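(* Let $\Bbbk$ be an algebraically closed field of characteristic $0$. Let $S$ be the Coble surface arising from the Hessian of the Sylvester non-degenerate cubic surface with parameters $(1,1,1,1,\frac1{16})$, let $C\subset S$ be its unique effective bi-anticanonical divisor (a smooth rational curve), and let $\bar g_{ab}\in\operatorname{Aut}(C)$ be the images of the ten involutions $g_{ab}\in\operatorname{Aut}(S)$ under restriction to $C$. Then there is an isomorphism $C\cong\mathbb P^1$ under which the four $\bar g_{a4}$ ($a=0,\dots,3$) correspond to the images in $\operatorname{PGL}_2(\Bbbk)$ of the quaternions $\pm i\pm j\pm k$, and the six remaining $\bar g_{ab}$ ($a,b\ne4$) correspond to the images in $\operatorname{PGL}_2(\Bbbk)$ of $\pm i\pm j$, $\pm j\pm k$ and $\pm k\pm i$.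
   Context: Put $(\lambda_0,\dots,\lambda_4)=(1,1,1,1,\frac1{16})$ and identify $\mathbb P^3$ with the hyperplane $\sum_{a=0}^4 y_a=0$ in $\mathbb P^4$. The Hessian $H\subset\mathbb P^3$ of the cubic surface $\sum_a\lambda_a y_a^3=0$ is the quartic $\sum_a\prod_{b\ne a}\lambda_b y_b=0$. For distinct $a,b$, $P_{ab}\in H$ is the point with $y_c=0$ for all $c\ne a,b$. The singular points of $H$ are the ten $P_{ab}$ and the "new node" $(1:1:1:1:-4)$, all ordinary nodes. Let $X$ be the minimal resolution of $H$ (a K3 surface). The birational involution $(y_a)\mapsto(1/(\lambda_a y_a))$ of $H$ induces a biregular involution $\sigma$ of $X$ whose fixed locus is the exceptional curve over the new node. $S=X/\langle\sigma\rangle$ is a smooth rational surface, and $C\subset S$ is the image of that exceptional curve; it is the unique effective divisor in $|-2K_S|$, so $\operatorname{Aut}(S)$ preserves it. Projection from $P_{ab}$ is a dominant rational map $H\dashrightarrow\mathbb P^2$ of degree 2; its covering involution induces an automorphism of $X$ commuting with $\sigma$, hence an involution $g_{ab}=g_{ba}\in\operatorname{Aut}(S)$. $\mathbb H$ is Hamilton's quaternion algebra over $\mathbb Q$ with standard basis $1,i,j,k$. Fix an isomorphism $\Bbbk\otimes\mathbb H\cong M_2(\Bbbk)$; the image of a nonzero quaternion in $\operatorname{PGL}_2(\Bbbk)$ is its image under $\mathbb H^*\to\operatorname{GL}_2(\Bbbk)\to\operatorname{PGL}_2(\Bbbk)$. (All sign choices are allowed; quaternions differing by an overall sign have the same image,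 so the two lists give 4 and 6 elements.) *)

theory Defs
  imports "HOL-Analysis.Analysis" "HOL-Computational_Algebra.Polynomial"
begin

section \<open>Varieties as spaces with functions\<close>

text \<open>
  A (classical, reduced) variety over an algebraically closed field is given by its set of closed
  points with the Zariski topology and, for every open set, the regular functions on it.
  Regular functions on \<open>U\<close> are represented by total functions of which only the values on \<open>U\<close> matter.
\<close>

record ('p, 'k) fspace =
  ztop :: "'p topology"
  reg :: "'p set \<Rightarrow> ('p \<Rightarrow> 'k) set"

abbreviation points :: "('p, 'k) fspace \<Rightarrow> 'p set" where
  "points X \<equiv> topspace (ztop X)"

definition morphism :: "('p, 'k) fspace \<Rightarrow> ('q, 'k) fspace \<Rightarrow> ('p \<Rightarrow> 'q) \<Rightarrow> bool" where
  "morphism X Y f \<longleftrightarrow> continuous_map (ztop X) (ztop Y) f \<and>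
     (\<forall>V h. openin (ztop Y) V \<longrightarrow> h \<in> reg Y V \<longrightarrow> h \<circ> f \<in> reg X {x \<in> points X. f x \<in> V})"

definition isomorphism :: "('p, 'k) fspace \<Rightarrow> ('q, 'k) fspace \<Rightarrow> ('p \<Rightarrow> 'q) \<Rightarrow> bool" where
  "isomorphism X Y f \<longleftrightarrow> morphism X Y f \<and>
     (\<exists>f'. morphism Y X f' \<and> (\<forall>x\<in>points X. f' (f x) = x) \<and> (\<forall>y\<in>points Y. f (f' y) = y))"

abbreviation automorphism :: "('p, 'k) fspace \<Rightarrow> ('p \<Rightarrow> 'p) \<Rightarrow> bool" where
  "automorphism X f \<equiv> isomorphism X X f"

text \<open>The automorphism of \<open>Y\<close> to which an automorphism \<open>f\<close> of \<open>X\<close> corresponds under \<open>\<phi> : X \<cong> Y\<close>.\<close>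

definition transport ::
    "('p, 'k) fspace \<Rightarrow> ('q, 'k) fspace \<Rightarrow> ('p \<Rightarrow> 'q) \<Rightarrow> ('p \<Rightarrow> 'p) \<Rightarrow> ('q \<Rightarrow> 'q)" where
  "transport X Y \<phi> f = restrict (\<phi> \<circ> f \<circ> the_inv_into (points X) \<phi>) (points Y)"

definition subspace_of :: "('p, 'k) fspace \<Rightarrow> 'p set \<Rightarrow> ('p, 'k) fspace" where
  "subspace_of X Z = \<lparr>
     ztop = subtopology (ztop X) Z,
     reg = (\<lambda>U. {f. \<forall>x\<in>U. \<exists>W h. openin (ztop X) W \<and> x \<in> W \<and> W \<inter> Z \<subseteq> U \<and> h \<in> reg X W \<and>
                     (\<forall>y\<in>W \<inter> Z. f y = h y)})\<rparr>"

definition quotient_topology :: "'p topology \<Rightarrow> ('p \<times> 'p) set \<Rightarrow> 'p set topology" where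
  "quotient_topology T r =
     topology (\<lambda>U. U \<subseteq> topspace T // r \<and> openin T {x \<in> topspace T. r `` {x} \<in> U})"

lemma openin_quotient_topology:
  "openin (quotient_topology T r) U \<longleftrightarrow>
     U \<subseteq> topspace T // r \<and> openin T {x \<in> topspace T. r `` {x} \<in> U}"
proof -
  have "istopology (\<lambda>U. U \<subseteq> topspace T // r \<and> openin T {x \<in> topspace T. r `` {x} \<in> U})"
    unfolding istopology_def
  proof (intro conjI allI impI)
    fix U V
    assume "U \<subseteq> topspace T // r \<and> openin T {x \<in> topspace T. r `` {x} \<in> U}"
      and "V \<subseteq> topspace T // r \<and> openin T {x \<in> topspace T. r `` {x} \<in> V}"
    moreover have "{x \<in> topspace T. r `` {x} \<in> U \<inter> V} =
        {x \<in> topspace T. r `` {x} \<in> U} \<inter> {x \<in> topspace T. r `` {x} \<in> V}" by auto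
    ultimately show "U \<inter> V \<subseteq> topspace T // r"
      and "openin T {x \<in> topspace T. r `` {x} \<in> U \<inter> V}" by auto
  next
    fix \<U>
    assume *: "\<forall>U\<in>\<U>. U \<subseteq> topspace T // r \<and> openin T {x \<in> topspace T. r `` {x} \<in> U}"
    show "\<Union>\<U> \<subseteq> topspace T // r" using * by blast
    have "{x \<in> topspace T. r `` {x} \<in> \<Union>\<U>} = (\<Union>U\<in>\<U>. {x \<in> topspace T. r `` {x} \<in> U})" by auto
    then show "openin T {x \<in> topspace T. r `` {x} \<in> \<Union>\<U>}" using * by auto
  qed
  then show ?thesis unfolding quotient_topology_def by simp
qed

text \<open>
  The quotient by an equivalence relation: a function is regular iff its pullback is.
  This gives \<open>X/G\<close> for a finite group \<open>G\<close>, and also projective spaces as quotients of cones.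
\<close>

definition quotient_space :: "('p, 'k) fspace \<Rightarrow> ('p \<times> 'p) set \<Rightarrow> ('p set, 'k) fspace" where
  "quotient_space X r = \<lparr>
     ztop = quotient_topology (ztop X) r,
     reg = (\<lambda>U. {f. (\<lambda>x. f (r `` {x})) \<in> reg X {x \<in> points X. r `` {x} \<in> U}})\<rparr>"

inductive_set polyfuns :: "('v \<Rightarrow> 'k::comm_ring_1) set \<Rightarrow> ('v \<Rightarrow> 'k) set"
  for K :: "('v \<Rightarrow> 'k) set" where
  const: "(\<lambda>_. c) \<in> polyfuns K"
| coord: "f \<in> K \<Longrightarrow> f \<in> polyfuns K"
| add: "f \<in> polyfuns K \<Longrightarrow> g \<in> polyfuns K \<Longrightarrow> (\<lambda>v. f v + g v) \<in> polyfuns K"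
| mult: "f \<in> polyfuns K \<Longrightarrow> g \<in> polyfuns K \<Longrightarrow> (\<lambda>v. f v * g v) \<in> polyfuns K"

text \<open>
  \<open>affine_part A K\<close> is the subset \<open>A\<close> of the affine space with coordinate functions \<open>K\<close>; its regular
  functions are the functions that locally are quotients of polynomials.
\<close>

definition affine_part :: "'v set \<Rightarrow> ('v \<Rightarrow> 'k::field) set \<Rightarrow> ('v, 'k) fspace" where
  "affine_part A K = (let T = topology_generated_by {{x \<in> A. f x \<noteq> 0} | f. f \<in> polyfuns K} in \<lparr>
     ztop = T,
     reg = (\<lambda>U. {f. \<forall>x\<in>U. \<exists>W P Q. openin T W \<and> x \<in> W \<and> W \<subseteq> U \<and>
                     P \<in> polyfuns K \<and> Q \<in> polyfuns K \<and>
                     (\<forall>y\<in>W. Q y \<noteq> 0 \<and> f y = P y / Q y)})\<rparr>)"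


section \<open>Projective spaces and blow-ups of points\<close>

definition prop_rel :: "(('k::field ^ 'n) \<times> ('k ^ 'n)) set" where
  "prop_rel = {(v, w). v \<noteq> 0 \<and> (\<exists>c. c \<noteq> 0 \<and> w = c *s v)}"

definition proj_space :: "(('k::field ^ 'n) set, 'k) fspace" where
  "proj_space = quotient_space (affine_part (- {0}) {\<lambda>v. v $ i | i. True}) prop_rel"

text \<open>A point of projective space is thus the set of all its homogeneous coordinate vectors.\<close>

definition pt :: "'k::field ^ 'n \<Rightarrow> ('k ^ 'n) set" where
  "pt v = prop_rel `` {v}"

text \<open>
  Let \<open>p\<close> be a point of \<open>P(V)\<close> and \<open>L\<close> the line in \<open>V\<close> that it spans. Projection from \<open>p\<close> takes
  \<open>P(V) - {p}\<close> to \<open>P(V/L)\<close>, whose points are represented by the preimages in \<open>V - L\<close> of the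
  punctured lines of \<open>V/L\<close>.
\<close>

definition project_from :: "('k::field ^ 'n) set \<Rightarrow> ('k ^ 'n) set \<Rightarrow> ('k ^ 'n) set" where
  "project_from p P = {v + u | v u. v \<in> P \<and> u \<in> insert 0 p}"

text \<open>
  \<open>blowup H Z\<close> is the blow-up of a closed subset \<open>H\<close> of \<open>P(V)\<close> in a finite set \<open>Z\<close> of (reduced)
  points: the closure in \<open>P(V) \<times> (\<Prod>p\<in>Z. P(V/L\<^sub>p))\<close>, where \<open>L\<^sub>p\<close> is the line of \<open>p\<close>, of the graph of
  the projections from the points of \<open>Z\<close> on \<open>H - Z\<close>. The ambient product is the quotient of the set
  of all \<open>(x, w)\<close> with \<open>0 \<noteq> x \<in> V\<close> and \<open>w p \<in> V - L\<^sub>p\<close> for \<open>p \<in> Z\<close>, where \<open>x\<close> may be rescaled, and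
  \<open>w p\<close> rescaled and changed by a vector of \<open>L\<^sub>p\<close>.
\<close>

type_synonym ('k, 'n) blowup_cone = "('k ^ 'n) \<times> (('k ^ 'n) set \<Rightarrow> 'k ^ 'n)"

definition blowup_cone :: "('k::field ^ 'n) set set \<Rightarrow> ('k, 'n) blowup_cone set" where
  "blowup_cone Z = {(x, w). x \<noteq> 0 \<and> w \<in> (\<Pi>\<^sub>E p\<in>Z. - insert 0 p)}"

definition blowup_coords :: "('k::field ^ 'n) set set \<Rightarrow> (('k, 'n) blowup_cone \<Rightarrow> 'k) set" where
  "blowup_coords Z = {\<lambda>(x, w). x $ i | i. True} \<union> {\<lambda>(x, w). w p $ i | p i. p \<in> Z}"

definition blowup_rel ::
    "('k::field ^ 'n) set set \<Rightarrow> (('k, 'n) blowup_cone \<times> ('k, 'n) blowup_cone) set" where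
  "blowup_rel Z = {((x, w), (x', w')).
     (x, w) \<in> blowup_cone Z \<and> (x', w') \<in> blowup_cone Z \<and>
     (\<exists>c. c \<noteq> 0 \<and> x' = c *s x) \<and>
     (\<forall>p\<in>Z. \<exists>c u. c \<noteq> 0 \<and> u \<in> insert 0 p \<and> w' p = c *s w p + u)}"

definition blowup_ambient ::
    "('k::field ^ 'n) set set \<Rightarrow> (('k, 'n) blowup_cone set, 'k) fspace" where
  "blowup_ambient Z =
     quotient_space (affine_part (blowup_cone Z) (blowup_coords Z)) (blowup_rel Z)"

definition blowup ::
    "('k::field ^ 'n) set set \<Rightarrow> ('k ^ 'n) set set \<Rightarrow> (('k, 'n) blowup_cone set, 'k) fspace" where
  "blowup H Z = subspace_of (blowup_ambient Z)
     (ztop (blowup_ambient Z) closure_of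
        {blowup_rel Z `` {(x, \<lambda>p\<in>Z. x)} | x. x \<noteq> 0 \<and> pt x \<in> H - Z})"

text \<open>The blow-down map: the first components of a class form a point of \<open>P(V)\<close>.\<close>

definition blow_down :: "('k::field, 'n) blowup_cone set \<Rightarrow> ('k ^ 'n) set" where
  "blow_down \<xi> = fst ` \<xi>"


section \<open>The Hessian quartic and its Coble surface\<close>

text \<open>The five coordinates are indexed by the numeral type \<open>5\<close>, whose elements are \<open>0, 1, 2, 3, 4\<close>.\<close>

definition lam :: "5 \<Rightarrow> 'k::field" where
  "lam a = (if a = 4 then 1 / 16 else 1)"

definition quartic :: "'k::field ^ 5 \<Rightarrow> 'k" where
  "quartic y = (\<Sum>a\<in>UNIV. \<Prod>b\<in>UNIV - {a}. lam b * y $ b)"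

definition Hessian :: "('k::field ^ 5) set set" where
  "Hessian = {pt y | y. y \<noteq> 0 \<and> (\<Sum>a\<in>UNIV. y $ a) = 0 \<and> quartic y = 0}"

text \<open>
  The singular points of the Hessian, as a surface in the hyperplane \<open>\<Sum>y\<^sub>a = 0\<close>, are its points of
  multiplicity at least 2: on every line of the hyperplane through the point, the quartic form
  vanishes there to order at least 2.
\<close>

definition Hessian_singular :: "('k::field ^ 5) set set" where
  "Hessian_singular = {P \<in> Hessian. \<forall>y\<in>P. \<forall>v. (\<Sum>a\<in>UNIV. v $ a) = 0 \<longrightarrow>
     (\<exists>G. \<forall>t. quartic (y + t *s v) = t\<^sup>2 * poly G t)}"

definition P_node :: "5 \<Rightarrow> 5 \<Rightarrow> ('k::field ^ 5) set" where
  "P_node a b = pt (\<chi> c. if c = a then 1 else if c = b then - 1 else 0)"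

definition new_node :: "('k::field ^ 5) set" where
  "new_node = pt (\<chi> a. if a = 4 then - 4 else 1)"

text \<open>
  All singular points of the Hessian are ordinary nodes, so its minimal resolution is obtained by
  blowing them up.
\<close>

type_synonym 'k xpoint = "('k, 5) blowup_cone set"

definition X_surface :: "('k::field xpoint, 'k) fspace" where
  "X_surface = blowup Hessian Hessian_singular"

definition induced_by_cremona :: "('k::field xpoint \<Rightarrow> 'k xpoint) \<Rightarrow> bool" where
  "induced_by_cremona \<sigma> \<longleftrightarrow> automorphism X_surface \<sigma> \<and>
     (\<forall>\<xi>\<in>points X_surface. \<sigma> (\<sigma> \<xi>) = \<xi>) \<and>
     (\<forall>\<xi>\<in>points X_surface. \<forall>y. blow_down \<xi> = pt y \<longrightarrow> (\<forall>a. y $ a \<noteq> 0) \<longrightarrow>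
        blow_down (\<sigma> \<xi>) = pt (\<chi> a. 1 / (lam a * y $ a)))"

definition sigma_rel :: "('k::field xpoint \<Rightarrow> 'k xpoint) \<Rightarrow> ('k xpoint \<times> 'k xpoint) set" where
  "sigma_rel \<sigma> = {(\<xi>, \<eta>). \<xi> \<in> points X_surface \<and> (\<eta> = \<xi> \<or> \<eta> = \<sigma> \<xi>)}"

definition S_surface :: "('k::field xpoint \<Rightarrow> 'k xpoint) \<Rightarrow> ('k xpoint set, 'k) fspace" where
  "S_surface \<sigma> = quotient_space X_surface (sigma_rel \<sigma>)"

definition quotient_map_S ::
    "('k::field xpoint \<Rightarrow> 'k xpoint) \<Rightarrow> 'k xpoint \<Rightarrow> 'k xpoint set" where
  "quotient_map_S \<sigma> \<xi> = sigma_rel \<sigma> `` {\<xi>}"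

text \<open>The bi-anticanonical curve: the image in \<open>S\<close> of the exceptional curve over the new node.\<close>

definition C_curve :: "('k::field xpoint \<Rightarrow> 'k xpoint) \<Rightarrow> ('k xpoint set, 'k) fspace" where
  "C_curve \<sigma> = subspace_of (S_surface \<sigma>)
     (quotient_map_S \<sigma> ` {\<xi> \<in> points X_surface. blow_down \<xi> = new_node})"

text \<open>
  The covering involution of the projection from \<open>p\<close>, a generically two-to-one rational map,
  interchanges the two points of its general fibre.
\<close>

definition covering_involution ::
    "('k::field ^ 5) set \<Rightarrow> ('k xpoint \<Rightarrow> 'k xpoint) \<Rightarrow> bool" where
  "covering_involution p \<gamma> \<longleftrightarrow> automorphism X_surface \<gamma> \<and>
     (\<forall>\<xi>\<in>points X_surface. \<gamma> (\<gamma> \<xi>) = \<xi>) \<and>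
     (\<exists>U. openin (ztop X_surface) U \<and> ztop X_surface closure_of U = points X_surface \<and>
        (\<forall>\<xi>\<in>U. blow_down \<xi> \<noteq> p \<and> blow_down (\<gamma> \<xi>) \<noteq> p \<and> \<gamma> \<xi> \<noteq> \<xi> \<and>
           project_from p (blow_down (\<gamma> \<xi>)) = project_from p (blow_down \<xi>)))"

definition induced_projection_involution ::
    "('k::field xpoint \<Rightarrow> 'k xpoint) \<Rightarrow> ('k ^ 5) set \<Rightarrow> ('k xpoint set \<Rightarrow> 'k xpoint set) \<Rightarrow> bool"
  where
  "induced_projection_involution \<sigma> p g \<longleftrightarrow> automorphism (S_surface \<sigma>) g \<and>
     (\<exists>\<gamma>. covering_involution p \<gamma> \<and>
        (\<forall>\<xi>\<in>points X_surface. \<gamma> (\<sigma> \<xi>) = \<sigma> (\<gamma> \<xi>)) \<and>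
        (\<forall>\<xi>\<in>points X_surface. g (quotient_map_S \<sigma> \<xi>) = quotient_map_S \<sigma> (\<gamma> \<xi>)))"


section \<open>Quaternions and \<open>PGL\<^sub>2\<close>\<close>

datatype 'a quat = Quat (q_re: 'a) (q_i: 'a) (q_j: 'a) (q_k: 'a)

instantiation quat :: (comm_ring_1) ring_1
begin

definition "0 = Quat 0 0 0 0"
definition "1 = Quat 1 0 0 0"
definition "x + y = Quat (q_re x + q_re y) (q_i x + q_i y) (q_j x + q_j y) (q_k x + q_k y)"
definition "- x = Quat (- q_re x) (- q_i x) (- q_j x) (- q_k x)"
definition "x - y = Quat (q_re x - q_re y) (q_i x - q_i y) (q_j x - q_j y) (q_k x - q_k y)"
definition "x * y = Quat
  (q_re x * q_re y - q_i x * q_i y - q_j x * q_j y - q_k x * q_k y)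
  (q_re x * q_i y + q_i x * q_re y + q_j x * q_k y - q_k x * q_j y)
  (q_re x * q_j y - q_i x * q_k y + q_j x * q_re y + q_k x * q_i y)
  (q_re x * q_k y + q_i x * q_j y - q_j x * q_i y + q_k x * q_re y)"

instance
  by standard
    (auto simp: zero_quat_def one_quat_def plus_quat_def uminus_quat_def minus_quat_def
      times_quat_def algebra_simps quat.expand)

end

definition quat_scale :: "'a::comm_ring_1 \<Rightarrow> 'a quat \<Rightarrow> 'a quat" where
  "quat_scale c = map_quat ((*) c)"

definition quat_i :: "'a::comm_ring_1 quat" where "quat_i = Quat 0 1 0 0"
definition quat_j :: "'a::comm_ring_1 quat" where "quat_j = Quat 0 0 1 0"
definition quat_k :: "'a::comm_ring_1 quat" where "quat_k = Quat 0 0 0 1"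

text \<open>
  Hamilton's algebra over the rationals is \<open>rat quat\<close>; its base change to \<open>'k\<close> is \<open>'k quat\<close>, with
  \<open>map_quat of_rat\<close> as the natural map.
\<close>

definition quat_matrix_iso :: "('k::field quat \<Rightarrow> 'k ^ 2 ^ 2) \<Rightarrow> bool" where
  "quat_matrix_iso \<Phi> \<longleftrightarrow> bij \<Phi> \<and> \<Phi> 1 = mat 1 \<and>
     (\<forall>x y. \<Phi> (x + y) = \<Phi> x + \<Phi> y) \<and> (\<forall>x y. \<Phi> (x * y) = \<Phi> x ** \<Phi> y) \<and>
     (\<forall>c x. \<Phi> (quat_scale c x) = (\<chi> i j. c * \<Phi> x $ i $ j))"

text \<open>Elements of \<open>PGL\<^sub>2\<close> are classes of invertible matrices up to nonzero scalars.\<close>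

definition pgl_class :: "'k::field ^ 2 ^ 2 \<Rightarrow> ('k ^ 2 ^ 2) set" where
  "pgl_class A = {\<chi> i j. c * A $ i $ j | c. c \<noteq> 0}"

definition pgl_act :: "('k::field ^ 2 ^ 2) set \<Rightarrow> ('k ^ 2) set \<Rightarrow> ('k ^ 2) set" where
  "pgl_act m = (\<lambda>P\<in>points proj_space. {A *v v | A v. A \<in> m \<and> v \<in> P})"

text \<open>
  The image of a nonzero rational quaternion in \<open>PGL\<^sub>2\<close>, as an automorphism of the projective line.
\<close>

definition pgl_of_quat ::
    "('k::field_char_0 quat \<Rightarrow> 'k ^ 2 ^ 2) \<Rightarrow> rat quat \<Rightarrow> ('k ^ 2) set \<Rightarrow> ('k ^ 2) set" where
  "pgl_of_quat \<Phi> q = pgl_act (pgl_class (\<Phi> (map_quat of_rat q)))"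

end

theory Submission
  imports Defs
begin

text \<open>
  Write a point of the hyperplane as \<open>s\<close> times the new node plus \<open>u\<close> with \<open>u\<^sub>4 = 0\<close>. The Hessian becomes
  \<open>2 s\<^sup>2 e\<^sub>2(u) + 3 s e\<^sub>3(u) + 4 e\<^sub>4(u) = 0\<close>, so the exceptional curve over the node is the conic
  \<open>e\<^sub>1 = e\<^sub>2 = 0\<close>, that is \<open>x\<^sup>2 + y\<^sup>2 + z\<^sup>2 = 0\<close> for \<open>x = u\<^sub>0 + u\<^sub>1\<close>, \<open>y = u\<^sub>0 + u\<^sub>2\<close>, \<open>z = u\<^sub>0 + u\<^sub>3\<close>.
  An automorphism of the resolution is determined on this conic by continuity: wherever its effect on
  the directions at the node is given by polynomials on a set accumulating at the curve, the same
  polynomials give it on the curve. The Cremona involution acts on the tangent space at the node as \<open>-1\<close>,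
  so it fixes the conic pointwise, and the covering involution of the projection from \<open>P\<^sub>a\<^sub>b\<close> acts as the
  reflection in the image \<open>d\<close> of \<open>e\<^sub>a - e\<^sub>b\<close>. Viewing \<open>(x, y, z)\<close> as a pure quaternion \<open>n\<close>, the points of the
  conic are the nilpotent matrices up to scalars, identified with the projective line by their
  images, and the reflection \<open>n \<mapsto> d n d\<close> acts on images through the matrix of \<open>d\<close>.
\<close>

section \<open>Spaces with functions\<close>

text \<open>The automorphisms enter as hypotheses, not as formulas: they are regular on the whole
  surface, but only their effect on images in the Hessian is described, for the projections merely
  on some unspecified dense open set that may miss the exceptional curve. So points of that set are
  needed arbitrarily near every point of the curve, subject to several inequalities at once; most of
  the preparation serves this. The new node is a fixed point of the Cremona map: such points have
  \<open>lam a * (y $ a)\<^sup>2\<close> constant, hence coordinates 1, 1, 1, 1, 4 up to signs and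
  scale, and the signs of the node give sum 0. On vectors with \<open>u $ 4 = 0\<close> and
  coordinate sum 0 the passage to (x, y, z) is an isometry, since x^2 + y^2 + z^2 is the sum of the
  squares of the coordinates of u. It takes the basis vectors e_0, ..., e_3, made sum-free, to the
  vertices of a regular tetrahedron inscribed in a cube, and their differences to its edges. These
  are the long diagonals and the face diagonals of the cube, hence the two lists of
  quaternions.\<close>

locale function_sheaf =
  fixes X :: "('p, 'k::comm_ring_1) fspace"
  assumes reg_restrict: "\<And>f U W. f \<in> reg X U \<Longrightarrow> openin (ztop X) W \<Longrightarrow> W \<subseteq> U \<Longrightarrow> f \<in> reg X W"
    and reg_glue: "\<And>U f. (\<And>x. x \<in> U \<Longrightarrow> \<exists>W h. openin (ztop X) W \<and> x \<in> W \<and> W \<subseteq> U \<and> h \<in> reg X W \<and>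
      (\<forall>y\<in>W. f y = h y)) \<Longrightarrow> f \<in> reg X U"
    and reg_const: "\<And>U c. openin (ztop X) U \<Longrightarrow> (\<lambda>_. c) \<in> reg X U"
    and reg_add: "\<And>U f g. f \<in> reg X U \<Longrightarrow> g \<in> reg X U \<Longrightarrow> (\<lambda>x. f x + g x) \<in> reg X U"
    and reg_mult: "\<And>U f g. f \<in> reg X U \<Longrightarrow> g \<in> reg X U \<Longrightarrow> (\<lambda>x. f x * g x) \<in> reg X U"

lemmas reg_restrict = function_sheaf.reg_restrict
  and reg_glue = function_sheaf.reg_glue
  and reg_const = function_sheaf.reg_const
  and reg_add = function_sheaf.reg_add
  and reg_mult = function_sheaf.reg_mult

text \<open>Regular functions are total functions whose values off the open set carry no meaning;
  gluing over the one-set cover by \<open>U\<close> shows that only the values on \<open>U\<close>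
  decide.\<close>

lemma reg_cong:
  assumes "function_sheaf X" "openin (ztop X) U" "f \<in> reg X U" "\<And>x. x \<in> U \<Longrightarrow> g x = f x"
  shows "g \<in> reg X U"
  using assms by (intro reg_glue[OF assms(1)]) blast

lemma morphism_preimage:
  assumes "morphism X Y f" "openin (ztop Y) V"
  shows "openin (ztop X) {x \<in> points X. f x \<in> V}"
  using assms unfolding morphism_def by (auto intro: openin_continuous_map_preimage)

lemma morphism_reg:
  assumes "morphism X Y f" "openin (ztop Y) V" "h \<in> reg Y V"
  shows "h \<circ> f \<in> reg X {x \<in> points X. f x \<in> V}"
  using assms unfolding morphism_def by auto

lemma morphism_points: "morphism X Y f \<Longrightarrow> x \<in> points X \<Longrightarrow> f x \<in> points Y"
  unfolding morphism_def by (auto simp: continuous_map_def)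

lemma morphismI:
  assumes "\<And>x. x \<in> points X \<Longrightarrow> f x \<in> points Y"
    and "\<And>V. openin (ztop Y) V \<Longrightarrow> openin (ztop X) {x \<in> points X. f x \<in> V}"
    and "\<And>V h. openin (ztop Y) V \<Longrightarrow> h \<in> reg Y V \<Longrightarrow> h \<circ> f \<in> reg X {x \<in> points X. f x \<in> V}"
  shows "morphism X Y f"
  using assms unfolding morphism_def by (auto simp: continuous_map_def)

lemma morphism_comp:
  assumes f: "morphism X Y f" and g: "morphism Y Z g"
  shows "morphism X Z (g \<circ> f)"
proof -
  have eq: "{x \<in> points X. (g \<circ> f) x \<in> V} = {x \<in> points X. f x \<in> {y \<in> points Y. g y \<in> V}}" for V
    using morphism_points[OF f] by auto
  show ?thesis
  proof (rule morphismI)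
    show "(g \<circ> f) x \<in> points Z" if "x \<in> points X" for x
      using that by (simp add: morphism_points[OF f] morphism_points[OF g])
    show "openin (ztop X) {x \<in> points X. (g \<circ> f) x \<in> V}" if "openin (ztop Z) V" for V
      unfolding eq by (rule morphism_preimage[OF f morphism_preimage[OF g that]])
    show "h \<circ> (g \<circ> f) \<in> reg X {x \<in> points X. (g \<circ> f) x \<in> V}"
      if "openin (ztop Z) V" "h \<in> reg Z V" for V h
      unfolding eq comp_assoc[symmetric]
      by (rule morphism_reg[OF f morphism_preimage[OF g that(1)] morphism_reg[OF g that]])
  qed
qed

lemma morphism_cong:
  assumes X: "function_sheaf X" and f: "morphism X Y f" and eq: "\<And>x. x \<in> points X \<Longrightarrow> g x = f x"
  shows "morphism X Y g"
proof (rule morphismI)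
  show "g x \<in> points Y" if "x \<in> points X" for x using that eq morphism_points[OF f] by simp
  have sets: "{x \<in> points X. g x \<in> V} = {x \<in> points X. f x \<in> V}" for V using eq by auto
  show "openin (ztop X) {x \<in> points X. g x \<in> V}" if "openin (ztop Y) V" for V
    using morphism_preimage[OF f that] by (simp add: sets)
  show "h \<circ> g \<in> reg X {x \<in> points X. g x \<in> V}" if "openin (ztop Y) V" "h \<in> reg Y V" for V h
    unfolding sets
    by (rule reg_cong[OF X morphism_preimage[OF f that(1)] morphism_reg[OF f that]]) (auto simp: eq)
qed

text \<open>Being a morphism is local on the source. This serves maps given by different formulas on
  different open sets, as when the image of a rank-one matrix is read off by applying it to a vector
  that works only nearby.\<close>

lemma morphism_local:
  assumes X: "function_sheaf X"
    and pts: "\<And>x. x \<in> points X \<Longrightarrow> f x \<in> points Y"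
    and loc: "\<And>x. x \<in> points X \<Longrightarrow> \<exists>W F. openin (ztop X) W \<and> x \<in> W \<and>
      (\<forall>V. openin (ztop Y) V \<longrightarrow> openin (ztop X) {y \<in> W. F y \<in> V}) \<and>
      (\<forall>V h. openin (ztop Y) V \<longrightarrow> h \<in> reg Y V \<longrightarrow> h \<circ> F \<in> reg X {y \<in> W. F y \<in> V}) \<and>
      (\<forall>y\<in>W. f y = F y)"
  shows "morphism X Y f"
proof (rule morphismI)
  fix V assume V: "openin (ztop Y) V"
  show "openin (ztop X) {x \<in> points X. f x \<in> V}"
    unfolding openin_subopen[of "ztop X" "{x \<in> points X. f x \<in> V}"]
  proof
    fix x assume x: "x \<in> {x \<in> points X. f x \<in> V}"
    then obtain W F where W: "openin (ztop X) W" "x \<in> W" "openin (ztop X) {y \<in> W. F y \<in> V}"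
      "\<forall>y\<in>W. f y = F y" using loc[of x] V by blast
    then show "\<exists>T. openin (ztop X) T \<and> x \<in> T \<and> T \<subseteq> {x \<in> points X. f x \<in> V}"
      using x openin_subset[OF W(1)] by (intro exI[of _ "{y \<in> W. F y \<in> V}"]) auto
  qed
  fix h assume h: "h \<in> reg Y V"
  show "h \<circ> f \<in> reg X {x \<in> points X. f x \<in> V}"
  proof (rule reg_glue[OF X])
    fix x assume x: "x \<in> {x \<in> points X. f x \<in> V}"
    then obtain W F where W: "openin (ztop X) W" "x \<in> W" "openin (ztop X) {y \<in> W. F y \<in> V}"
      "h \<circ> F \<in> reg X {y \<in> W. F y \<in> V}"
      "\<forall>y\<in>W. f y = F y" using loc[of x] V h by blast
    then show "\<exists>U k. openin (ztop X) U \<and> x \<in> U \<and> U \<subseteq> {x \<in> points X. f x \<in> V} \<and> k \<in> reg X U \<and>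
        (\<forall>y\<in>U. (h \<circ> f) y = k y)"
      using x openin_subset[OF W(1)]
      by (intro exI[of _ "{y \<in> W. F y \<in> V}"] exI[of _ "h \<circ> F"]) auto
  qed
qed (rule pts)

lemma isomorphism_bij_betw:
  assumes "isomorphism X Y f"
  shows "bij_betw f (points X) (points Y)"
proof -
  obtain f' where f: "morphism X Y f" and f': "morphism Y X f'"
    "\<forall>x\<in>points X. f' (f x) = x" "\<forall>y\<in>points Y. f (f' y) = y"
    using assms unfolding isomorphism_def by blast
  show ?thesis
    by (rule bij_betw_byWitness[where f' = f'])
      (use f' morphism_points[OF f] morphism_points[OF f'(1)] in auto)
qed


subsection \<open>Subspaces\<close>

lemma openin_subspace_of:
  "openin (ztop (subspace_of X Z)) U \<longleftrightarrow> (\<exists>W. openin (ztop X) W \<and> U = W \<inter> Z)"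
  by (simp add: subspace_of_def openin_subtopology)

lemma points_subspace_of: "points (subspace_of X Z) = points X \<inter> Z"
  by (simp add: subspace_of_def)

lemma reg_subspace_of:
  "f \<in> reg (subspace_of X Z) U \<longleftrightarrow> (\<forall>x\<in>U. \<exists>W h. openin (ztop X) W \<and> x \<in> W \<and> W \<inter> Z \<subseteq> U \<and>
     h \<in> reg X W \<and> (\<forall>y\<in>W \<inter> Z. f y = h y))"
  by (simp add: subspace_of_def)

lemma reg_subspace_ofI:
  assumes "h \<in> reg X W" "openin (ztop X) W" "U = W \<inter> Z" "\<And>y. y \<in> U \<Longrightarrow> f y = h y"
  shows "f \<in> reg (subspace_of X Z) U"
  using assms unfolding reg_subspace_of by blast

lemma reg_subspace_ofE:
  assumes "f \<in> reg (subspace_of X Z) U" "x \<in> U"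
  obtains W h where "openin (ztop X) W" "x \<in> W" "W \<inter> Z \<subseteq> U" "h \<in> reg X W" "\<forall>y\<in>W \<inter> Z. f y = h y"
  using bspec[OF assms(1)[unfolded reg_subspace_of] assms(2)] by (elim exE conjE) (rule that)

lemma function_sheaf_subspace_of:
  assumes X: "function_sheaf X"
  shows "function_sheaf (subspace_of X Z)"
proof (rule function_sheaf.intro)
  fix U W f assume f: "f \<in> reg (subspace_of X Z) U" and W: "openin (ztop (subspace_of X Z)) W" "W \<subseteq> U"
  then obtain O' where O': "openin (ztop X) O'" "W = O' \<inter> Z" by (auto simp: openin_subspace_of)
  show "f \<in> reg (subspace_of X Z) W"
    unfolding reg_subspace_of
  proof
    fix x assume x: "x \<in> W"
    with W(2) have "x \<in> U" by auto
    with f obtain V h where V: "openin (ztop X) V" "x \<in> V" "h \<in> reg X V" "\<forall>y\<in>V \<inter> Z. f y = h y"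
      by (rule reg_subspace_ofE)
    have "openin (ztop X) (V \<inter> O')" using V O' by blast
    then show "\<exists>W' h. openin (ztop X) W' \<and> x \<in> W' \<and> W' \<inter> Z \<subseteq> W \<and> h \<in> reg X W' \<and> (\<forall>y\<in>W' \<inter> Z. f y = h y)"
      using V O' x reg_restrict[OF X V(3), of "V \<inter> O'"] by (intro exI[of _ "V \<inter> O'"] exI[of _ h]) auto
  qed
next
  fix U f
  assume loc: "\<And>x. x \<in> U \<Longrightarrow> \<exists>W h. openin (ztop (subspace_of X Z)) W \<and> x \<in> W \<and> W \<subseteq> U \<and>
    h \<in> reg (subspace_of X Z) W \<and> (\<forall>y\<in>W. f y = h y)"
  show "f \<in> reg (subspace_of X Z) U"
    unfolding reg_subspace_of
  proof
    fix x assume "x \<in> U"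
    from loc[OF this] obtain W h where W: "openin (ztop (subspace_of X Z)) W" "x \<in> W" "W \<subseteq> U"
      "h \<in> reg (subspace_of X Z) W" "\<forall>y\<in>W. f y = h y" by (elim exE conjE) (rule that)
    obtain W' h' where "openin (ztop X) W'" "x \<in> W'" "W' \<inter> Z \<subseteq> W" "h' \<in> reg X W'"
      "\<forall>y\<in>W' \<inter> Z. h y = h' y" by (rule reg_subspace_ofE[OF W(4,2)])
    then show "\<exists>W h. openin (ztop X) W \<and> x \<in> W \<and> W \<inter> Z \<subseteq> U \<and> h \<in> reg X W \<and> (\<forall>y\<in>W \<inter> Z. f y = h y)"
      using W by (intro exI[of _ W'] exI[of _ h']) auto
  qed
next
  fix U and c :: 'b assume "openin (ztop (subspace_of X Z)) U"
  then show "(\<lambda>_. c) \<in> reg (subspace_of X Z) U"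
    by (auto simp: openin_subspace_of intro: reg_subspace_ofI[OF reg_const[OF X]])
next
  fix U f g assume *: "f \<in> reg (subspace_of X Z) U" "g \<in> reg (subspace_of X Z) U"
  have both: "\<exists>W h k. openin (ztop X) W \<and> x \<in> W \<and> W \<inter> Z \<subseteq> U \<and> h \<in> reg X W \<and> k \<in> reg X W \<and>
      (\<forall>y\<in>W \<inter> Z. f y = h y \<and> g y = k y)" if x: "x \<in> U" for x
  proof -
    obtain V h where V: "openin (ztop X) V" "x \<in> V" "V \<inter> Z \<subseteq> U" "h \<in> reg X V" "\<forall>y\<in>V \<inter> Z. f y = h y"
      by (rule reg_subspace_ofE[OF *(1) x])
    obtain V' k where V': "openin (ztop X) V'" "x \<in> V'" "k \<in> reg X V'" "\<forall>y\<in>V' \<inter> Z. g y = k y"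
      by (rule reg_subspace_ofE[OF *(2) x])
    have "openin (ztop X) (V \<inter> V')" using V V' by blast
    then show ?thesis using V V' reg_restrict[OF X V(4), of "V \<inter> V'"] reg_restrict[OF X V'(3), of "V \<inter> V'"]
      by (intro exI[of _ "V \<inter> V'"] exI[of _ h] exI[of _ k]) auto
  qed
  show "(\<lambda>x. f x + g x) \<in> reg (subspace_of X Z) U"
    unfolding reg_subspace_of using both reg_add[OF X] by (metis (no_types, lifting))
  show "(\<lambda>x. f x * g x) \<in> reg (subspace_of X Z) U"
    unfolding reg_subspace_of using both reg_mult[OF X] by (metis (no_types, lifting))
qed

lemma morphism_inclusion:
  assumes X: "function_sheaf X"
  shows "morphism (subspace_of X Z) X (\<lambda>x. x)"
proof (rule morphismI)
  have eq: "{x \<in> points (subspace_of X Z). x \<in> V} = V \<inter> Z" if "openin (ztop X) V" for V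
    using openin_subset[OF that] by (auto simp: points_subspace_of)
  show "openin (ztop (subspace_of X Z)) {x \<in> points (subspace_of X Z). x \<in> V}"
    if "openin (ztop X) V" for V using that by (auto simp: eq openin_subspace_of)
  show "h \<circ> (\<lambda>x. x) \<in> reg (subspace_of X Z) {x \<in> points (subspace_of X Z). x \<in> V}"
    if "openin (ztop X) V" "h \<in> reg X V" for V h
    using that by (auto simp: eq intro: reg_subspace_ofI)
qed (simp add: points_subspace_of)

lemma morphism_into_subspace:
  assumes X: "function_sheaf X" and f: "morphism X Y f" and Z: "\<And>x. x \<in> points X \<Longrightarrow> f x \<in> Z"
  shows "morphism X (subspace_of Y Z) f"
proof (rule morphismI)
  show "f x \<in> points (subspace_of Y Z)" if "x \<in> points X" for x
    using that Z morphism_points[OF f] by (auto simp: points_subspace_of)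
  fix V assume "openin (ztop (subspace_of Y Z)) V"
  then obtain W where W: "openin (ztop Y) W" "V = W \<inter> Z" by (auto simp: openin_subspace_of)
  have eq: "{x \<in> points X. f x \<in> V} = {x \<in> points X. f x \<in> W}" using W Z by auto
  show *: "openin (ztop X) {x \<in> points X. f x \<in> V}" unfolding eq by (rule morphism_preimage[OF f W(1)])
  fix h assume h: "h \<in> reg (subspace_of Y Z) V"
  show "h \<circ> f \<in> reg X {x \<in> points X. f x \<in> V}"
  proof (rule reg_glue[OF X])
    fix x assume x: "x \<in> {x \<in> points X. f x \<in> V}"
    then have "f x \<in> V" by simp
    with h obtain O' k where O': "openin (ztop Y) O'" "f x \<in> O'" "O' \<inter> Z \<subseteq> V" "k \<in> reg Y O'"
      "\<forall>y\<in>O' \<inter> Z. h y = k y" by (rule reg_subspace_ofE)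
    show "\<exists>W g. openin (ztop X) W \<and> x \<in> W \<and> W \<subseteq> {x \<in> points X. f x \<in> V} \<and> g \<in> reg X W \<and>
        (\<forall>y\<in>W. (h \<circ> f) y = g y)"
      using O' x Z morphism_preimage[OF f O'(1)] morphism_reg[OF f O'(1,4)]
      by (intro exI[of _ "{x \<in> points X. f x \<in> O'}"] exI[of _ "k \<circ> f"]) auto
  qed
qed

lemma morphism_subspaces:
  assumes X: "function_sheaf X" and f: "morphism X Y f"
    and Z: "\<And>x. x \<in> points X \<Longrightarrow> x \<in> Z \<Longrightarrow> f x \<in> Z'"
  shows "morphism (subspace_of X Z) (subspace_of Y Z') f"
proof -
  have "morphism (subspace_of X Z) Y f"
    using morphism_comp[OF morphism_inclusion[OF X] f, of Z] by (simp add: comp_def)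
  then show ?thesis
    by (rule morphism_into_subspace[OF function_sheaf_subspace_of[OF X]])
      (auto simp: points_subspace_of Z)
qed

text \<open>An involution is its own inverse, so stability of \<open>Z\<close> in one direction
  already gives an automorphism of the subspace.\<close>

lemma automorphism_subspace:
  assumes X: "function_sheaf X" and f: "automorphism X f"
    and Z: "\<And>x. x \<in> points X \<Longrightarrow> x \<in> Z \<Longrightarrow> f x \<in> Z"
    and inv: "\<And>x. x \<in> points X \<Longrightarrow> f (f x) = x"
  shows "automorphism (subspace_of X Z) f"
proof -
  have "morphism (subspace_of X Z) (subspace_of X Z) f"
    using f Z by (intro morphism_subspaces[OF X]) (auto simp: isomorphism_def)
  then show ?thesis unfolding isomorphism_def using inv by (auto simp: points_subspace_of)
qed


subsection \<open>Quotients\<close>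

lemma openin_quotient_space:
  "openin (ztop (quotient_space X r)) U \<longleftrightarrow>
     U \<subseteq> points X // r \<and> openin (ztop X) {x \<in> points X. r `` {x} \<in> U}"
  by (simp add: quotient_space_def openin_quotient_topology)

lemma points_quotient_space: "points (quotient_space X r) = points X // r"
proof
  show "points (quotient_space X r) \<subseteq> points X // r"
    using openin_topspace[of "ztop (quotient_space X r)"] unfolding openin_quotient_space by blast
  have "{x \<in> points X. r `` {x} \<in> points X // r} = points X" by (auto simp: quotient_def)
  then have "openin (ztop (quotient_space X r)) (points X // r)"
    unfolding openin_quotient_space by simp
  then show "points X // r \<subseteq> points (quotient_space X r)" by (rule openin_subset)
qed

lemma reg_quotient_space:
  "f \<in> reg (quotient_space X r) U \<longleftrightarrow> (\<lambda>x. f (r `` {x})) \<in> reg X {x \<in> points X. r `` {x} \<in> U}"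
  by (simp add: quotient_space_def)

lemma function_sheaf_quotient_space:
  assumes X: "function_sheaf X"
  shows "function_sheaf (quotient_space X r)"
proof (rule function_sheaf.intro)
  show "f \<in> reg (quotient_space X r) W"
    if "f \<in> reg (quotient_space X r) U" "openin (ztop (quotient_space X r)) W" "W \<subseteq> U" for U W f
    using that by (auto simp: reg_quotient_space openin_quotient_space intro: reg_restrict[OF X])
  show "(\<lambda>_. c) \<in> reg (quotient_space X r) U"
    if "openin (ztop (quotient_space X r)) U" for U c
    using that by (auto simp: reg_quotient_space openin_quotient_space intro: reg_const[OF X])
next
  fix U f
  assume loc: "\<And>x. x \<in> U \<Longrightarrow> \<exists>W h. openin (ztop (quotient_space X r)) W \<and> x \<in> W \<and> W \<subseteq> U \<and>
    h \<in> reg (quotient_space X r) W \<and> (\<forall>y\<in>W. f y = h y)"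
  show "f \<in> reg (quotient_space X r) U" unfolding reg_quotient_space
  proof (rule reg_glue[OF X])
    fix x assume x: "x \<in> {x \<in> points X. r `` {x} \<in> U}"
    then have "r `` {x} \<in> U" by simp
    from loc[OF this] obtain W h where W: "openin (ztop (quotient_space X r)) W" "r `` {x} \<in> W" "W \<subseteq> U"
      "h \<in> reg (quotient_space X r) W" "\<forall>y\<in>W. f y = h y" by (elim exE conjE) (rule that)
    show "\<exists>W h. openin (ztop X) W \<and> x \<in> W \<and> W \<subseteq> {x \<in> points X. r `` {x} \<in> U} \<and> h \<in> reg X W \<and>
       (\<forall>y\<in>W. f (r `` {y}) = h y)"
      using W x by (intro exI[of _ "{x \<in> points X. r `` {x} \<in> W}"] exI[of _ "\<lambda>x. h (r `` {x})"])
        (auto simp: reg_quotient_space openin_quotient_space)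
  qed
qed (auto simp: reg_quotient_space intro: reg_add[OF X] reg_mult[OF X])

lemma morphism_quotient_map: "morphism X (quotient_space X r) (\<lambda>x. r `` {x})"
  by (rule morphismI)
    (auto simp: points_quotient_space openin_quotient_space reg_quotient_space comp_def
      intro: quotientI)

text \<open>Universal property of the quotient: its topology and its regular functions are both
  defined by pulling back to \<open>X\<close>, so the composite decides everything.\<close>

lemma morphism_from_quotient:
  assumes f: "morphism X Y (\<lambda>x. f (r `` {x}))"
  shows "morphism (quotient_space X r) Y f"
proof (rule morphismI)
  show "f c \<in> points Y" if "c \<in> points (quotient_space X r)" for c
    using that morphism_points[OF f] by (auto simp: points_quotient_space elim!: quotientE)
  have eq: "{x \<in> points X. r `` {x} \<in> {c \<in> points (quotient_space X r). f c \<in> V}} =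
      {x \<in> points X. f (r `` {x}) \<in> V}" for V
    by (auto simp: points_quotient_space intro: quotientI)
  show "openin (ztop (quotient_space X r)) {c \<in> points (quotient_space X r). f c \<in> V}"
    if "openin (ztop Y) V" for V
    unfolding openin_quotient_space eq
    using morphism_preimage[OF f that] by (auto simp: points_quotient_space)
  show "h \<circ> f \<in> reg (quotient_space X r) {c \<in> points (quotient_space X r). f c \<in> V}"
    if "openin (ztop Y) V" "h \<in> reg Y V" for V h
    unfolding reg_quotient_space eq using morphism_reg[OF f that] by (simp add: comp_def)
qed

text \<open>
  A curve fixed pointwise by an involution maps isomorphically to the quotient: regular functions
  near the curve are made invariant by averaging, which does not change them on the curve.
\<close>

lemma morphism_fixed_locus_of_quotient:
  fixes X :: "('p, 'k::field_char_0) fspace"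
  assumes X: "function_sheaf X" and s: "morphism X X s"
    and inv: "\<And>x. x \<in> points X \<Longrightarrow> s (s x) = x"
    and fixp: "\<And>x. x \<in> Z \<Longrightarrow> s x = x" and Z: "Z \<subseteq> points X"
    and r: "r = {(x, y). x \<in> points X \<and> (y = x \<or> y = s x)}"
    and k: "\<And>x. x \<in> Z \<Longrightarrow> k (r `` {x}) = x"
  shows "morphism (subspace_of (quotient_space X r) ((\<lambda>x. r `` {x}) ` Z)) (subspace_of X Z) k"
proof (rule morphismI)
  let ?q = "\<lambda>x. r `` {x}"
  let ?S = "quotient_space X r"
  let ?C = "subspace_of ?S (?q ` Z)"
  have q: "?q x = {x, s x}" if "x \<in> points X" for x using that by (auto simp: r)
  have sp: "s x \<in> points X" if "x \<in> points X" for x using morphism_points[OF s that] .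
  have ptsC: "points ?C = ?q ` Z"
    using Z by (auto simp: points_subspace_of points_quotient_space intro: quotientI)
  show "k c \<in> points (subspace_of X Z)" if "c \<in> points ?C" for c
    using that k Z by (auto simp: ptsC points_subspace_of)
  have sym: "openin (ztop X) (W \<inter> {x \<in> points X. s x \<in> W})" if "openin (ztop X) W" for W
    using morphism_preimage[OF s that] that by blast
  \<comment> \<open>The points of \<open>W\<close> whose mirror image lies in \<open>W\<close> too
    form an invariant open set, because \<open>s\<close> is an involution. Its image
    \<open>N W\<close> is therefore open in the quotient, and it cuts the image of \<open>Z\<close>
    in the image of \<open>W \<inter> Z\<close>, as \<open>s\<close> fixes \<open>Z\<close>.\<close>
  define N where "N W = ?q ` (W \<inter> {x \<in> points X. s x \<in> W})" for W
  have N: "{x \<in> points X. ?q x \<in> N W} = W \<inter> {x \<in> points X. s x \<in> W}" if "openin (ztop X) W" for W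
  proof -
    have W: "W \<subseteq> points X" using openin_subset[OF that] .
    have "x \<in> W \<and> s x \<in> W" if "x \<in> points X" "y \<in> W" "s y \<in> W" "?q x = ?q y" for x y
    proof -
      have "y \<in> points X" using that W by auto
      then have "{x, s x} = {y, s y}" using that(4) q[OF that(1)] q by metis
      then show ?thesis using that(2,3) by (auto simp: doubleton_eq_iff)
    qed
    then show ?thesis using W by (auto simp: N_def)
  qed
  have Nopen: "openin (ztop ?S) (N W)" if "openin (ztop X) W" for W
    unfolding openin_quotient_space N[OF that]
    using sym[OF that] by (auto simp: N_def intro: quotientI)
  have NZ: "?q x \<in> N W \<longleftrightarrow> x \<in> W" if "openin (ztop X) W" "x \<in> Z" for W x
    using N[OF that(1)] that(2) Z fixp[OF that(2)] by auto
  have NC: "N W \<inter> ?q ` Z = ?q ` (W \<inter> Z)" if "openin (ztop X) W" for W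
    using NZ[OF that] by blast
  fix V assume V: "openin (ztop (subspace_of X Z)) V"
  then obtain W where W: "openin (ztop X) W" "V = W \<inter> Z" by (auto simp: openin_subspace_of)
  have pre: "{c \<in> points ?C. k c \<in> V} = ?q ` V"
    unfolding ptsC using W k by auto
  show "openin (ztop ?C) {c \<in> points ?C. k c \<in> V}"
    unfolding pre openin_subspace_of using NC[OF W(1)] Nopen[OF W(1)] W(2) by metis
  fix h assume h: "h \<in> reg (subspace_of X Z) V"
  show "h \<circ> k \<in> reg ?C {c \<in> points ?C. k c \<in> V}"
    unfolding pre reg_subspace_of
  proof
    fix c assume "c \<in> ?q ` V"
    then obtain x where x: "x \<in> V" "c = ?q x" by auto
    then have xZ: "x \<in> Z" using W by auto
    obtain O' f where O': "openin (ztop X) O'" "x \<in> O'" "O' \<inter> Z \<subseteq> V" "f \<in> reg X O'" "\<forall>y\<in>O' \<inter> Z. h y = f y"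
      by (rule reg_subspace_ofE[OF h x(1)])
    let ?O = "O' \<inter> {x \<in> points X. s x \<in> O'}"
    \<comment> \<open>The average over the orbit, regular where both \<open>f\<close> and
      \<open>f \<circ> s\<close> are. On \<open>Z\<close> the two terms agree, and the factor 1/2
      makes \<open>f'\<close> equal to \<open>f\<close> there.\<close>
    define f' where "f' y = (f y + f (s y)) * (1 / 2)" for y
    have "f \<circ> s \<in> reg X {x \<in> points X. s x \<in> O'}" using morphism_reg[OF s O'(1,4)] .
    then have "(\<lambda>y. f (s y)) \<in> reg X ?O"
      using reg_restrict[OF X, of "f \<circ> s" _ ?O] sym[OF O'(1)] by (simp add: comp_def)
    moreover have "f \<in> reg X ?O" using reg_restrict[OF X O'(4), of ?O] sym[OF O'(1)] by simp
    ultimately have f': "f' \<in> reg X ?O"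
      unfolding f'_def using sym[OF O'(1)]
      by (intro reg_mult[OF X] reg_add[OF X] reg_const[OF X])
    \<comment> \<open>A value for each class through a chosen representative; the invariance of
      \<open>f'\<close> makes the choice harmless.\<close>
    define g where "g c = f' (SOME y. y \<in> c)" for c
    have g: "g (?q y) = f' y" if y: "y \<in> points X" for y
    proof -
      have "y \<in> ?q y" using q[OF y] by simp
      then have "(SOME z. z \<in> ?q y) \<in> ?q y" by (rule someI)
      then show ?thesis using q[OF y] inv[OF y] by (auto simp: g_def f'_def add.commute)
    qed
    have "(\<lambda>y. g (?q y)) \<in> reg X ?O"
      using sym[OF O'(1)] f' g by (rule reg_cong[OF X]) auto
    then have "g \<in> reg ?S (N O')"
      unfolding reg_quotient_space N[OF O'(1)] .
    moreover have "(h \<circ> k) d = g d" if d: "d \<in> N O' \<inter> ?q ` Z" for d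
    proof -
      obtain y where "y \<in> O'" "y \<in> Z" "d = ?q y" using d NC[OF O'(1)] by auto
      then show ?thesis using O'(5) g[of y] Z k fixp[of y] by (auto simp: f'_def)
    qed
    moreover have "c \<in> N O'" using x xZ O' NZ by auto
    ultimately show "\<exists>W g. openin (ztop ?S) W \<and> c \<in> W \<and> W \<inter> ?q ` Z \<subseteq> ?q ` V \<and> g \<in> reg ?S W \<and>
        (\<forall>y\<in>W \<inter> ?q ` Z. (h \<circ> k) y = g y)"
      using Nopen[OF O'(1)] NC[OF O'(1)] O'(3) by (intro exI[of _ "N O'"] exI[of _ g]) auto
  qed
qed


subsection \<open>Polynomial functions and affine spaces\<close>

lemma polyfuns_minus:
  assumes "f \<in> polyfuns K" shows "(\<lambda>v. - f v) \<in> polyfuns K"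
  using polyfuns.mult[OF polyfuns.const[of "-1"] assms] by simp

lemma polyfuns_diff:
  assumes "f \<in> polyfuns K" "g \<in> polyfuns K" shows "(\<lambda>v. f v - g v) \<in> polyfuns K"
  using polyfuns.add[OF assms(1) polyfuns_minus[OF assms(2)]] by simp

lemma polyfuns_power:
  assumes "f \<in> polyfuns K" shows "(\<lambda>v. f v ^ n) \<in> polyfuns K"
  by (induction n) (auto intro: polyfuns.intros assms)

lemma polyfuns_sum:
  assumes "\<And>i. i \<in> I \<Longrightarrow> f i \<in> polyfuns K" shows "(\<lambda>v. \<Sum>i\<in>I. f i v) \<in> polyfuns K"
  using assms by (induction I rule: infinite_finite_induct) (auto intro: polyfuns.intros)

lemma polyfuns_prod:
  assumes "\<And>i. i \<in> I \<Longrightarrow> f i \<in> polyfuns K" shows "(\<lambda>v. \<Prod>i\<in>I. f i v) \<in> polyfuns K"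
  using assms by (induction I rule: infinite_finite_induct) (auto intro: polyfuns.intros)

lemmas polyfuns_intros = polyfuns.const polyfuns.add polyfuns.mult polyfuns_minus polyfuns_diff
  polyfuns_power polyfuns_sum polyfuns_prod

lemma polyfuns_comp:
  assumes "f \<in> polyfuns K'" "\<And>k. k \<in> K' \<Longrightarrow> (\<lambda>v. k (F v)) \<in> polyfuns K"
  shows "(\<lambda>v. f (F v)) \<in> polyfuns K"
  using assms by (induction rule: polyfuns.induct) (auto intro: polyfuns.intros)

text \<open>The generating sets are closed under finite intersections, because a product is nonzero
  exactly where both factors are; hence they are a base and not merely a subbase.\<close>

lemma openin_affine_part:
  "openin (ztop (affine_part A K)) U \<longleftrightarrow>
     U \<subseteq> A \<and> (\<forall>x\<in>U. \<exists>f\<in>polyfuns K. f x \<noteq> 0 \<and> {y \<in> A. f y \<noteq> 0} \<subseteq> U)" (is "_ \<longleftrightarrow> ?R U")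
proof
  let ?B = "{{x \<in> A. f x \<noteq> 0} | f. f \<in> polyfuns K}"
  have "openin (ztop (affine_part A K)) U \<longleftrightarrow> generate_topology_on ?B U"
    by (simp add: affine_part_def Let_def openin_topology_generated_by_iff)
  moreover have "?R U" if "generate_topology_on ?B U"
    using that
  proof induction
    case (Int U V)
    show ?case
    proof (intro conjI ballI)
      fix x assume x: "x \<in> U \<inter> V"
      obtain f g where f: "f \<in> polyfuns K" "f x \<noteq> 0" "{y \<in> A. f y \<noteq> 0} \<subseteq> U"
        and g: "g \<in> polyfuns K" "g x \<noteq> 0" "{y \<in> A. g y \<noteq> 0} \<subseteq> V"
        using Int.IH x by blast
      then show "\<exists>f\<in>polyfuns K. f x \<noteq> 0 \<and> {y \<in> A. f y \<noteq> 0} \<subseteq> U \<inter> V"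
        by (intro bexI[of _ "\<lambda>v. f v * g v"]) (auto intro: polyfuns.intros)
    qed (use Int.IH in auto)
  next
    case (UN \<U>)
    show ?case
    proof (intro conjI ballI)
      show "\<Union>\<U> \<subseteq> A" using UN.IH by blast
      fix x assume "x \<in> \<Union>\<U>"
      then obtain V where V: "V \<in> \<U>" "x \<in> V" by blast
      with UN.IH obtain f where "f \<in> polyfuns K" "f x \<noteq> 0" "{y \<in> A. f y \<noteq> 0} \<subseteq> V" by meson
      then show "\<exists>f\<in>polyfuns K. f x \<noteq> 0 \<and> {y \<in> A. f y \<noteq> 0} \<subseteq> \<Union>\<U>" using V by blast
    qed
  qed auto
  ultimately show "openin (ztop (affine_part A K)) U \<Longrightarrow> ?R U" by simp
  assume R: "?R U"
  show "openin (ztop (affine_part A K)) U"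
    unfolding openin_subopen[of "ztop (affine_part A K)" U]
  proof
    fix x assume "x \<in> U"
    then obtain f where "f \<in> polyfuns K" "f x \<noteq> 0" "{y \<in> A. f y \<noteq> 0} \<subseteq> U" "x \<in> A" using R by blast
    then show "\<exists>T. openin (ztop (affine_part A K)) T \<and> x \<in> T \<and> T \<subseteq> U"
      by (intro exI[of _ "{y \<in> A. f y \<noteq> 0}"])
        (auto simp: affine_part_def Let_def intro!: topology_generated_by_Basis)
  qed
qed

lemma openin_affine_nonzero: "f \<in> polyfuns K \<Longrightarrow> openin (ztop (affine_part A K)) {x \<in> A. f x \<noteq> 0}"
  unfolding openin_affine_part by auto

lemma points_affine_part: "points (affine_part A K) = A"
proof
  show "points (affine_part A K) \<subseteq> A"
    using openin_topspace[of "ztop (affine_part A K)"] unfolding openin_affine_part by blast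
  show "A \<subseteq> points (affine_part A K)"
    using openin_subset[OF openin_affine_nonzero[OF polyfuns.const[of 1 K], of A]] by auto
qed

lemma reg_affine_part:
  "f \<in> reg (affine_part A K) U \<longleftrightarrow> (\<forall>x\<in>U. \<exists>W P Q. openin (ztop (affine_part A K)) W \<and> x \<in> W \<and> W \<subseteq> U \<and>
     P \<in> polyfuns K \<and> Q \<in> polyfuns K \<and> (\<forall>y\<in>W. Q y \<noteq> 0 \<and> f y = P y / Q y))"
  by (simp add: affine_part_def Let_def)

lemma reg_affine_partE:
  assumes "f \<in> reg (affine_part A K) U" "x \<in> U"
  obtains W P Q where "openin (ztop (affine_part A K)) W" "x \<in> W" "W \<subseteq> U"
    "P \<in> polyfuns K" "Q \<in> polyfuns K" "\<forall>y\<in>W. Q y \<noteq> 0 \<and> f y = P y / Q y"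
  using bspec[OF assms(1)[unfolded reg_affine_part] assms(2)] by (elim exE conjE) (rule that)

lemma function_sheaf_affine_part: "function_sheaf (affine_part A K)"
proof (rule function_sheaf.intro)
  let ?T = "ztop (affine_part A K)"
  fix U W f assume f: "f \<in> reg (affine_part A K) U" and W: "openin ?T W" "W \<subseteq> U"
  show "f \<in> reg (affine_part A K) W" unfolding reg_affine_part
  proof
    fix x assume "x \<in> W"
    with W(2) have "x \<in> U" by auto
    with f obtain V P Q where "openin ?T V" "x \<in> V" "P \<in> polyfuns K" "Q \<in> polyfuns K"
      "\<forall>y\<in>V. Q y \<noteq> 0 \<and> f y = P y / Q y" by (rule reg_affine_partE)
    then show "\<exists>W' P Q. openin ?T W' \<and> x \<in> W' \<and> W' \<subseteq> W \<and>
        P \<in> polyfuns K \<and> Q \<in> polyfuns K \<and> (\<forall>y\<in>W'. Q y \<noteq> 0 \<and> f y = P y / Q y)"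
      using W \<open>x \<in> W\<close> by (intro exI[of _ "V \<inter> W"] exI[of _ P] exI[of _ Q]) auto
  qed
next
  let ?T = "ztop (affine_part A K)"
  fix U f
  assume loc: "\<And>x. x \<in> U \<Longrightarrow> \<exists>W h. openin ?T W \<and> x \<in> W \<and> W \<subseteq> U \<and>
    h \<in> reg (affine_part A K) W \<and> (\<forall>y\<in>W. f y = h y)"
  show "f \<in> reg (affine_part A K) U" unfolding reg_affine_part
  proof
    fix x assume "x \<in> U"
    from loc[OF this] obtain W h where W: "openin ?T W" "x \<in> W" "W \<subseteq> U" "h \<in> reg (affine_part A K) W" "\<forall>y\<in>W. f y = h y"
      by (elim exE conjE) (rule that)
    obtain V P Q where "openin ?T V" "x \<in> V" "V \<subseteq> W" "P \<in> polyfuns K" "Q \<in> polyfuns K"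
      "\<forall>y\<in>V. Q y \<noteq> 0 \<and> h y = P y / Q y" by (rule reg_affine_partE[OF W(4,2)])
    then show "\<exists>V P Q. openin ?T V \<and> x \<in> V \<and> V \<subseteq> U \<and>
        P \<in> polyfuns K \<and> Q \<in> polyfuns K \<and> (\<forall>y\<in>V. Q y \<noteq> 0 \<and> f y = P y / Q y)"
      using W by (intro exI[of _ V] exI[of _ P] exI[of _ Q]) auto
  qed
next
  show "(\<lambda>_. c) \<in> reg (affine_part A K) U" if "openin (ztop (affine_part A K)) U" for U c
    unfolding reg_affine_part using that polyfuns.const[of c K] polyfuns.const[of 1 K] by fastforce
next
  let ?T = "ztop (affine_part A K)"
  fix U f g assume *: "f \<in> reg (affine_part A K) U" "g \<in> reg (affine_part A K) U"
  have both: "\<exists>W P Q P' Q'. openin ?T W \<and> x \<in> W \<and> W \<subseteq> U \<and> P \<in> polyfuns K \<and> Q \<in> polyfuns K \<and>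
      P' \<in> polyfuns K \<and> Q' \<in> polyfuns K \<and>
      (\<forall>y\<in>W. Q y \<noteq> 0 \<and> Q' y \<noteq> 0 \<and> f y = P y / Q y \<and> g y = P' y / Q' y)" if x: "x \<in> U" for x
  proof -
    obtain V P Q where "openin ?T V" "x \<in> V" "V \<subseteq> U" "P \<in> polyfuns K" "Q \<in> polyfuns K"
      "\<forall>y\<in>V. Q y \<noteq> 0 \<and> f y = P y / Q y" by (rule reg_affine_partE[OF *(1) x])
    moreover obtain V' P' Q' where "openin ?T V'" "x \<in> V'" "P' \<in> polyfuns K" "Q' \<in> polyfuns K"
      "\<forall>y\<in>V'. Q' y \<noteq> 0 \<and> g y = P' y / Q' y" by (rule reg_affine_partE[OF *(2) x])
    ultimately show ?thesis
      by (intro exI[of _ "V \<inter> V'"] exI[of _ P] exI[of _ Q] exI[of _ P'] exI[of _ Q']) auto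
  qed
  show "(\<lambda>x. f x + g x) \<in> reg (affine_part A K) U" unfolding reg_affine_part
  proof
    fix x assume "x \<in> U"
    from both[OF this] obtain W P Q P' Q' where "openin ?T W" "x \<in> W" "W \<subseteq> U" "P \<in> polyfuns K"
      "Q \<in> polyfuns K" "P' \<in> polyfuns K" "Q' \<in> polyfuns K"
      "\<forall>y\<in>W. Q y \<noteq> 0 \<and> Q' y \<noteq> 0 \<and> f y = P y / Q y \<and> g y = P' y / Q' y" by (elim exE conjE) (rule that)
    then show "\<exists>W P Q. openin ?T W \<and> x \<in> W \<and> W \<subseteq> U \<and> P \<in> polyfuns K \<and> Q \<in> polyfuns K \<and>
        (\<forall>y\<in>W. Q y \<noteq> 0 \<and> f y + g y = P y / Q y)"
      by (intro exI[of _ W] exI[of _ "\<lambda>y. P y * Q' y + P' y * Q y"] exI[of _ "\<lambda>y. Q y * Q' y"])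
        (auto intro: polyfuns.intros simp: add_frac_eq)
  qed
  show "(\<lambda>x. f x * g x) \<in> reg (affine_part A K) U" unfolding reg_affine_part
  proof
    fix x assume "x \<in> U"
    from both[OF this] obtain W P Q P' Q' where "openin ?T W" "x \<in> W" "W \<subseteq> U" "P \<in> polyfuns K"
      "Q \<in> polyfuns K" "P' \<in> polyfuns K" "Q' \<in> polyfuns K"
      "\<forall>y\<in>W. Q y \<noteq> 0 \<and> Q' y \<noteq> 0 \<and> f y = P y / Q y \<and> g y = P' y / Q' y" by (elim exE conjE) (rule that)
    then show "\<exists>W P Q. openin ?T W \<and> x \<in> W \<and> W \<subseteq> U \<and> P \<in> polyfuns K \<and> Q \<in> polyfuns K \<and>
        (\<forall>y\<in>W. Q y \<noteq> 0 \<and> f y * g y = P y / Q y)"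
      by (intro exI[of _ W] exI[of _ "\<lambda>y. P y * P' y"] exI[of _ "\<lambda>y. Q y * Q' y"])
        (auto intro: polyfuns.intros)
  qed
qed

text \<open>\<open>F\<close> may leave \<open>B\<close> on part of \<open>A\<close>, as long as it
  stays in \<open>B\<close> on an open set. This covers polynomial vectors that vanish somewhere and
  so define a map to projective space only on an open part.\<close>

lemma affine_preimage_open:
  assumes F: "\<And>k. k \<in> K' \<Longrightarrow> (\<lambda>v. k (F v)) \<in> polyfuns K"
    and B: "openin (ztop (affine_part A K)) {x \<in> A. F x \<in> B}"
    and V: "openin (ztop (affine_part B K')) V"
  shows "openin (ztop (affine_part A K)) {x \<in> A. F x \<in> V}"
  unfolding openin_subopen[of "ztop (affine_part A K)" "{x \<in> A. F x \<in> V}"]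
proof
  fix x assume x: "x \<in> {x \<in> A. F x \<in> V}"
  then obtain f where f: "f \<in> polyfuns K'" "f (F x) \<noteq> 0" "{y \<in> B. f y \<noteq> 0} \<subseteq> V"
    using V unfolding openin_affine_part by blast
  have "openin (ztop (affine_part A K)) ({x \<in> A. F x \<in> B} \<inter> {x \<in> A. f (F x) \<noteq> 0})"
    by (intro openin_Int B openin_affine_nonzero[of "\<lambda>x. f (F x)"] polyfuns_comp[OF f(1)] F)
  then show "\<exists>T. openin (ztop (affine_part A K)) T \<and> x \<in> T \<and> T \<subseteq> {x \<in> A. F x \<in> V}"
    using x f V by (intro exI[of _ "{x \<in> A. F x \<in> B} \<inter> {x \<in> A. f (F x) \<noteq> 0}"])
      (auto simp: openin_affine_part)
qed

lemma affine_reg_comp: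
  assumes F: "\<And>k. k \<in> K' \<Longrightarrow> (\<lambda>v. k (F v)) \<in> polyfuns K"
    and B: "openin (ztop (affine_part A K)) {x \<in> A. F x \<in> B}"
    and h: "h \<in> reg (affine_part B K') V"
  shows "(\<lambda>x. h (F x)) \<in> reg (affine_part A K) {x \<in> A. F x \<in> V}"
  unfolding reg_affine_part
proof
  fix x assume x: "x \<in> {x \<in> A. F x \<in> V}"
  then have "F x \<in> V" by simp
  with h obtain W P Q where W: "openin (ztop (affine_part B K')) W" "F x \<in> W" "W \<subseteq> V"
    "P \<in> polyfuns K'" "Q \<in> polyfuns K'" "\<forall>y\<in>W. Q y \<noteq> 0 \<and> h y = P y / Q y"
    by (rule reg_affine_partE)
  have "(\<lambda>v. P (F v)) \<in> polyfuns K" "(\<lambda>v. Q (F v)) \<in> polyfuns K"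
    by (intro polyfuns_comp[OF W(4)] polyfuns_comp[OF W(5)] F; assumption)+
  then show "\<exists>W P Q. openin (ztop (affine_part A K)) W \<and> x \<in> W \<and> W \<subseteq> {x \<in> A. F x \<in> V} \<and>
      P \<in> polyfuns K \<and> Q \<in> polyfuns K \<and> (\<forall>y\<in>W. Q y \<noteq> 0 \<and> h (F y) = P y / Q y)"
    using affine_preimage_open[OF F B W(1)] x W
    by (intro exI[of _ "{x \<in> A. F x \<in> W}"] exI[of _ "\<lambda>v. P (F v)"] exI[of _ "\<lambda>v. Q (F v)"]) auto
qed

lemma morphism_affine:
  assumes F: "\<And>k. k \<in> K' \<Longrightarrow> (\<lambda>v. k (F v)) \<in> polyfuns K" and B: "\<And>x. x \<in> A \<Longrightarrow> F x \<in> B"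
  shows "morphism (affine_part A K) (affine_part B K') F"
proof -
  have "{x \<in> A. F x \<in> B} = A" using B by auto
  then have *: "openin (ztop (affine_part A K)) {x \<in> A. F x \<in> B}"
    using openin_topspace[of "ztop (affine_part A K)"] by (simp add: points_affine_part)
  show ?thesis
    using affine_preimage_open[OF F *] affine_reg_comp[OF F *] B
    by (intro morphismI) (auto simp: points_affine_part comp_def)
qed

section \<open>Projective spaces and blow-ups\<close>

lemma pt_eq: "v \<noteq> 0 \<Longrightarrow> pt v = {c *s v | c. c \<noteq> 0}"
  by (auto simp: pt_def prop_rel_def)

lemma pt_scale:
  assumes c: "c \<noteq> 0"
  shows "pt (c *s v) = pt v"
proof (cases "v = 0")
  case False
  have "d *s v = (d / c) *s (c *s v)" for d using c by (simp add: vector_smult_assoc)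
  then have "{d *s (c *s v) | d. d \<noteq> 0} = {d *s v | d. d \<noteq> 0}"
    using c by (auto simp: vector_smult_assoc) (metis divide_eq_0_iff nonzero_eq_divide_eq)
  then show ?thesis using False c pt_eq[of v] pt_eq[of "c *s v"] by simp
qed (simp add: pt_def prop_rel_def)

lemma self_in_pt: "v \<noteq> 0 \<Longrightarrow> v \<in> pt v"
  unfolding pt_eq by (auto intro!: exI[of _ 1])

lemma pt_eq_iff:
  assumes v: "v \<noteq> 0"
  shows "pt w = pt v \<longleftrightarrow> (\<exists>c. c \<noteq> 0 \<and> w = c *s v)"
proof
  assume eq: "pt w = pt v"
  have "w \<noteq> 0" using eq self_in_pt[OF v] by (auto simp: pt_def prop_rel_def)
  then have "w \<in> pt v" using self_in_pt eq by blast
  then show "\<exists>c. c \<noteq> 0 \<and> w = c *s v" using pt_eq[OF v] by auto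
qed (auto simp: pt_scale)

lemma insert_0_pt: "v \<noteq> 0 \<Longrightarrow> insert 0 (pt v) = {c *s v | c. True}"
  by (auto simp: pt_eq intro: exI[of _ 0])

lemma closure_of_meets: "x \<in> T closure_of S \<Longrightarrow> openin T W \<Longrightarrow> x \<in> W \<Longrightarrow> \<exists>y\<in>W. y \<in> S"
  by (auto simp: in_closure_of)

lemma openin_affineE:
  assumes "openin (ztop (affine_part A K)) U" "x \<in> U"
  obtains f where "f \<in> polyfuns K" "f x \<noteq> 0" "{y \<in> A. f y \<noteq> 0} \<subseteq> U"
  using conjunct2[OF assms(1)[unfolded openin_affine_part], THEN bspec, OF assms(2)]
  by (elim bexE conjE) (rule that)

lemma points_proj_space: "points proj_space = {pt v | v. v \<noteq> 0}"
  by (auto simp: proj_space_def points_quotient_space points_affine_part quotient_def pt_def)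

abbreviation blowup_class ::
    "('k::field ^ 'n) set set \<Rightarrow> ('k, 'n) blowup_cone \<Rightarrow> ('k, 'n) blowup_cone set" where
  "blowup_class Z z \<equiv> blowup_rel Z `` {z}"

abbreviation cone_space :: "('k::field ^ 'n) set set \<Rightarrow> (('k, 'n) blowup_cone, 'k) fspace" where
  "cone_space Z \<equiv> affine_part (blowup_cone Z) (blowup_coords Z)"

abbreviation cone_polyfuns :: "('k::field ^ 'n) set set \<Rightarrow> (('k, 'n) blowup_cone \<Rightarrow> 'k) set" where
  "cone_polyfuns Z \<equiv> polyfuns (blowup_coords Z)"

lemma blowup_coords_eq:
  "blowup_coords Z = {\<lambda>z. fst z $ i | i. True} \<union> {\<lambda>z. snd z p $ i | p i. p \<in> Z}"
  by (simp add: blowup_coords_def case_prod_unfold)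

lemma polyfuns_fst: "(\<lambda>z. fst z $ i) \<in> cone_polyfuns Z"
  by (intro polyfuns.coord) (auto simp: blowup_coords_eq)

lemma polyfuns_snd: "p \<in> Z \<Longrightarrow> (\<lambda>z. snd z p $ i) \<in> cone_polyfuns Z"
  by (intro polyfuns.coord) (auto simp: blowup_coords_eq)

lemma blowup_coords_cases:
  assumes "k \<in> blowup_coords Z"
  obtains i where "k = (\<lambda>z. fst z $ i)" | p i where "p \<in> Z" "k = (\<lambda>z. snd z p $ i)"
  using assms unfolding blowup_coords_eq by blast

text \<open>\<open>insert 0 p\<close> stands for the line spanned by \<open>p\<close>; it is a
  linear subspace because \<open>p\<close> is a genuine point of projective space. Nothing more is
  asked, so the singular points of the Hessian never have to be listed.\<close>

locale blowup_centre =
  fixes Z :: "('k::field ^ 'n) set set"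
  assumes centre_points: "\<And>p. p \<in> Z \<Longrightarrow> \<exists>v. v \<noteq> 0 \<and> p = pt v"
begin

lemma line_eq:
  assumes "p \<in> Z"
  shows "\<exists>v. v \<noteq> 0 \<and> p = pt v \<and> insert 0 p = {c *s v | c. True}"
proof -
  obtain v where "v \<noteq> 0" "p = pt v" using centre_points[OF assms] by (elim exE conjE) (rule that)
  then show ?thesis using insert_0_pt[of v] by (intro exI[of _ v]) simp
qed

lemma line_scale:
  assumes "p \<in> Z" "u \<in> insert 0 p"
  shows "c *s u \<in> insert 0 p"
proof -
  obtain v where L: "insert 0 p = {c *s v | c. True}"
    using line_eq[OF assms(1)] by (elim exE conjE) (rule that)
  then obtain d where "u = d *s v" using assms(2) unfolding L by blast
  then have "c *s u = (c * d) *s v" by (simp add: vector_smult_assoc)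
  then show ?thesis unfolding L by blast
qed

lemma line_add:
  assumes "p \<in> Z" "u \<in> insert 0 p" "w \<in> insert 0 p"
  shows "u + w \<in> insert 0 p"
proof -
  obtain v where L: "insert 0 p = {c *s v | c. True}"
    using line_eq[OF assms(1)] by (elim exE conjE) (rule that)
  then obtain d e where "u = d *s v" "w = e *s v" using assms(2,3) unfolding L by blast
  then have "u + w = (d + e) *s v" by (simp add: vector_sadd_rdistrib)
  then show ?thesis unfolding L by blast
qed

lemma line_diff: "p \<in> Z \<Longrightarrow> u \<in> insert 0 p \<Longrightarrow> v \<in> insert 0 p \<Longrightarrow> u - v \<in> insert 0 p"
  using line_add[of p u "(-1) *s v"] line_scale[of p v "-1"] by simp

lemma blowup_relI:
  assumes "z \<in> blowup_cone Z" "z' \<in> blowup_cone Z" "c \<noteq> 0" "fst z' = c *s fst z"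
    and "\<And>p. p \<in> Z \<Longrightarrow> \<exists>c u. c \<noteq> 0 \<and> u \<in> insert 0 p \<and> snd z' p = c *s snd z p + u"
  shows "(z, z') \<in> blowup_rel Z"
  using assms by (cases z; cases z') (auto simp: blowup_rel_def)

lemma blowup_relD:
  assumes "(z, z') \<in> blowup_rel Z"
  shows "z \<in> blowup_cone Z" "z' \<in> blowup_cone Z" "\<exists>c. c \<noteq> 0 \<and> fst z' = c *s fst z"
    "\<And>p. p \<in> Z \<Longrightarrow> \<exists>c u. c \<noteq> 0 \<and> u \<in> insert 0 p \<and> snd z' p = c *s snd z p + u"
  using assms by (cases z; cases z'; force simp: blowup_rel_def)+

lemma equiv_blowup_rel: "equiv (blowup_cone Z) (blowup_rel Z)"
proof (rule equivI)
  show "blowup_rel Z \<subseteq> blowup_cone Z \<times> blowup_cone Z" using blowup_relD(1,2) by auto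
  show "refl_on (blowup_cone Z) (blowup_rel Z)"
  proof (rule refl_onI)
    fix z assume "z \<in> blowup_cone Z"
    then show "(z, z) \<in> blowup_rel Z"
      by (intro blowup_relI[where c = 1]) (auto intro: exI[of _ 1] exI[of _ 0])
  qed
  show "sym (blowup_rel Z)"
  proof (rule symI)
    fix z z' assume r: "(z, z') \<in> blowup_rel Z"
    obtain c where c: "c \<noteq> 0" "fst z' = c *s fst z" using blowup_relD(3)[OF r] by blast
    show "(z', z) \<in> blowup_rel Z"
    proof (rule blowup_relI[where c = "inverse c"])
      fix p assume p: "p \<in> Z"
      obtain d u where d: "d \<noteq> 0" "u \<in> insert 0 p" "snd z' p = d *s snd z p + u"
        using blowup_relD(4)[OF r p] by blast
      have "snd z p = inverse d *s snd z' p + (- inverse d) *s u"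
        using d by (simp add: vector_add_ldistrib vector_smult_assoc)
      then show "\<exists>c u. c \<noteq> 0 \<and> u \<in> insert 0 p \<and> snd z p = c *s snd z' p + u"
        using d line_scale[OF p d(2)] nonzero_imp_inverse_nonzero by blast
    qed (use c blowup_relD(1,2)[OF r] in \<open>auto simp: vector_smult_assoc\<close>)
  qed
  show "trans (blowup_rel Z)"
  proof (rule transI)
    fix z z' z'' assume r: "(z, z') \<in> blowup_rel Z" and r': "(z', z'') \<in> blowup_rel Z"
    obtain c where c: "c \<noteq> 0" "fst z' = c *s fst z" using blowup_relD(3)[OF r] by blast
    obtain c' where c': "c' \<noteq> 0" "fst z'' = c' *s fst z'" using blowup_relD(3)[OF r'] by blast
    show "(z, z'') \<in> blowup_rel Z"
    proof (rule blowup_relI[where c = "c' * c"])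
      fix p assume p: "p \<in> Z"
      obtain d u where d: "d \<noteq> 0" "u \<in> insert 0 p" "snd z' p = d *s snd z p + u"
        using blowup_relD(4)[OF r p] by blast
      obtain d' u' where d': "d' \<noteq> 0" "u' \<in> insert 0 p" "snd z'' p = d' *s snd z' p + u'"
        using blowup_relD(4)[OF r' p] by blast
      have "snd z'' p = (d' * d) *s snd z p + (d' *s u + u')"
        using d d' by (simp add: vector_add_ldistrib vector_smult_assoc)
      then show "\<exists>c u. c \<noteq> 0 \<and> u \<in> insert 0 p \<and> snd z'' p = c *s snd z p + u"
        using d d' line_add[OF p line_scale[OF p d(2)] d'(2)] no_zero_divisors by blast
    qed (use c c' blowup_relD(1)[OF r] blowup_relD(2)[OF r'] in \<open>auto simp: vector_smult_assoc\<close>)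
  qed
qed

lemma blowup_class_eq_iff:
  "z \<in> blowup_cone Z \<Longrightarrow> z' \<in> blowup_cone Z \<Longrightarrow>
    blowup_class Z z = blowup_class Z z' \<longleftrightarrow> (z, z') \<in> blowup_rel Z"
  using eq_equiv_class_iff[OF equiv_blowup_rel] by auto

lemma blowup_class_self: "z \<in> blowup_cone Z \<Longrightarrow> z \<in> blowup_class Z z"
  using equiv_class_self[OF equiv_blowup_rel] .

lemma blow_down_class:
  assumes z: "z \<in> blowup_cone Z"
  shows "blow_down (blowup_class Z z) = pt (fst z)"
proof
  have nz: "fst z \<noteq> 0" using z by (auto simp: blowup_cone_def)
  show "blow_down (blowup_class Z z) \<subseteq> pt (fst z)"
    using blowup_relD(3) by (fastforce simp: blow_down_def pt_eq[OF nz])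
  show "pt (fst z) \<subseteq> blow_down (blowup_class Z z)"
  proof
    fix x assume "x \<in> pt (fst z)"
    then obtain c where c: "c \<noteq> 0" "x = c *s fst z" by (auto simp: pt_eq[OF nz])
    have "(z, (x, snd z)) \<in> blowup_rel Z"
      using z c nz by (intro blowup_relI[where c = c])
        (auto simp: blowup_cone_def case_prod_beta intro: exI[of _ 1] exI[of _ 0])
    then show "x \<in> blow_down (blowup_class Z z)" by (force simp: blow_down_def)
  qed
qed

lemma points_blowup_ambient: "points (blowup_ambient Z) = blowup_class Z ` blowup_cone Z"
  by (auto simp: blowup_ambient_def points_quotient_space points_affine_part quotient_def)

lemma openin_blowup_ambient:
  "openin (ztop (blowup_ambient Z)) U \<longleftrightarrow> U \<subseteq> points (blowup_ambient Z) \<and>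
     openin (ztop (cone_space Z)) {z \<in> blowup_cone Z. blowup_class Z z \<in> U}"
  unfolding blowup_ambient_def openin_quotient_space points_quotient_space points_affine_part ..

text \<open>The ambient space is an orbit space of a group of polynomial automorphisms of the cone.\<close>

lemma open_blowup_class_image:
  assumes W: "openin (ztop (cone_space Z)) W"
  shows "openin (ztop (blowup_ambient Z)) (blowup_class Z ` W)"
  unfolding openin_blowup_ambient
proof
  have Wc: "W \<subseteq> blowup_cone Z" using openin_subset[OF W] by (simp add: points_affine_part)
  show "blowup_class Z ` W \<subseteq> points (blowup_ambient Z)" using Wc by (auto simp: points_blowup_ambient)
  let ?S = "{z \<in> blowup_cone Z. blowup_class Z z \<in> blowup_class Z ` W}"
  show "openin (ztop (cone_space Z)) ?S"
    unfolding openin_subopen[of _ ?S]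
  proof
    fix z assume z: "z \<in> ?S"
    then obtain z' where z': "z' \<in> W" "blowup_class Z z = blowup_class Z z'" by auto
    have zc: "z \<in> blowup_cone Z" and zc': "z' \<in> blowup_cone Z" using z z' Wc by auto
    have r: "(z, z') \<in> blowup_rel Z" using blowup_class_eq_iff[OF zc zc'] z'(2) by simp
    obtain c where c: "c \<noteq> 0" "fst z' = c *s fst z" using blowup_relD(3)[OF r] by blast
    have "\<forall>p\<in>Z. \<exists>d u. d \<noteq> 0 \<and> u \<in> insert 0 p \<and> snd z' p = d *s snd z p + u"
      using blowup_relD(4)[OF r] by blast
    then obtain d u where du: "\<And>p. p \<in> Z \<Longrightarrow> d p \<noteq> 0" "\<And>p. p \<in> Z \<Longrightarrow> u p \<in> insert 0 p"
      "\<And>p. p \<in> Z \<Longrightarrow> snd z' p = d p *s snd z p + u p" by metis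
    \<comment> \<open>The scalars and shifts that lead from \<open>z\<close> to \<open>z'\<close>,
      applied to every point of the cone. This is a polynomial map that preserves all classes, so
      the preimage of \<open>W\<close> under it is a neighbourhood of \<open>z\<close> inside the
      saturation of \<open>W\<close>.\<close>
    define G where "G y = (c *s fst y, \<lambda>p\<in>Z. d p *s snd y p + u p)" for y :: "('k, 'n) blowup_cone"
    have Gc: "G y \<in> blowup_cone Z" if y: "y \<in> blowup_cone Z" for y
    proof -
      have "d p *s snd y p + u p \<notin> insert 0 p" if p: "p \<in> Z" for p
      proof
        assume "d p *s snd y p + u p \<in> insert 0 p"
        from line_scale[OF p line_diff[OF p this du(2)[OF p]], of "inverse (d p)"]
        have "snd y p \<in> insert 0 p" using du(1)[OF p] by (simp add: vector_smult_assoc)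
        then show False using y p by (auto simp: blowup_cone_def case_prod_beta PiE_def Pi_def)
      qed
      then show ?thesis using y c by (auto simp: blowup_cone_def case_prod_beta G_def)
    qed
    have Gr: "(y, G y) \<in> blowup_rel Z" if y: "y \<in> blowup_cone Z" for y
      using y Gc[OF y] c(1) du by (intro blowup_relI[where c = c]) (auto simp: G_def)
    have Gz: "G z = z'"
    proof (rule prod_eqI)
      show "fst (G z) = fst z'" using c by (simp add: G_def)
      have "snd z' \<in> extensional Z" using zc' by (auto simp: blowup_cone_def case_prod_beta PiE_def)
      then show "snd (G z) = snd z'" using du by (auto simp: G_def restrict_def extensional_def)
    qed
    have Gpoly: "(\<lambda>y. k (G y)) \<in> cone_polyfuns Z" if "k \<in> blowup_coords Z" for k
      using that by (cases rule: blowup_coords_cases)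
        (auto simp: G_def intro!: polyfuns_intros polyfuns_fst polyfuns_snd)
    have "morphism (cone_space Z) (cone_space Z) G"
      using Gpoly Gc by (rule morphism_affine)
    from morphism_preimage[OF this W] have o: "openin (ztop (cone_space Z)) {y \<in> blowup_cone Z. G y \<in> W}"
      by (simp add: points_affine_part)
    have "{y \<in> blowup_cone Z. G y \<in> W} \<subseteq> ?S"
    proof
      fix y assume y: "y \<in> {y \<in> blowup_cone Z. G y \<in> W}"
      then have "blowup_class Z y = blowup_class Z (G y)"
        using blowup_class_eq_iff[of y "G y"] Gr[of y] Gc[of y] by auto
      then show "y \<in> ?S" using y by auto
    qed
    then show "\<exists>T. openin (ztop (cone_space Z)) T \<and> z \<in> T \<and> T \<subseteq> ?S"
      using o zc Gz z'(1) by (intro exI[of _ "{y \<in> blowup_cone Z. G y \<in> W}"]) auto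
  qed
qed

text \<open>The full preimage in the cone of the graph of the projections, saturated under
  \<open>blowup_rel\<close>: besides the diagonal representatives
  \<open>(x, \<lambda>p\<in>Z. x)\<close> it contains every rescaled and shifted one.\<close>

definition graph_cone :: "('k ^ 'n) set set \<Rightarrow> ('k, 'n) blowup_cone set" where
  "graph_cone H = {z \<in> blowup_cone Z. pt (fst z) \<in> H - Z \<and>
     (\<forall>p\<in>Z. \<exists>c u. c \<noteq> 0 \<and> u \<in> insert 0 p \<and> snd z p = c *s fst z + u)}"

lemma off_centre:
  assumes "x \<noteq> 0" "pt x \<notin> Z" "p \<in> Z" shows "x \<notin> insert 0 p"
proof
  assume x: "x \<in> insert 0 p"
  obtain v where v: "v \<noteq> 0" "p = pt v" using centre_points[OF assms(3)] by blast
  then obtain c where "c \<noteq> 0" "x = c *s v" using x assms(1) by (auto simp: pt_eq)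
  then show False using v assms pt_scale[of c v] by simp
qed

lemma graph_cone_iff:
  assumes z: "z \<in> blowup_cone Z"
  shows "z \<in> graph_cone H \<longleftrightarrow>
    blowup_class Z z \<in> {blowup_rel Z `` {(x, \<lambda>p\<in>Z. x)} | x. x \<noteq> 0 \<and> pt x \<in> H - Z}" (is "_ \<longleftrightarrow> _ \<in> ?G")
proof
  have diag: "(x, \<lambda>p\<in>Z. x) \<in> blowup_cone Z" if "x \<noteq> 0" "pt x \<notin> Z" for x
    using off_centre[OF that] that by (auto simp: blowup_cone_def)
  {
    assume g: "z \<in> graph_cone H"
    have x: "fst z \<noteq> 0" "pt (fst z) \<in> H - Z" using z g by (auto simp: graph_cone_def blowup_cone_def)
    have "((fst z, \<lambda>p\<in>Z. fst z), z) \<in> blowup_rel Z"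
      using x diag z g by (intro blowup_relI[where c = 1]) (auto simp: graph_cone_def)
    then show "blowup_class Z z \<in> ?G"
      using blowup_class_eq_iff[OF diag z] x by blast
  next
    assume "blowup_class Z z \<in> ?G"
    then obtain x where x: "x \<noteq> 0" "pt x \<in> H - Z" "blowup_class Z z = blowup_class Z (x, \<lambda>p\<in>Z. x)"
      by blast
    then have r: "(z, (x, \<lambda>p\<in>Z. x)) \<in> blowup_rel Z" using blowup_class_eq_iff[OF z diag] by auto
    then have r': "((x, \<lambda>p\<in>Z. x), z) \<in> blowup_rel Z" using equiv_blowup_rel by (meson equivE symE)
    obtain c where c: "c \<noteq> 0" "x = c *s fst z" using blowup_relD(3)[OF r] by auto
    have "\<exists>c u. c \<noteq> 0 \<and> u \<in> insert 0 p \<and> snd z p = c *s fst z + u" if p: "p \<in> Z" for p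
    proof -
      obtain d u where "d \<noteq> 0" "u \<in> insert 0 p" "snd z p = d *s x + u"
        using blowup_relD(4)[OF r' p] p by auto
      then show ?thesis using c by (intro exI[of _ "d * c"] exI[of _ u]) (auto simp: vector_smult_assoc)
    qed
    then show "z \<in> graph_cone H" using z x c pt_scale[of c "fst z"] by (auto simp: graph_cone_def)
  }
qed

lemma points_blowup:
  "points (blowup H Z) = ztop (blowup_ambient Z) closure_of
     {blowup_rel Z `` {(x, \<lambda>p\<in>Z. x)} | x. x \<noteq> 0 \<and> pt x \<in> H - Z}"
  unfolding blowup_def points_subspace_of using closure_of_subset_topspace by fastforce

lemma points_blowup_subset: "points (blowup H Z) \<subseteq> points (blowup_ambient Z)"
  unfolding points_blowup by (rule closure_of_subset_topspace)

lemma blowup_pointE: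
  assumes "\<xi> \<in> points (blowup H Z)"
  obtains z where "z \<in> blowup_cone Z" "\<xi> = blowup_class Z z"
  using assms points_blowup_subset[of H] by (auto simp: points_blowup_ambient)

lemma blowup_eq: "blowup H Z = subspace_of (blowup_ambient Z) (points (blowup H Z))"
  unfolding points_blowup by (simp add: blowup_def)

text \<open>A neighbourhood of the class pulls back to an open set of the cone, which contains a
  basic open set around \<open>z\<close>. So the closure can be tested with single polynomials on
  the cone.\<close>

lemma blowup_pointI:
  assumes z: "z \<in> blowup_cone Z"
    and near: "\<And>f. f \<in> cone_polyfuns Z \<Longrightarrow> f z \<noteq> 0 \<Longrightarrow> \<exists>z'\<in>graph_cone H. f z' \<noteq> 0"
  shows "blowup_class Z z \<in> points (blowup H Z)"
  unfolding points_blowup in_closure_of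
proof (intro conjI allI impI)
  show "blowup_class Z z \<in> points (blowup_ambient Z)" using z by (auto simp: points_blowup_ambient)
  fix T assume T: "blowup_class Z z \<in> T \<and> openin (ztop (blowup_ambient Z)) T"
  then have "openin (ztop (cone_space Z)) {z \<in> blowup_cone Z. blowup_class Z z \<in> T}"
    by (simp add: openin_blowup_ambient)
  moreover have "z \<in> {z \<in> blowup_cone Z. blowup_class Z z \<in> T}" using T z by simp
  ultimately obtain f where f: "f \<in> cone_polyfuns Z" "f z \<noteq> 0"
    "{y \<in> blowup_cone Z. f y \<noteq> 0} \<subseteq> {z \<in> blowup_cone Z. blowup_class Z z \<in> T}"
    by (rule openin_affineE)
  obtain z' where z': "z' \<in> graph_cone H" "f z' \<noteq> 0" using near[OF f(1,2)] by blast
  then have "z' \<in> blowup_cone Z" by (simp add: graph_cone_def)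
  then show "\<exists>y. y \<in> {blowup_rel Z `` {(x, \<lambda>p\<in>Z. x)} | x. x \<noteq> 0 \<and> pt x \<in> H - Z} \<and> y \<in> T"
    using z' f(3) graph_cone_iff[of z' H] by (intro exI[of _ "blowup_class Z z'"]) auto
qed

lemma graph_cone_point:
  assumes "z \<in> graph_cone H"
  shows "blowup_class Z z \<in> points (blowup H Z)"
proof (rule blowup_pointI)
  show "z \<in> blowup_cone Z" using assms by (simp add: graph_cone_def)
  show "\<exists>z'\<in>graph_cone H. f z' \<noteq> 0" if "f z \<noteq> 0" for f :: "('k, 'n) blowup_cone \<Rightarrow> 'k"
    using assms that by (rule bexI[rotated])
qed

text \<open>Polynomial equations pass from the graph to its closure. The set where \<open>f\<close>
  is nonzero has open image since the class map is open, so it would meet the graph; as the graph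
  cone is saturated, this contradicts the vanishing of \<open>f\<close> on it.\<close>

lemma blowup_point_vanishing:
  assumes z: "z \<in> blowup_cone Z" "blowup_class Z z \<in> points (blowup H Z)"
    and f: "f \<in> cone_polyfuns Z" "\<And>z'. z' \<in> graph_cone H \<Longrightarrow> f z' = 0"
  shows "f z = 0"
proof (rule ccontr)
  assume fz: "f z \<noteq> 0"
  let ?W = "{y \<in> blowup_cone Z. f y \<noteq> 0}"
  have "openin (ztop (blowup_ambient Z)) (blowup_class Z ` ?W)"
    by (intro open_blowup_class_image openin_affine_nonzero f)
  moreover have "blowup_class Z z \<in> blowup_class Z ` ?W" using z fz by auto
  ultimately have "\<exists>y\<in>blowup_class Z ` ?W.
      y \<in> {blowup_rel Z `` {(x, \<lambda>p\<in>Z. x)} | x. x \<noteq> 0 \<and> pt x \<in> H - Z}"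
    by (rule closure_of_meets[OF z(2)[unfolded points_blowup]])
  then obtain z' where "z' \<in> ?W"
    "blowup_class Z z' \<in> {blowup_rel Z `` {(x, \<lambda>p\<in>Z. x)} | x. x \<noteq> 0 \<and> pt x \<in> H - Z}"
    by (elim bexE imageE) (rule that, assumption, simp only:)
  then show False using f(2)[of z'] graph_cone_iff[of z' H] by simp
qed

text \<open>The hypothesis is the vanishing of all 3x3 minors of the matrix with columns
  \<open>x\<close>, \<open>w\<close>, \<open>v\<close>. Independence of \<open>x\<close> and
  \<open>v\<close> provides a nonzero 2x2 minor \<open>D\<close>, and Cramer's rule then solves for
  \<open>w\<close>.\<close>

lemma minors_dependent:
  fixes x w v :: "'k ^ 'n"
  assumes m: "\<And>i j k. (x $ i * w $ j - x $ j * w $ i) * v $ k + (x $ j * w $ k - x $ k * w $ j) * v $ i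
      + (x $ k * w $ i - x $ i * w $ k) * v $ j = 0"
    and v: "v \<noteq> 0" and x: "\<And>c. x \<noteq> c *s v"
  shows "\<exists>c d. w = c *s x + d *s v"
proof -
  obtain j where j: "v $ j \<noteq> 0" using v by (auto simp: vec_eq_iff)
  obtain i where i: "x $ i * v $ j - x $ j * v $ i \<noteq> 0"
  proof (rule ccontr)
    assume "\<not> thesis"
    then have "x $ i * v $ j = x $ j * v $ i" for i using that by force
    then have "x = (x $ j / v $ j) *s v" using j by (simp add: vec_eq_iff field_simps)
    then show False using x by blast
  qed
  define D \<alpha> \<beta> where "D = x $ i * v $ j - x $ j * v $ i" and "\<alpha> = w $ i * v $ j - w $ j * v $ i"
    and "\<beta> = x $ i * w $ j - x $ j * w $ i"
  have "w $ k * D = \<alpha> * x $ k + \<beta> * v $ k" for k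
    using m[of i j k] unfolding D_def \<alpha>_def \<beta>_def by algebra
  moreover have "D \<noteq> 0" using i by (simp add: D_def)
  ultimately have "w $ k = \<alpha> / D * x $ k + \<beta> / D * v $ k" for k
    by (simp add: add_divide_distrib[symmetric] eq_divide_eq)
  then have "w = (\<alpha> / D) *s x + (\<beta> / D) *s v"
    by (simp add: vec_eq_iff)
  then show ?thesis by blast
qed

text \<open>Linear dependence of the position, the direction at \<open>p\<close> and the centre
  itself is a closed condition that holds on the graph. Away from \<open>p\<close> it determines the
  direction; its coefficient along the position is nonzero since the direction is not on the line of
  \<open>p\<close>.\<close>

lemma blowup_point_direction:
  assumes z: "z \<in> blowup_cone Z" "blowup_class Z z \<in> points (blowup H Z)"
    and p: "p \<in> Z" and x: "fst z \<notin> insert 0 p"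
  shows "\<exists>c u. c \<noteq> 0 \<and> u \<in> insert 0 p \<and> snd z p = c *s fst z + u"
proof -
  obtain v where v: "v \<noteq> 0" "p = pt v" using centre_points[OF p] by blast
  have "\<exists>c d. snd z p = c *s fst z + d *s v"
  proof (rule minors_dependent[OF _ v(1)])
    fix i j k
    let ?f = "\<lambda>z. (fst z $ i * snd z p $ j - fst z $ j * snd z p $ i) * v $ k
      + (fst z $ j * snd z p $ k - fst z $ k * snd z p $ j) * v $ i
      + (fst z $ k * snd z p $ i - fst z $ i * snd z p $ k) * v $ j"
    show "?f z = 0"
    proof (rule blowup_point_vanishing[OF z, where f = ?f])
      show "?f \<in> cone_polyfuns Z"
        by (intro polyfuns_intros polyfuns_fst polyfuns_snd p)
      fix z' assume "z' \<in> graph_cone H"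
      then obtain c u where "u \<in> insert 0 p" "snd z' p = c *s fst z' + u"
        using p unfolding graph_cone_def by blast
      moreover from this obtain d where "u = d *s v" using v by (auto simp: insert_0_pt)
      ultimately show "?f z' = 0" by (simp add: algebra_simps)
    qed
    show "fst z \<noteq> c *s v" for c using x v by (auto simp: insert_0_pt)
  qed
  then obtain c d where cd: "snd z p = c *s fst z + d *s v" by blast
  have "snd z p \<notin> insert 0 p" using z(1) p by (auto simp: blowup_cone_def case_prod_beta)
  then have "c \<noteq> 0" using cd v by (auto simp: insert_0_pt)
  then show ?thesis using cd v by (auto simp: insert_0_pt)
qed

text \<open>Components at centres other than the image point are forced by
  \<open>blowup_point_direction\<close>, so two points over the same image are compared only at the
  centre where they lie.\<close>

lemma blowup_point_eqI:
  assumes z: "z \<in> blowup_cone Z" "blowup_class Z z \<in> points (blowup H Z)"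
    and z': "z' \<in> blowup_cone Z" "blowup_class Z z' \<in> points (blowup H Z)"
    and x: "pt (fst z') = pt (fst z)"
    and w: "\<And>p. p \<in> Z \<Longrightarrow> fst z \<in> insert 0 p \<Longrightarrow>
      \<exists>c u. c \<noteq> 0 \<and> u \<in> insert 0 p \<and> snd z' p = c *s snd z p + u"
  shows "blowup_class Z z = blowup_class Z z'"
proof -
  have "fst z \<noteq> 0" using z(1) by (auto simp: blowup_cone_def)
  then obtain a where a: "a \<noteq> 0" "fst z' = a *s fst z" using x pt_eq_iff by blast
  have "(z, z') \<in> blowup_rel Z"
  proof (rule blowup_relI[OF z(1) z'(1) a])
    fix p assume p: "p \<in> Z"
    show "\<exists>c u. c \<noteq> 0 \<and> u \<in> insert 0 p \<and> snd z' p = c *s snd z p + u"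
    proof (cases "fst z \<in> insert 0 p")
      case False
      then obtain c u where c: "c \<noteq> 0" "u \<in> insert 0 p" "snd z p = c *s fst z + u"
        using blowup_point_direction[OF z p] by blast
      have "fst z' \<notin> insert 0 p"
        using False line_scale[OF p, of "fst z'" "inverse a"] a by (auto simp: vector_smult_assoc)
      then obtain c' u' where c': "c' \<noteq> 0" "u' \<in> insert 0 p" "snd z' p = c' *s fst z' + u'"
        using blowup_point_direction[OF z' p] by blast
      have "snd z' p = (c' * a / c) *s snd z p + (u' - (c' * a / c) *s u)"
        using c c' a by (simp add: vector_smult_assoc vector_add_ldistrib)
      then show ?thesis using a c c' line_diff[OF p c'(2) line_scale[OF p c(2)]]
        by (intro exI[of _ "c' * a / c"] exI[of _ "u' - (c' * a / c) *s u"]) auto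
    qed (use w[OF p] in auto)
  qed
  then show ?thesis using blowup_class_eq_iff z z' by blast
qed

lemma function_sheaf_blowup_ambient: "function_sheaf (blowup_ambient Z)"
  unfolding blowup_ambient_def
  by (intro function_sheaf_quotient_space function_sheaf_affine_part)

lemma function_sheaf_blowup: "function_sheaf (blowup H Z)"
  unfolding blowup_def by (intro function_sheaf_subspace_of function_sheaf_blowup_ambient)

lemma openin_blowup:
  "openin (ztop (blowup H Z)) U \<longleftrightarrow>
    (\<exists>W. openin (ztop (blowup_ambient Z)) W \<and> U = W \<inter> points (blowup H Z))"
  by (subst blowup_eq) (simp add: openin_subspace_of)

text \<open>The class map is open, so a neighbourhood in the cone yields one in the blow-up, and the
  dense set meets it.\<close>

lemma dense_open_near:
  assumes U: "ztop (blowup H Z) closure_of U = points (blowup H Z)"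
    and W: "openin (ztop (cone_space Z)) W" "z \<in> W" "blowup_class Z z \<in> points (blowup H Z)"
  shows "\<exists>z'\<in>W. blowup_class Z z' \<in> U"
proof -
  have "openin (ztop (blowup H Z)) (blowup_class Z ` W \<inter> points (blowup H Z))"
    unfolding openin_blowup using open_blowup_class_image[OF W(1)] by blast
  moreover have "blowup_class Z z \<in> ztop (blowup H Z) closure_of U" using U W by simp
  moreover have "blowup_class Z z \<in> blowup_class Z ` W \<inter> points (blowup H Z)" using W by simp
  ultimately have "\<exists>y\<in>blowup_class Z ` W \<inter> points (blowup H Z). y \<in> U"
    by (intro closure_of_meets)
  then show ?thesis by auto
qed

text \<open>
  A morphism to a projective space is determined on a closure by its values on the dense part;
  here the morphism is \<open>A \<circ> \<tau>\<close>, compared with the one given by the polynomials \<open>L\<close>.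
\<close>

lemma relation_extends:
  fixes A L :: "('k, 'n) blowup_cone \<Rightarrow> 'k ^ 'm"
  assumes \<tau>: "morphism (blowup H Z) (blowup H Z) \<tau>"
    and z0: "z0 \<in> blowup_cone Z" "blowup_class Z z0 \<in> points (blowup H Z)"
    and \<zeta>0: "\<zeta>0 \<in> blowup_cone Z" "\<tau> (blowup_class Z z0) = blowup_class Z \<zeta>0"
    and A: "\<And>i. (\<lambda>z. A z $ i) \<in> cone_polyfuns Z"
    and L: "\<And>i. (\<lambda>z. L z $ i) \<in> cone_polyfuns Z"
    and inv: "\<And>z z'. (z, z') \<in> blowup_rel Z \<Longrightarrow> \<exists>c. c \<noteq> 0 \<and> A z' = c *s A z"
    and D: "\<And>W. openin (ztop (cone_space Z)) W \<Longrightarrow> z0 \<in> W \<Longrightarrow> \<exists>z\<in>W.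
      blowup_class Z z \<in> points (blowup H Z) \<and>
      (\<forall>\<zeta>\<in>blowup_cone Z. \<tau> (blowup_class Z z) = blowup_class Z \<zeta> \<longrightarrow>
        (\<forall>i j. A \<zeta> $ i * L z $ j = A \<zeta> $ j * L z $ i))"
  shows "A \<zeta>0 $ i * L z0 $ j = A \<zeta>0 $ j * L z0 $ i"
proof (cases "A \<zeta>0 = 0")
  case False
  then obtain e where e: "A \<zeta>0 $ e \<noteq> 0" by (auto simp: vec_eq_iff)
  let ?X = "blowup H Z" and ?B = "blowup_ambient Z"
  let ?D = "{z \<in> blowup_cone Z. A z $ e \<noteq> 0}"
  \<comment> \<open>The chart in which coordinate \<open>e\<close> of \<open>A\<close> is nonzero;
    by \<open>inv\<close> it is a union of classes.\<close>
  define V where "V = blowup_class Z ` ?D"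
  have Vo: "openin (ztop ?B) V"
    unfolding V_def by (intro open_blowup_class_image openin_affine_nonzero A)
  have Vmem: "blowup_class Z z \<in> V \<longleftrightarrow> A z $ e \<noteq> 0" if z: "z \<in> blowup_cone Z" for z
  proof
    assume "blowup_class Z z \<in> V"
    then obtain y where y: "y \<in> blowup_cone Z" "A y $ e \<noteq> 0" "blowup_class Z z = blowup_class Z y"
      by (auto simp: V_def)
    then have "(z, y) \<in> blowup_rel Z" using blowup_class_eq_iff[OF z] by blast
    then show "A z $ e \<noteq> 0" using inv y(2) by fastforce
  qed (use z in \<open>auto simp: V_def\<close>)
  have key: "A \<zeta>0 $ i * L z0 $ e = A \<zeta>0 $ e * L z0 $ i" for i
  proof -
    \<comment> \<open>An affine coordinate of the target, well defined on classes by
      \<open>inv\<close>. Its pullback along \<open>\<tau>\<close> is regular near the given point,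
      hence locally a quotient \<open>P / Q\<close> of polynomials on the cone.\<close>
    define F where "F \<xi> = A (SOME z. z \<in> \<xi>) $ i / A (SOME z. z \<in> \<xi>) $ e" for \<xi>
    have F: "F (blowup_class Z z) = A z $ i / A z $ e" if z: "z \<in> blowup_cone Z" for z
    proof -
      have "(SOME y. y \<in> blowup_class Z z) \<in> blowup_class Z z"
        using blowup_class_self[OF z] by (rule someI)
      then obtain c where "c \<noteq> 0" "A (SOME y. y \<in> blowup_class Z z) = c *s A z"
        using inv by blast
      then show ?thesis by (simp add: F_def)
    qed
    have "(\<lambda>z. F (blowup_class Z z)) \<in> reg (cone_space Z) ?D"
      unfolding reg_affine_part
      using F A openin_affine_nonzero[OF A[of e], of "blowup_cone Z"]
      by (intro ballI exI[of _ ?D] exI[of _ "\<lambda>z. A z $ i"] exI[of _ "\<lambda>z. A z $ e"]) auto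
    moreover have "{z \<in> blowup_cone Z. blowup_class Z z \<in> V} = ?D" using Vmem by auto
    ultimately have "F \<in> reg ?B V"
      unfolding blowup_ambient_def reg_quotient_space points_affine_part by simp
    then have "F \<in> reg ?X (V \<inter> points ?X)"
      by (subst blowup_eq) (auto intro: reg_subspace_ofI Vo)
    moreover have Vo': "openin (ztop ?X) (V \<inter> points ?X)" using Vo openin_blowup by blast
    ultimately have "F \<circ> \<tau> \<in> reg ?X {\<xi> \<in> points ?X. \<tau> \<xi> \<in> V \<inter> points ?X}"
      using morphism_reg[OF \<tau>] by blast
    then have "F \<circ> \<tau> \<in> reg (subspace_of ?B (points ?X)) {\<xi> \<in> points ?X. \<tau> \<xi> \<in> V \<inter> points ?X}"
      using blowup_eq by metis
    moreover have "blowup_class Z z0 \<in> {\<xi> \<in> points ?X. \<tau> \<xi> \<in> V \<inter> points ?X}"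
      using z0 \<zeta>0 e Vmem[OF \<zeta>0(1)] morphism_points[OF \<tau> z0(2)] by auto
    ultimately obtain W h where W: "openin (ztop ?B) W" "blowup_class Z z0 \<in> W"
      "W \<inter> points ?X \<subseteq> {\<xi> \<in> points ?X. \<tau> \<xi> \<in> V \<inter> points ?X}" "h \<in> reg ?B W"
      "\<forall>\<xi>\<in>W \<inter> points ?X. (F \<circ> \<tau>) \<xi> = h \<xi>"
      by (rule reg_subspace_ofE)
    have "(\<lambda>z. h (blowup_class Z z)) \<in> reg (cone_space Z) {z \<in> blowup_cone Z. blowup_class Z z \<in> W}"
      using W(4) unfolding blowup_ambient_def reg_quotient_space points_affine_part .
    moreover have "z0 \<in> {z \<in> blowup_cone Z. blowup_class Z z \<in> W}" using z0 W by simp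
    ultimately obtain W' P Q where W': "openin (ztop (cone_space Z)) W'" "z0 \<in> W'"
      "W' \<subseteq> {z \<in> blowup_cone Z. blowup_class Z z \<in> W}" "P \<in> cone_polyfuns Z" "Q \<in> cone_polyfuns Z"
      "\<forall>z\<in>W'. Q z \<noteq> 0 \<and> h (blowup_class Z z) = P z / Q z"
      by (rule reg_affine_partE)
    have quot: "Q z \<noteq> 0 \<and> A \<zeta> $ e \<noteq> 0 \<and> A \<zeta> $ i / A \<zeta> $ e = P z / Q z"
      if z: "z \<in> W'" "blowup_class Z z \<in> points ?X" and \<zeta>: "\<zeta> \<in> blowup_cone Z"
        "\<tau> (blowup_class Z z) = blowup_class Z \<zeta>" for z \<zeta>
    proof -
      have *: "blowup_class Z z \<in> W \<inter> points ?X" using z W' by auto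
      have "F (blowup_class Z \<zeta>) = h (blowup_class Z z)" using bspec[OF W(5) *] \<zeta>(2) by simp
      then have "F (blowup_class Z \<zeta>) = P z / Q z" using bspec[OF W'(6) z(1)] by simp
      moreover have "blowup_class Z \<zeta> \<in> V" using * W(3) \<zeta>(2) by auto
      ultimately show ?thesis using F[OF \<zeta>(1)] Vmem[OF \<zeta>(1)] W'(6) z by auto
    qed
    \<comment> \<open>The cross-multiplied form of \<open>P / Q = L $ i / L $ e\<close>, which holds
      at the points supplied by \<open>D\<close>. Were \<open>f\<close> nonzero at
      \<open>z0\<close>, it would be nonzero on a whole neighbourhood, and that contains such a
      point.\<close>
    define f where "f z = P z * L z $ e - Q z * L z $ i" for z
    have fpoly: "f \<in> cone_polyfuns Z" unfolding f_def by (intro polyfuns_intros W' L)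
    have "f z0 = 0"
    proof (rule ccontr)
      assume "f z0 \<noteq> 0"
      then have "z0 \<in> W' \<inter> {z \<in> blowup_cone Z. f z \<noteq> 0}" using W' z0 by simp
      moreover have "openin (ztop (cone_space Z)) (W' \<inter> {z \<in> blowup_cone Z. f z \<noteq> 0})"
        by (intro openin_Int W' openin_affine_nonzero fpoly)
      ultimately obtain z where z: "z \<in> W'" "f z \<noteq> 0" "blowup_class Z z \<in> points ?X"
        "\<forall>\<zeta>\<in>blowup_cone Z. \<tau> (blowup_class Z z) = blowup_class Z \<zeta> \<longrightarrow>
          (\<forall>i j. A \<zeta> $ i * L z $ j = A \<zeta> $ j * L z $ i)" using D by blast
      obtain \<zeta> where \<zeta>: "\<zeta> \<in> blowup_cone Z" "\<tau> (blowup_class Z z) = blowup_class Z \<zeta>"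
        using blowup_pointE[OF morphism_points[OF \<tau> z(3)]] by metis
      have "A \<zeta> $ i * L z $ e = A \<zeta> $ e * L z $ i" using z(4) \<zeta> by blast
      moreover have "Q z \<noteq> 0" "A \<zeta> $ e \<noteq> 0" "A \<zeta> $ i * Q z = P z * A \<zeta> $ e"
        using quot[OF z(1,3) \<zeta>] by (auto simp: field_simps)
      ultimately have "(P z * L z $ e) * A \<zeta> $ e = (Q z * L z $ i) * A \<zeta> $ e" by algebra
      then show False using z(2) \<open>A \<zeta> $ e \<noteq> 0\<close> by (simp add: f_def)
    qed
    then show ?thesis using quot[OF W'(2) z0(2) \<zeta>0] e
      by (simp add: f_def field_simps)
  qed
  have "(A \<zeta>0 $ i * L z0 $ j) * A \<zeta>0 $ e = (A \<zeta>0 $ j * L z0 $ i) * A \<zeta>0 $ e"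
    using key[of i] key[of j] by algebra
  then show ?thesis using e by simp
qed simp

end

section \<open>The Hessian near its new node\<close>

lemma exhaust_5: "x = 0 \<or> x = 1 \<or> x = 2 \<or> x = 3 \<or> x = 4" for x :: 5
proof (induct x)
  case (of_int z)
  then have "0 \<le> z" and "z < 5" by simp_all
  then have "z = 0 \<or> z = 1 \<or> z = 2 \<or> z = 3 \<or> z = 4" by arith
  then show ?case by auto
qed

lemma UNIV_5: "(UNIV :: 5 set) = {0, 1, 2, 3, 4}" using exhaust_5 by auto

lemma forall_5: "(\<forall>i::5. P i) \<longleftrightarrow> P 0 \<and> P 1 \<and> P 2 \<and> P 3 \<and> P 4" by (metis exhaust_5)

lemma sum_5: "sum f (UNIV :: 5 set) = f 0 + f 1 + f 2 + f 3 + f 4"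
  unfolding UNIV_5 by (simp add: ac_simps)

definition node_vec :: "'k::field ^ 5" where "node_vec = (\<chi> a. if a = 4 then - 4 else 1)"

text \<open>The projection along the node onto the hyperplane where the last coordinate is 0; the
  divisor 4 comes from the last coordinate -4 of the node. Vectors modulo the node are thereby
  replaced by canonical representatives.\<close>

definition off_node :: "'k::field ^ 5 \<Rightarrow> 'k ^ 5" where
  "off_node w = w + (w $ 4 / 4) *s node_vec"

definition e2 :: "'k::field ^ 5 \<Rightarrow> 'k" where
  "e2 u = u$0 * u$1 + u$0 * u$2 + u$0 * u$3 + u$1 * u$2 + u$1 * u$3 + u$2 * u$3"

definition e3 :: "'k::field ^ 5 \<Rightarrow> 'k" where
  "e3 u = u$0 * u$1 * u$2 + u$0 * u$1 * u$3 + u$0 * u$2 * u$3 + u$1 * u$2 * u$3"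

definition e4 :: "'k::field ^ 5 \<Rightarrow> 'k" where
  "e4 u = u$0 * u$1 * u$2 * u$3"

lemma distinct_UNIV_5:
  fixes a b c d :: 5
  assumes "distinct [a, b, c, d, 4]"
  shows "UNIV = {a, b, c, d, 4}"
proof -
  have "card {a, b, c, d, 4} = 5" using assms by simp
  then have "{a, b, c, d, 4} = (UNIV :: 5 set)" by (intro card_subset_eq) auto
  then show ?thesis by simp
qed

lemma sum_distinct_5:
  fixes a b c d :: 5
  assumes "distinct [a, b, c, d, 4]"
  shows "sum f UNIV = f a + f b + f c + f d + f 4"
  unfolding distinct_UNIV_5[OF assms] using assms by (simp add: add.assoc)

text \<open>The first four parameters are equal, so the indices other than 4 may be named in any
  order. A computation for one pair of indices then holds for every pair.\<close>

lemma quartic_distinct: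
  fixes a b c d :: 5 and y :: "'k::field_char_0 ^ 5"
  assumes "distinct [a, b, c, d, 4]"
  shows "quartic y = y$a * y$b * y$c * y$d + y$4 / 16 *
    (y$a * y$b * y$c + y$a * y$b * y$d + y$a * y$c * y$d + y$b * y$c * y$d)"
proof -
  have "UNIV - {a} = {b, c, d, 4}" "UNIV - {b} = {a, c, d, 4}" "UNIV - {c} = {a, b, d, 4}"
    "UNIV - {d} = {a, b, c, 4}" "UNIV - {4} = {a, b, c, d}"
    using distinct_UNIV_5[OF assms] assms by auto
  then show ?thesis
    unfolding quartic_def sum_distinct_5[OF assms] using assms by (simp add: lam_def algebra_simps)
qed

lemma quartic_eq:
  fixes y :: "'k::field_char_0 ^ 5"
  shows "quartic y = y$0 * y$1 * y$2 * y$3 + y$4 / 16 *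
    (y$0 * y$1 * y$2 + y$0 * y$1 * y$3 + y$0 * y$2 * y$3 + y$1 * y$2 * y$3)"
  by (rule quartic_distinct) simp

lemma quartic_scale: "quartic (c *s y) = c ^ 4 * quartic y" for y :: "'k::field_char_0 ^ 5"
  unfolding quartic_eq by (simp add: algebra_simps power4_eq_xxxx)

lemma off_node_nth: "off_node w $ c = (if c = 4 then 0 else w $ c + w $ 4 / 4)"
  for w :: "'k::field_char_0 ^ 5"
  by (simp add: off_node_def node_vec_def)

text \<open>Substituting \<open>u + s\<close> for the first four coordinates and
  \<open>-4 * s\<close> for the last, the terms in s^4 cancel because the node lies on the quartic,
  and the coefficient of s^3 is a multiple of the coordinate sum of u, which is 0. The factor 4
  clears denominators.\<close>

lemma quartic_near_node:
  fixes x :: "'k::field_char_0 ^ 5"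
  assumes "sum (($) x) UNIV = 0"
  shows "4 * quartic x = 2 * (- x$4 / 4)\<^sup>2 * e2 (off_node x) + 3 * (- x$4 / 4) * e3 (off_node x)
    + 4 * e4 (off_node x)"
proof -
  define s where "s = - x$4 / 4"
  have x4: "x$4 = -4 * s" by (simp add: s_def)
  define u0 u1 u2 u3 where "u0 = off_node x $ 0" and "u1 = off_node x $ 1" and "u2 = off_node x $ 2"
    and "u3 = off_node x $ 3"
  note u_def = u0_def u1_def u2_def u3_def
  have xs: "x$0 = u0 + s" "x$1 = u1 + s" "x$2 = u2 + s" "x$3 = u3 + s"
    by (simp_all add: u_def off_node_nth s_def)
  have "u0 + u1 + u2 + u3 = 0" using assms unfolding sum_5 xs x4 by (simp add: algebra_simps)
  then have u3: "u3 = - u0 - u1 - u2" by algebra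
  show ?thesis
    unfolding quartic_eq e2_def e3_def e4_def u_def[symmetric] xs x4 u3
    by (simp add: field_simps power2_eq_square)
qed

lemma new_node_eq: "new_node = pt node_vec" by (simp add: new_node_def node_vec_def)

lemma node_vec_nonzero: "node_vec \<noteq> (0 :: 'k::field_char_0 ^ 5)"
  by (auto simp: node_vec_def vec_eq_iff)

lemma sum_scale: "sum (($) (c *s y)) UNIV = c * sum (($) y) UNIV" for y :: "'k::field ^ 5"
  by (simp add: sum_distrib_left)

lemma sum_add: "sum (($) (v + w)) UNIV = sum (($) v) UNIV + sum (($) w) UNIV" for v :: "'k::field ^ 5"
  by (simp add: sum.distrib)

lemma sum_node_vec: "sum (($) node_vec) UNIV = 0"
  by (simp add: node_vec_def sum_5)

lemma pt_in_Hessian_iff: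
  fixes x :: "'k::field_char_0 ^ 5"
  assumes "x \<noteq> 0"
  shows "pt x \<in> Hessian \<longleftrightarrow> sum (($) x) UNIV = 0 \<and> quartic x = 0"
proof
  assume "pt x \<in> Hessian"
  then obtain y where y: "pt x = pt y" "y \<noteq> 0" "sum (($) y) UNIV = 0" "quartic y = 0"
    unfolding Hessian_def by (elim CollectE exE conjE) (rule that)
  obtain c where "x = c *s y" using y(1) unfolding pt_eq_iff[OF y(2)] by blast
  then show "sum (($) x) UNIV = 0 \<and> quartic x = 0" using y(3,4) by (simp only: sum_scale quartic_scale) simp
qed (use assms in \<open>auto simp: Hessian_def\<close>)

lemma off_node_scale: "off_node (c *s w) = c *s off_node w"
  by (simp add: off_node_def vec_eq_iff algebra_simps)

lemma off_node_add: "off_node (v + w) = off_node v + off_node w"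
  by (simp add: off_node_def vec_eq_iff add_divide_distrib algebra_simps)

lemma off_node_node: "off_node node_vec = (0 :: 'k::field_char_0 ^ 5)"
  by (simp add: off_node_def node_vec_def vec_eq_iff)

lemma off_node_eq_0_iff: "off_node w = 0 \<longleftrightarrow> w \<in> insert 0 new_node" for w :: "'k::field_char_0 ^ 5"
proof
  assume "off_node w = 0"
  then have "w $ i + w $ 4 / 4 * node_vec $ i = 0" for i by (simp add: off_node_def vec_eq_iff)
  then have "w = (- w $ 4 / 4) *s node_vec" by (simp add: vec_eq_iff eq_neg_iff_add_eq_0)
  then show "w \<in> insert 0 new_node" unfolding new_node_eq insert_0_pt[OF node_vec_nonzero] by blast
next
  assume "w \<in> insert 0 new_node"
  then obtain c where "w = c *s node_vec"
    unfolding new_node_eq insert_0_pt[OF node_vec_nonzero] by blast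
  then show "off_node w = 0" by (simp add: off_node_scale off_node_node)
qed

lemma e_scale: "e2 (c *s u) = c ^ 2 * e2 u" "e3 (c *s u) = c ^ 3 * e3 u" "e4 (c *s u) = c ^ 4 * e4 u"
  by (simp_all add: e2_def e3_def e4_def algebra_simps power2_eq_square power3_eq_cube power4_eq_xxxx)

text \<open>Along \<open>y + t *s v\<close> the off-node part is \<open>t *s off_node v\<close>, and
  every term of \<open>quartic_near_node\<close> has degree at least 2 in the off-node part.\<close>

lemma new_node_singular: "new_node \<in> (Hessian_singular :: ('k::field_char_0 ^ 5) set set)"
  unfolding Hessian_singular_def
proof (intro CollectI conjI ballI allI impI)
  show "new_node \<in> (Hessian :: ('k ^ 5) set set)"
    unfolding new_node_eq pt_in_Hessian_iff[OF node_vec_nonzero] quartic_eq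
    by (simp add: node_vec_def sum_5)
  fix y v :: "'k ^ 5" assume y: "y \<in> new_node" and v: "sum (($) v) UNIV = 0"
  obtain c where c: "y = c *s node_vec" using y by (auto simp: new_node_eq pt_eq[OF node_vec_nonzero])
  define S where "S = [:c, - v $ 4 / 4:]"
  define G where "G = smult (e2 (off_node v) / 2) (S ^ 2) + smult (3 / 4 * e3 (off_node v)) (S * [:0, 1:])
    + smult (e4 (off_node v)) [:0, 0, 1:]"
  have "quartic (y + t *s v) = t\<^sup>2 * poly G t" for t
  proof -
    have "sum (($) (y + t *s v)) UNIV = 0"
      using v by (simp only: c sum_add sum_scale sum_node_vec) simp
    moreover have "off_node (y + t *s v) = t *s off_node v"
      by (simp add: off_node_add off_node_scale c off_node_node)
    moreover have "- (y + t *s v) $ 4 / 4 = poly S t"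
      by (simp add: S_def c node_vec_def field_simps)
    ultimately have "4 * quartic (y + t *s v) = 2 * (poly S t)\<^sup>2 * (t ^ 2 * e2 (off_node v))
      + 3 * poly S t * (t ^ 3 * e3 (off_node v)) + 4 * (t ^ 4 * e4 (off_node v))"
      by (subst quartic_near_node) (simp_all only: e_scale)
    then show ?thesis by (simp add: G_def field_simps power2_eq_square power3_eq_cube power4_eq_xxxx)
  qed
  then show "\<exists>G. \<forall>t. quartic (y + t *s v) = t\<^sup>2 * poly G t" by blast
qed

lemma Hessian_singular_point:
  assumes "p \<in> (Hessian_singular :: ('k::field_char_0 ^ 5) set set)"
  shows "\<exists>v. v \<noteq> 0 \<and> p = pt v"
  using assms by (auto simp: Hessian_singular_def Hessian_def)

interpretation H: blowup_centre "Hessian_singular :: ('k::field_char_0 ^ 5) set set"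
  by standard (rule Hessian_singular_point)

text \<open>The partial derivative of the quartic along \<open>e\<^sub>0 - e\<^sub>1\<close> is \<open>N (x\<^sub>1 - x\<^sub>0)\<close>.\<close>

lemma singular_squares_eq:
  fixes x :: "'k::field_char_0 ^ 5"
  assumes nz: "\<And>a. x $ a \<noteq> 0" and sing: "pt x \<in> Hessian_singular"
  shows "(x $ 0 - x $ 1) * (x $ 0 + x $ 1) = 0"
proof -
  have x: "x \<noteq> 0" using nz[of 0] by auto
  have q: "quartic x = 0" using sing pt_in_Hessian_iff[OF x] by (simp add: Hessian_singular_def)
  let ?v = "(\<chi> i. if i = 0 then 1 else if i = 1 then - 1 else 0) :: 'k ^ 5"
  have "sum (($) ?v) UNIV = 0" by (simp add: sum_5)
  then obtain G where G: "\<And>t. quartic (x + t *s ?v) = t\<^sup>2 * poly G t"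
    using sing self_in_pt[OF x] unfolding Hessian_singular_def by blast
  define N where "N = x$2 * x$3 + x$4 / 16 * (x$2 + x$3)"
  have "quartic (x + t *s ?v) = quartic x + t * N * (x$1 - x$0 - t)" for t
    unfolding quartic_eq N_def by (simp add: field_simps)
  then have eq: "t * (N * (x$1 - x$0 - t)) = t * (t * poly G t)" for t
    using G[of t] q by (simp add: power2_eq_square mult.assoc)
  \<comment> \<open>The equation divided by \<open>t\<close> is known only for nonzero
    \<open>t\<close>. As a polynomial with infinitely many zeros, \<open>P\<close> vanishes at 0 as
    well, and this is the vanishing of the derivative.\<close>
  define P where "P = [:N * (x$1 - x$0), - N:] - [:0, 1:] * G"
  have "poly P t = 0" if "t \<noteq> 0" for t
    using eq[of t] that unfolding mult_cancel_left by (simp add: P_def algebra_simps)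
  then have "UNIV - {0} \<subseteq> {t. poly P t = 0}" by auto
  then have "infinite {t. poly P t = 0}"
    using infinite_UNIV_char_0[where 'a = 'k] by (meson finite.emptyI finite_Diff2 finite_insert finite_subset)
  then have "P = 0" using poly_roots_finite by blast
  then have "poly P 0 = 0" by simp
  then have "N * (x$1 - x$0) = 0" by (simp add: P_def)
  \<comment> \<open>Where the factor \<open>N\<close> of the derivative is 0, the quartic reduces to
    its other term, which is \<open>x $ 0 + x $ 1\<close> times nonzero coordinates.\<close>
  moreover have "x$0 + x$1 = 0" if "N = 0"
  proof -
    have "quartic x = N * x$0 * x$1 + x$2 * x$3 * x$4 / 16 * (x$0 + x$1)"
      unfolding quartic_eq N_def by (simp add: field_simps)
    then show ?thesis using q that nz by simp
  qed
  ultimately show ?thesis by auto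
qed

abbreviation X_cone :: "('k::field, 5) blowup_cone set" where
  "X_cone \<equiv> blowup_cone Hessian_singular"

abbreviation X_class :: "('k::field, 5) blowup_cone \<Rightarrow> 'k xpoint" where
  "X_class \<equiv> blowup_class Hessian_singular"

abbreviation X_cone_top :: "('k::field, 5) blowup_cone topology" where
  "X_cone_top \<equiv> ztop (cone_space Hessian_singular)"

abbreviation X_polyfuns :: "(('k::field, 5) blowup_cone \<Rightarrow> 'k) set" where
  "X_polyfuns \<equiv> cone_polyfuns Hessian_singular"

section \<open>Density near the exceptional curve\<close>

lemma polyfuns_on_curve:
  assumes "f \<in> polyfuns K" "\<And>k. k \<in> K \<Longrightarrow> \<exists>P. \<forall>t. k (z t) = poly P t"
  shows "\<exists>P. \<forall>t. f (z t) = poly P t"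
  using assms(1)
proof induction
  case (const c)
  show ?case by (rule exI[of _ "[:c:]"]) simp
next
  case (add f g)
  then obtain P Q where "\<forall>t. f (z t) = poly P t" "\<forall>t. g (z t) = poly Q t" by blast
  then show ?case by (intro exI[of _ "P + Q"]) simp
next
  case (mult f g)
  then obtain P Q where "\<forall>t. f (z t) = poly P t" "\<forall>t. g (z t) = poly Q t" by blast
  then show ?case by (intro exI[of _ "P * Q"]) simp
qed (use assms(2) in auto)

text \<open>Polynomials in two variables are encoded as \<open>'k poly poly\<close>: the outer
  variable is evaluated at the constant polynomial \<open>[:t:]\<close>, the coefficients afterwards
  at \<open>s\<close>.\<close>

lemma polyfuns_on_surface:
  assumes "f \<in> polyfuns K" "\<And>k. k \<in> K \<Longrightarrow> \<exists>P. \<forall>s t. k (z s t) = poly (poly P [:t:]) s"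
  shows "\<exists>P. \<forall>s t. f (z s t) = poly (poly P [:t:]) s"
  using assms(1)
proof induction
  case (const c)
  show ?case by (rule exI[of _ "[:[:c:]:]"]) simp
next
  case (add f g)
  then obtain P Q where "\<forall>s t. f (z s t) = poly (poly P [:t:]) s" "\<forall>s t. g (z s t) = poly (poly Q [:t:]) s"
    by blast
  then show ?case by (intro exI[of _ "P + Q"]) simp
next
  case (mult f g)
  then obtain P Q where "\<forall>s t. f (z s t) = poly (poly P [:t:]) s" "\<forall>s t. g (z s t) = poly (poly Q [:t:]) s"
    by blast
  then show ?case by (intro exI[of _ "P * Q"]) simp
qed (use assms(2) in auto)

lemma poly_zero_of_infinite: "infinite S \<Longrightarrow> (\<And>t. t \<in> S \<Longrightarrow> poly P t = 0) \<Longrightarrow> P = 0"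
  for P :: "'a::{comm_ring_1, ring_no_zero_divisors} poly"
  by (metis (mono_tags, lifting) finite_subset mem_Collect_eq poly_roots_finite subsetI)

text \<open>The quadratic polynomial divides a power of \<open>C\<close> times \<open>h\<close>, by pseudo-division.\<close>

lemma vanishes_on_double_cover:
  fixes A B C :: "'k::field poly" and h :: "'k poly poly"
  assumes inf: "infinite S"
    and roots: "\<And>s. s \<in> S \<Longrightarrow> \<exists>t t'. t \<noteq> t' \<and>
      (\<forall>r\<in>{t, t'}. poly A s + poly B s * r + poly C s * r\<^sup>2 = 0 \<and> poly (poly h [:r:]) s = 0)"
    and A: "poly A 0 = 0" and C: "poly C 0 \<noteq> 0"
  shows "poly (poly h 0) 0 = 0"
proof -
  define G where "G = [:A, B, C:]"
  have C0: "C \<noteq> 0" using C by auto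
  have G: "G \<noteq> 0" "degree G = 2" "coeff G (degree G) = C" using C0 by (auto simp: G_def)
  obtain q r where qr: "pseudo_divmod h G = (q, r)" by fastforce
  define k where "k = Suc (degree h) - degree G"
  have div: "smult (C ^ k) h = G * q + r" and r: "r = 0 \<or> degree r < 2"
    using pseudo_divmod[OF G(1) qr] G by (auto simp: k_def)
  define \<alpha> \<beta> where "\<alpha> = coeff r 0" and "\<beta> = coeff r 1"
  have r_eq: "r = [:\<alpha>, \<beta>:]"
  proof (rule poly_eqI)
    show "coeff r n = coeff [:\<alpha>, \<beta>:] n" for n
      using r coeff_eq_0[of r n] by (auto simp: \<alpha>_def \<beta>_def coeff_pCons split: nat.splits)
  qed
  have ev: "poly C s ^ k * poly (poly h [:t:]) s =
      (poly A s + poly B s * t + poly C s * t\<^sup>2) * poly (poly q [:t:]) s + (poly \<alpha> s + poly \<beta> s * t)" for s t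
    using arg_cong[OF div, of "\<lambda>p. poly (poly p [:t:]) s"]
    by (simp add: G_def r_eq algebra_simps power2_eq_square)
  \<comment> \<open>A remainder of degree at most 1 in the fibre variable that vanishes at two
    distinct roots has both coefficients zero.\<close>
  have zero: "poly \<alpha> s = 0 \<and> poly \<beta> s = 0" if "s \<in> S" for s
  proof -
    obtain t t' where t: "t \<noteq> t'" and "\<forall>r\<in>{t, t'}. poly A s + poly B s * r + poly C s * r\<^sup>2 = 0 \<and>
      poly (poly h [:r:]) s = 0" using roots[OF \<open>s \<in> S\<close>] by blast
    then have 1: "poly \<alpha> s + poly \<beta> s * t = 0" "poly \<alpha> s + poly \<beta> s * t' = 0"
      using ev[of s t] ev[of s t'] by auto
    then have "poly \<beta> s * (t - t') = 0" by algebra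
    with t 1 show ?thesis by auto
  qed
  have "\<alpha> = 0" "\<beta> = 0" using poly_zero_of_infinite[OF inf] zero by blast+
  then show ?thesis using ev[of 0 0] A C by simp
qed

lemma quadratic_roots:
  fixes a b c :: "'k::{alg_closed_field, field_char_0}"
  assumes "c \<noteq> 0" "b\<^sup>2 - 4 * a * c \<noteq> 0"
  shows "\<exists>t t'. t \<noteq> t' \<and> (\<forall>r\<in>{t, t'}. a + b * r + c * r\<^sup>2 = 0)"
proof -
  obtain d where d: "d ^ 2 = b\<^sup>2 - 4 * a * c" using nth_root_exists[of 2] by auto
  have "a + b * ((- b + e) / (2 * c)) + c * ((- b + e) / (2 * c))\<^sup>2 = 0" if "e\<^sup>2 = b\<^sup>2 - 4 * a * c" for e
  proof -
    have "4 * c * (a + b * ((- b + e) / (2 * c)) + c * ((- b + e) / (2 * c))\<^sup>2) = 4 * a * c - b\<^sup>2 + e\<^sup>2"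
      using assms(1) by (simp add: field_simps power2_eq_square)
    then show ?thesis using that assms(1) by simp
  qed
  moreover have "(- b + d) / (2 * c) \<noteq> (- b + - d) / (2 * c)" using d assms by auto
  moreover have "(- d)\<^sup>2 = b\<^sup>2 - 4 * a * c" using d by simp
  ultimately show ?thesis using d by blast
qed

abbreviation vec_coords :: "('k::field ^ 'n \<Rightarrow> 'k) set" where
  "vec_coords \<equiv> {\<lambda>v. v $ i | i. True}"

lemma polyfuns_nth: "(\<lambda>v. v $ i) \<in> polyfuns vec_coords"
  by (intro polyfuns.coord) auto

text \<open>\<open>m\<close> is the point at infinity of the line through \<open>w\<close>. By
  homogeneity the restriction of \<open>\<Psi>\<close> to the line, read in the inverse parameter,
  extends to the value \<open>\<Psi> m\<close> there, so it cannot vanish identically.\<close>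

lemma homogeneous_nonzero_on_line:
  fixes \<Psi> :: "'k::field_char_0 ^ 'n \<Rightarrow> 'k"
  assumes \<Psi>: "\<Psi> \<in> polyfuns vec_coords" and hom: "\<And>c v. \<Psi> (c *s v) = c ^ d * \<Psi> v" and m: "\<Psi> m \<noteq> 0"
  shows "\<exists>P. P \<noteq> 0 \<and> (\<forall>t. \<Psi> (w + t *s m) = poly P t)"
proof -
  obtain P where P: "\<forall>t. \<Psi> (w + t *s m) = poly P t"
    using polyfuns_on_curve[OF \<Psi>, of "\<lambda>t. w + t *s m"]
    by (force intro: exI[of _ "[:w $ _, m $ _:]"])
  obtain Q where Q: "\<forall>t. \<Psi> (m + t *s w) = poly Q t"
    using polyfuns_on_curve[OF \<Psi>, of "\<lambda>t. m + t *s w"]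
    by (force intro: exI[of _ "[:m $ _, w $ _:]"])
  have "P \<noteq> 0"
  proof
    assume "P = 0"
    have "poly Q t = 0" if t: "t \<in> UNIV - {0}" for t
    proof -
      have "m + t *s w = t *s (w + (1 / t) *s m)"
        using t by (simp add: vec_eq_iff field_simps)
      then have "\<Psi> (m + t *s w) = t ^ d * poly P (1 / t)" by (simp only: hom spec[OF P])
      then show ?thesis using Q \<open>P = 0\<close> by simp
    qed
    moreover have "infinite (UNIV - {0 :: 'k})"
      using infinite_UNIV_char_0[where 'a = 'k] by simp
    ultimately have "Q = 0" using poly_zero_of_infinite by blast
    then show False using Q m by (metis add.right_neutral poly_0 vector_smult_lzero)
  qed
  then show ?thesis using P by blast
qed

text \<open>A direction at the node is a nonzero vector modulo the node; \<open>u $ 4 = 0\<close>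
  selects the representative.\<close>

definition node_conic :: "'k::field ^ 5 \<Rightarrow> bool" where
  "node_conic u \<longleftrightarrow> u $ 4 = 0 \<and> sum (($) u) UNIV = 0 \<and> e2 u = 0 \<and> u \<noteq> 0"

text \<open>The point over the node in direction \<open>u\<close>. The projections from the other
  centres are defined at the node, so there the component is the node itself.\<close>

definition exc_rep :: "'k::field ^ 5 \<Rightarrow> ('k, 5) blowup_cone" where
  "exc_rep u = (node_vec, \<lambda>p\<in>Hessian_singular. if p = new_node then u else node_vec)"

text \<open>All inequalities that hold at the node itself, hence near it: nonzero coordinates for
  the Cremona map, \<open>x $ 0 + x $ 1\<close> for \<open>singular_squares_eq\<close>, and then the
  leading coefficients \<open>N\<close> for the projections from \<open>P_node a b\<close> with
  \<open>a\<close> and \<open>b\<close> different from 4 and from \<open>P_node a 4\<close>. At the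
  node these last two kinds of factor are 1/2 and 3.\<close>

definition near_poly :: "'k::field ^ 5 \<Rightarrow> 'k" where
  "near_poly x = (\<Prod>a\<in>UNIV. x $ a) * (x $ 0 + x $ 1) *
    (\<Prod>p\<in>{p. distinct [fst p, snd p, 4]}. x $ fst p * x $ snd p + x $ 4 / 16 * (x $ fst p + x $ snd p)) *
    (\<Prod>p\<in>{p. distinct [fst p, fst (snd p), snd (snd p), 4]}.
      x $ fst p * x $ fst (snd p) + x $ fst p * x $ snd (snd p) + x $ fst (snd p) * x $ snd (snd p))"

text \<open>Kept apart from \<open>near_poly\<close> because every factor vanishes at the node: the
  differences have to be controlled through the direction of approach. They ensure that a point is
  nonsingular and that its off-node part is nonzero.\<close>

definition diff_poly :: "'k::field ^ 5 \<Rightarrow> 'k" where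
  "diff_poly x = (\<Prod>p\<in>{p. distinct [fst p, snd p, 4]}. x $ fst p - x $ snd p)"

lemma polyfuns_divide: "f \<in> polyfuns K \<Longrightarrow> (\<lambda>v. f v / c) \<in> polyfuns K" for c :: "'k::field"
  using polyfuns.mult[OF _ polyfuns.const[of "inverse c" K]] by (simp add: divide_inverse)

lemma near_poly_polyfun:
  "(\<lambda>z. near_poly (fst z)) \<in> cone_polyfuns Z" "(\<lambda>z. diff_poly (fst z)) \<in> cone_polyfuns Z"
  unfolding near_poly_def diff_poly_def
  by (intro polyfuns_intros polyfuns_divide polyfuns_fst)+

lemma near_poly_node: "near_poly (node_vec :: 'k::field_char_0 ^ 5) \<noteq> 0"
  unfolding near_poly_def by (auto simp: node_vec_def prod_zero_iff)

lemma prod_nonzeroD: "prod f A \<noteq> (0 :: 'a::field) \<Longrightarrow> a \<in> A \<Longrightarrow> finite A \<Longrightarrow> f a \<noteq> 0"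
  by auto

lemma near_polyD:
  fixes x :: "'k::field ^ 5"
  assumes "near_poly x \<noteq> 0"
  shows "x $ a \<noteq> 0" "x $ 0 + x $ 1 \<noteq> 0"
    "\<And>c d. distinct [c, d, 4] \<Longrightarrow> x $ c * x $ d + x $ 4 / 16 * (x $ c + x $ d) \<noteq> 0"
    "\<And>c d e. distinct [c, d, e, 4] \<Longrightarrow> x $ c * x $ d + x $ c * x $ e + x $ d * x $ e \<noteq> 0"
proof -
  have *: "(\<Prod>a\<in>UNIV. x $ a) \<noteq> 0" "x $ 0 + x $ 1 \<noteq> 0"
    "(\<Prod>p\<in>{p. distinct [fst p, snd p, 4]}. x $ fst p * x $ snd p + x $ 4 / 16 * (x $ fst p + x $ snd p)) \<noteq> 0"
    "(\<Prod>p\<in>{p. distinct [fst p, fst (snd p), snd (snd p), 4]}.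
      x $ fst p * x $ fst (snd p) + x $ fst p * x $ snd (snd p) + x $ fst (snd p) * x $ snd (snd p)) \<noteq> 0"
    using assms unfolding near_poly_def by (simp_all only: mult_eq_0_iff de_Morgan_disj simp_thms)
  show "x $ a \<noteq> 0" "x $ 0 + x $ 1 \<noteq> 0" using *(1,2) by simp_all
  show "x $ c * x $ d + x $ 4 / 16 * (x $ c + x $ d) \<noteq> 0" if "distinct [c, d, 4]" for c d
    using prod_nonzeroD[OF *(3), of "(c, d)"] that by simp
  show "x $ c * x $ d + x $ c * x $ e + x $ d * x $ e \<noteq> 0" if "distinct [c, d, e, 4]" for c d e
    using prod_nonzeroD[OF *(4), of "(c, d, e)"] that by simp
qed

lemma diff_polyD: "diff_poly x \<noteq> 0 \<Longrightarrow> distinct [c, d, 4] \<Longrightarrow> x $ c \<noteq> x $ d"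
  unfolding diff_poly_def prod_zero_iff[OF finite] by auto

lemma diff_polyI: "(\<And>c d. distinct [c, d, 4] \<Longrightarrow> x $ c \<noteq> x $ d) \<Longrightarrow> diff_poly x \<noteq> 0"
  unfolding diff_poly_def by (auto simp: prod_zero_iff)

text \<open>
  Points \<open>node + r u\<close>, up to a multiple of the node, on a line of directions \<open>u\<close> through a given
  point of the conic; \<open>\<kappa>\<close> is chosen to make the quadratic equation for \<open>r\<close> nondegenerate there.
\<close>

lemma generic_point_near:
  fixes u :: "'k::{alg_closed_field, field_char_0} ^ 5"
  assumes u: "node_conic u" and f: "f \<in> X_polyfuns" "f (exc_rep u) \<noteq> 0"
  shows "\<exists>z\<in>H.graph_cone Hessian. f z \<noteq> 0 \<and> near_poly (fst z) \<noteq> 0 \<and> diff_poly (fst z) \<noteq> 0"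
proof (rule ccontr)
  assume none: "\<not> ?thesis"
  \<comment> \<open>An auxiliary direction of coordinate sum 0 whose first four coordinates 0, 1, 2,
    -3 are distinct. There \<open>e2\<close> is -7, \<open>e3\<close> is -6 and \<open>e4\<close> is
    0, so \<open>\<Psi>\<close> below does not vanish.\<close>
  define m :: "'k ^ 5" where "m = (\<chi> i. if i = 1 then 1 else if i = 2 then 2 else if i = 3 then - 3 else 0)"
  \<comment> \<open>The expression is the leading coefficient \<open>C\<close> of the quadratic at
    the given point of the conic; it can be made nonzero unless \<open>e3 u\<close> and
    \<open>e4 u\<close> both vanish.\<close>
  obtain \<kappa> where \<kappa>: "3 * \<kappa> * e3 u + 4 * e4 u \<noteq> 0"
  proof (cases "e3 u = 0")
    case True
    have "e4 u \<noteq> 0"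
    proof
      assume "e4 u = 0"
      define a b c d where "a = u$0" and "b = u$1" and "c = u$2" and "d = u$3"
      note abcd = a_def b_def c_def d_def
      have "u$4 = 0" and s: "a + b + c + d = 0" and e: "e2 u = 0"
        using u by (auto simp: node_conic_def sum_5 abcd)
      \<comment> \<open>The four coordinates are the roots of the monic quartic whose coefficients
        are their elementary symmetric functions. If all of these vanish, so do the
        coordinates.\<close>
      have "x ^ 4 = 0" if "(x - a) * (x - b) * (x - c) * (x - d) = 0" for x
      proof -
        have "x ^ 4 - (a + b + c + d) * x ^ 3 + e2 u * x ^ 2 - e3 u * x + e4 u = 0"
          using that unfolding e2_def e3_def e4_def abcd[symmetric] by algebra
        then show ?thesis using s e True \<open>e4 u = 0\<close> by simp
      qed
      then have "a = 0" "b = 0" "c = 0" "d = 0" by fastforce+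
      then have "u = 0" using \<open>u$4 = 0\<close> by (simp add: vec_eq_iff forall_5 abcd)
      then show False using u by (simp add: node_conic_def)
    qed
    then show ?thesis using True that[of 0] by simp
  next
    case False
    show ?thesis
    proof (cases "e4 u = 0")
      case True
      then show ?thesis using False that[of 1] by simp
    next
      case e4: False
      then show ?thesis using that[of 0] by simp
    qed
  qed
  \<comment> \<open>Three conditions on a direction in one homogeneous polynomial: \<open>e2\<close>
    nonzero makes the roots \<open>r\<close> nonzero, the middle factor is the discriminant that
    makes them distinct, and \<open>diff_poly\<close> separates the coordinates.\<close>
  define \<Psi> :: "'k ^ 5 \<Rightarrow> 'k" where "\<Psi> v = e2 v * (9 * (e3 v)\<^sup>2 - 32 * e2 v * e4 v) * diff_poly v" for v
  have e_poly: "e2 \<in> polyfuns vec_coords" "e3 \<in> polyfuns vec_coords" "e4 \<in> polyfuns (vec_coords :: ('k ^ 5 \<Rightarrow> 'k) set)"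
    unfolding e2_def[abs_def] e3_def[abs_def] e4_def[abs_def]
    by (intro polyfuns_intros polyfuns_nth)+
  have "diff_poly (c *s v) = c ^ card {p :: 5 \<times> 5. distinct [fst p, snd p, 4]} * diff_poly v" for c and v :: "'k ^ 5"
    unfolding diff_poly_def by (simp add: right_diff_distrib[symmetric] prod.distrib)
  then have \<Psi>_hom: "\<Psi> (c *s v) = c ^ (8 + card {p :: 5 \<times> 5. distinct [fst p, snd p, 4]}) * \<Psi> v" for c v
    unfolding \<Psi>_def e_scale by (simp add: power_add algebra_simps power2_eq_square eval_nat_numeral)
  have \<Psi>_poly: "\<Psi> \<in> polyfuns vec_coords"
    unfolding \<Psi>_def[abs_def] diff_poly_def by (intro polyfuns_intros polyfuns_nth e_poly)
  have \<Psi>_m: "\<Psi> m \<noteq> 0"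
  proof -
    have "diff_poly m \<noteq> 0"
    proof (rule diff_polyI)
      fix c d :: 5 assume "distinct [c, d, 4]"
      then show "m $ c \<noteq> m $ d"
        using exhaust_5[of c] exhaust_5[of d] by (auto simp: m_def)
    qed
    then show ?thesis by (simp add: \<Psi>_def e2_def e3_def e4_def m_def)
  qed
  obtain P where P: "P \<noteq> 0" "\<And>t. \<Psi> (u + t *s m) = poly P t"
    using homogeneous_nonzero_on_line[OF \<Psi>_poly \<Psi>_hom \<Psi>_m] by blast
  have line: "\<exists>Q. \<forall>t. k (u + t *s m) = poly Q t" if "k \<in> vec_coords" for k :: "'k ^ 5 \<Rightarrow> 'k"
    using that by (force intro: exI[of _ "[:u $ _, m $ _:]"])
  obtain E2 where E2: "\<And>t. e2 (u + t *s m) = poly E2 t" using polyfuns_on_curve[OF e_poly(1), of "\<lambda>t. u + t *s m"] line by blast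
  obtain E3 where E3: "\<And>t. e3 (u + t *s m) = poly E3 t" using polyfuns_on_curve[OF e_poly(2), of "\<lambda>t. u + t *s m"] line by blast
  obtain E4 where E4: "\<And>t. e4 (u + t *s m) = poly E4 t" using polyfuns_on_curve[OF e_poly(3), of "\<lambda>t. u + t *s m"] line by blast
  \<comment> \<open>Coefficients of the quadratic in \<open>r\<close> obtained from
    \<open>quartic_near_node\<close> at \<open>(1 + r * \<kappa>) *s node_vec + r *s v\<close> after
    removing the factor r^2, which is the multiplicity of the node.\<close>
  define A B C where "A = smult 2 E2" and "B = smult (4 * \<kappa>) E2 + smult 3 E3"
    and "C = smult (2 * \<kappa>\<^sup>2) E2 + smult (3 * \<kappa>) E3 + smult 4 E4"
  have at0: "poly E2 0 = 0" "poly E3 0 = e3 u" "poly E4 0 = e4 u"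
    using E2[of 0] E3[of 0] E4[of 0] u by (simp_all add: node_conic_def)
  have A0: "poly A 0 = 0" and C0: "poly C 0 \<noteq> 0" using at0 \<kappa> by (simp_all add: A_def C_def)
  define S where "S = {t. poly (P * C) t \<noteq> 0}"
  have "P * C \<noteq> 0" using P C0 by auto
  then have inf: "infinite S"
    using Diff_infinite_finite[OF poly_roots_finite infinite_UNIV_char_0[where 'a = 'k], of "P * C"]
    by (simp add: S_def set_diff_eq)
  define v where "v t = u + t *s m" for t
  define x where "x t r = (1 + r * \<kappa>) *s node_vec + r *s v t" for t r
  define z :: "'k \<Rightarrow> 'k \<Rightarrow> ('k, 5) blowup_cone" where
    "z t r = (x t r, \<lambda>p\<in>Hessian_singular. if p = new_node then v t else x t r)" for t r
  \<comment> \<open>\<open>near_poly\<close> is nonzero at the node, so it can be absorbed into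
    \<open>f\<close>. \<open>diff_poly\<close> is zero there and is secured by the choice of
    \<open>S\<close> instead.\<close>
  define g where "g y = f y * near_poly (fst y)" for y
  have "g \<in> X_polyfuns"
    unfolding g_def by (intro polyfuns_intros f near_poly_polyfun)
  moreover have "\<exists>Q. \<forall>t r. k (z t r) = poly (poly Q [:r:]) t" if "k \<in> blowup_coords Hessian_singular" for k
  proof -
    have v: "\<exists>Q. \<forall>t r. v t $ i = poly (poly Q [:r:]) t" for i
      by (rule exI[of _ "[:[:u $ i, m $ i:]:]"]) (simp add: v_def)
    have x: "\<exists>Q. \<forall>t r. x t r $ i = poly (poly Q [:r:]) t" for i
      by (rule exI[of _ "[:[:node_vec $ i:], [:\<kappa> * node_vec $ i + u $ i, m $ i:]:]"])
        (simp add: x_def v_def algebra_simps)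
    show ?thesis using that
    proof (cases rule: blowup_coords_cases)
      case (2 p i)
      then show ?thesis using v[of i] x[of i] by (cases "p = new_node") (simp_all add: z_def)
    qed (use x in \<open>simp add: z_def\<close>)
  qed
  ultimately have "\<exists>h. \<forall>t r. g (z t r) = poly (poly h [:r:]) t"
    by (rule polyfuns_on_surface)
  then obtain h where h: "\<And>t r. g (z t r) = poly (poly h [:r:]) t" by blast
  have "\<exists>r r'. r \<noteq> r' \<and>
      (\<forall>q\<in>{r, r'}. poly A t + poly B t * q + poly C t * q\<^sup>2 = 0 \<and> poly (poly h [:q:]) t = 0)" if "t \<in> S" for t
  proof -
    have nz: "poly C t \<noteq> 0" "e2 (v t) \<noteq> 0" "9 * (e3 (v t))\<^sup>2 - 32 * e2 (v t) * e4 (v t) \<noteq> 0"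
      "diff_poly (v t) \<noteq> 0"
      using that P(2)[of t] by (auto simp: S_def \<Psi>_def v_def)
    have v4: "v t $ 4 = 0" and vsum: "sum (($) (v t)) UNIV = 0"
      using u by (simp_all only: v_def sum_add sum_scale) (auto simp: node_conic_def m_def sum_5)
    \<comment> \<open>The discriminant is independent of \<open>\<kappa>\<close>: replacing s by s +
      \<open>\<kappa>\<close> r is a unimodular substitution in the binary form 2 e2 s^2 + 3 e3 s r
      + 4 e4 r^2.\<close>
    have "(poly B t)\<^sup>2 - 4 * poly A t * poly C t = 9 * (e3 (v t))\<^sup>2 - 32 * e2 (v t) * e4 (v t)"
      by (simp add: A_def B_def C_def E2[symmetric] E3[symmetric] E4[symmetric] v_def[symmetric]
        power2_eq_square algebra_simps)
    then obtain r r' where r: "r \<noteq> r'" "\<forall>q\<in>{r, r'}. poly A t + poly B t * q + poly C t * q\<^sup>2 = 0"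
      using quadratic_roots[OF nz(1), of "poly B t" "poly A t"] nz(3) by metis
    have "poly (poly h [:q:]) t = 0" if q: "q \<in> {r, r'}" for q
    proof (rule ccontr)
      assume "poly (poly h [:q:]) t \<noteq> 0"
      then have fz: "f (z t q) \<noteq> 0" and near: "near_poly (x t q) \<noteq> 0"
        using h[of t q] by (auto simp: g_def z_def)
      have root: "poly A t + poly B t * q + poly C t * q\<^sup>2 = 0" using r(2) q by blast
      then have q0: "q \<noteq> 0" using nz(2) by (auto simp: A_def E2[symmetric] v_def)
      have x4: "- x t q $ 4 / 4 = 1 + q * \<kappa>" by (simp add: x_def v4 node_vec_def field_simps)
      have xsum: "sum (($) (x t q)) UNIV = 0"
        by (simp only: x_def sum_add sum_scale sum_node_vec vsum) simp
      have "off_node (v t) = v t" by (simp add: off_node_def v4)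
      then have "off_node (x t q) = q *s v t"
        by (simp add: x_def off_node_add off_node_scale off_node_node)
      then have "4 * quartic (x t q) = q\<^sup>2 * (poly A t + poly B t * q + poly C t * q\<^sup>2)"
        unfolding quartic_near_node[OF xsum] x4
        by (simp add: e_scale A_def B_def C_def E2[symmetric] E3[symmetric] E4[symmetric] v_def[symmetric]
          power2_eq_square power3_eq_cube power4_eq_xxxx algebra_simps)
      then have xq: "quartic (x t q) = 0" using root by simp
      have diff: "diff_poly (x t q) \<noteq> 0"
      proof (rule diff_polyI)
        fix c d :: 5 assume cd: "distinct [c, d, 4]"
        then have "x t q $ c - x t q $ d = q * (v t $ c - v t $ d)"
          by (simp add: x_def node_vec_def algebra_simps)
        then show "x t q $ c \<noteq> x t q $ d" using q0 diff_polyD[OF nz(4) cd] by auto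
      qed
      have x0: "x t q \<noteq> 0" using near_polyD(1)[OF near, of 0] by auto
      have xH: "pt (x t q) \<in> Hessian" using pt_in_Hessian_iff[OF x0] xsum xq by simp
      have xns: "pt (x t q) \<notin> Hessian_singular"
      proof
        assume "pt (x t q) \<in> Hessian_singular"
        from singular_squares_eq[OF near_polyD(1)[OF near] this]
        show False using near_polyD(2)[OF near] diff_polyD[OF diff, of 0 1] by simp
      qed
      have "v t \<noteq> 0" using nz(2) by (auto simp: e2_def)
      then have vn: "v t \<notin> insert 0 new_node"
        unfolding off_node_eq_0_iff[symmetric] \<open>off_node (v t) = v t\<close> .
      have "z t q \<in> X_cone"
        using vn x0 H.off_centre[OF x0 xns] by (auto simp: z_def blowup_cone_def)
      moreover have "\<exists>c u. c \<noteq> 0 \<and> u \<in> insert 0 p \<and> snd (z t q) p = c *s fst (z t q) + u"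
        if p: "p \<in> Hessian_singular" for p
      proof (cases "p = new_node")
        case True
        have "v t = (1 / q) *s x t q + (- (1 + q * \<kappa>) / q) *s node_vec"
          using q0 by (simp add: x_def vec_eq_iff field_simps)
        moreover have "(- (1 + q * \<kappa>) / q) *s node_vec \<in> insert 0 p"
          unfolding True new_node_eq insert_0_pt[OF node_vec_nonzero] by blast
        ultimately show ?thesis using q0 p True
          by (intro exI[of _ "1 / q"] exI[of _ "(- (1 + q * \<kappa>) / q) *s node_vec"]) (simp add: z_def)
      next
        case False
        then show ?thesis using p by (intro exI[of _ 1] exI[of _ 0]) (simp add: z_def)
      qed
      ultimately have "z t q \<in> H.graph_cone Hessian"
        using xH xns by (auto simp: H.graph_cone_def z_def)
      then show False using none fz near diff by (auto simp: z_def)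
    qed
    then show ?thesis using r by blast
  qed
  \<comment> \<open>For infinitely many directions \<open>h\<close> vanishes at both roots, hence
    also at the root 0 over the direction \<open>u\<close>. That point is \<open>exc_rep u\<close>,
    where \<open>g\<close> is nonzero.\<close>
  then have "poly (poly h 0) 0 = 0"
    by (rule vanishes_on_double_cover[OF inf _ A0 C0])
  moreover have "v 0 = u" "x 0 0 = node_vec" by (simp_all add: x_def v_def)
  then have "z 0 0 = exc_rep u" by (simp only: z_def exc_rep_def)
  ultimately show False using h[of 0 0] f(2) by (simp add: g_def exc_rep_def near_poly_node)
qed

section \<open>The exceptional curve and the involutions on it\<close>

abbreviation exc_pt :: "'k::field ^ 5 \<Rightarrow> 'k xpoint" where
  "exc_pt u \<equiv> X_class (exc_rep u)"

lemma X_surface_eq: "X_surface = blowup Hessian Hessian_singular" by (simp add: X_surface_def)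

lemma polyfuns_off_node_fst:
  "(\<lambda>z. off_node (fst z) $ i) \<in> cone_polyfuns (Hessian_singular :: ('k::field_char_0 ^ 5) set set)"
  by (cases "i = 4") (auto simp: off_node_nth intro!: polyfuns_intros polyfuns_divide polyfuns_fst)

lemma polyfuns_off_node_snd:
  "(\<lambda>z. off_node (snd z new_node) $ i) \<in> cone_polyfuns (Hessian_singular :: ('k::field_char_0 ^ 5) set set)"
  by (cases "i = 4")
    (auto simp: off_node_nth intro!: polyfuns_intros polyfuns_divide polyfuns_snd new_node_singular)

lemma off_node_conic: "node_conic u \<Longrightarrow> off_node u = u"
  by (simp add: node_conic_def off_node_def)

lemma snd_exc_rep: "snd (exc_rep u) new_node = (u :: 'k::field_char_0 ^ 5)"
  by (simp add: exc_rep_def new_node_singular)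

lemma exc_rep_cone:
  fixes u :: "'k::field_char_0 ^ 5"
  assumes u: "node_conic u"
  shows "exc_rep u \<in> X_cone"
proof -
  have "u \<notin> insert 0 new_node"
    unfolding off_node_eq_0_iff[symmetric] off_node_conic[OF u] using u by (simp add: node_conic_def)
  moreover have "node_vec \<notin> insert 0 p" if p: "p \<in> Hessian_singular" "p \<noteq> new_node" for p :: "('k ^ 5) set"
  proof
    assume n: "node_vec \<in> insert 0 p"
    obtain v where v: "v \<noteq> 0" "p = pt v" using Hessian_singular_point[OF p(1)] by (elim exE conjE) (rule that)
    with n node_vec_nonzero[where 'k = 'k] obtain c where "c \<noteq> 0" "node_vec = c *s v"
      by (auto simp: pt_eq)
    then show False using p(2) v(2) pt_scale[of c v] by (simp add: new_node_eq)
  qed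
  ultimately show ?thesis
    using node_vec_nonzero by (auto simp: exc_rep_def blowup_cone_def)
qed

lemma blow_down_exc_pt: "node_conic u \<Longrightarrow> blow_down (exc_pt u) = (new_node :: ('k::field_char_0 ^ 5) set)"
  using H.blow_down_class[OF exc_rep_cone] by (simp add: exc_rep_def new_node_eq)

lemma exc_pt_in_X:
  fixes u :: "'k::{alg_closed_field, field_char_0} ^ 5"
  assumes "node_conic u" shows "exc_pt u \<in> points X_surface"
  unfolding X_surface_eq
  using exc_rep_cone[OF assms]
proof (rule H.blowup_pointI)
  show "\<exists>z'\<in>H.graph_cone Hessian. f z' \<noteq> 0"
    if "f \<in> X_polyfuns" "f (exc_rep u) \<noteq> 0" for f
    using generic_point_near[OF assms that] by (elim bexE conjE) (rule bexI)
qed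

lemma node_conic_scale: "c \<noteq> 0 \<Longrightarrow> node_conic (c *s u) \<longleftrightarrow> node_conic u" for u :: "'k::field_char_0 ^ 5"
  unfolding node_conic_def sum_scale e_scale by simp

lemma exc_pt_scale:
  fixes u :: "'k::field_char_0 ^ 5"
  assumes c: "c \<noteq> 0" and u: "node_conic u"
  shows "exc_pt (c *s u) = exc_pt u"
proof -
  have "(exc_rep u, exc_rep (c *s u)) \<in> blowup_rel Hessian_singular"
  proof (rule H.blowup_relI[where c = 1])
    show "exc_rep (c *s u) \<in> X_cone"
      by (rule exc_rep_cone) (simp add: node_conic_scale c u)
    fix p :: "('k ^ 5) set" assume p: "p \<in> Hessian_singular"
    show "\<exists>d w. d \<noteq> 0 \<and> w \<in> insert 0 p \<and> snd (exc_rep (c *s u)) p = d *s snd (exc_rep u) p + w"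
    proof (cases "p = new_node")
      case True
      then show ?thesis using c p by (intro exI[of _ c] exI[of _ 0]) (simp add: snd_exc_rep)
    next
      case False
      then show ?thesis using p by (intro exI[of _ 1] exI[of _ 0]) (simp add: exc_rep_def)
    qed
  qed (use exc_rep_cone[OF u] in \<open>auto simp: exc_rep_def\<close>)
  then show ?thesis using H.blowup_class_eq_iff H.blowup_relD(1,2) by blast
qed

lemma X_point_on_Hessian:
  fixes z :: "('k::field_char_0, 5) blowup_cone"
  assumes z: "z \<in> X_cone" "X_class z \<in> points X_surface"
  shows "sum (($) (fst z)) UNIV = 0" "quartic (fst z) = 0"
proof -
  have H: "sum (($) (fst z')) UNIV = 0 \<and> quartic (fst z') = 0" if "z' \<in> H.graph_cone Hessian"
    for z' :: "('k, 5) blowup_cone"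
  proof -
    have "fst z' \<noteq> 0" "pt (fst z') \<in> Hessian"
      using that by (auto simp: H.graph_cone_def blowup_cone_def)
    then show ?thesis using pt_in_Hessian_iff by blast
  qed
  show "sum (($) (fst z)) UNIV = 0"
    by (rule H.blowup_point_vanishing[OF z[unfolded X_surface_eq]])
      (use H in \<open>auto intro!: polyfuns_intros polyfuns_fst\<close>)
  show "quartic (fst z) = 0"
    by (rule H.blowup_point_vanishing[OF z[unfolded X_surface_eq], where f = "\<lambda>z. quartic (fst z)"])
      (use H in \<open>auto simp: quartic_eq intro!: polyfuns_intros polyfuns_divide polyfuns_fst\<close>)
qed

text \<open>Away from the node, position and direction agree modulo the node up to a scalar. This is
  how directions are read off from homogeneous coordinates.\<close>

lemma X_point_off_node:
  fixes z :: "('k::field_char_0, 5) blowup_cone"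
  assumes z: "z \<in> X_cone" "X_class z \<in> points X_surface"
    and x: "off_node (fst z) \<noteq> 0"
  shows "\<exists>c. c \<noteq> 0 \<and> off_node (snd z new_node) = c *s off_node (fst z)"
proof -
  have "fst z \<notin> insert 0 new_node" using x off_node_eq_0_iff by blast
  from H.blowup_point_direction[OF z[unfolded X_surface_eq] new_node_singular this]
  obtain c w where cw: "c \<noteq> 0" "w \<in> insert 0 new_node" "snd z new_node = c *s fst z + w"
    by (elim exE conjE) (rule that)
  then have "off_node w = 0" using off_node_eq_0_iff by blast
  with cw show ?thesis by (auto simp: off_node_add off_node_scale)
qed

lemma exc_pt_cases:
  fixes \<xi> :: "'k::{alg_closed_field, field_char_0} xpoint"
  assumes \<xi>: "\<xi> \<in> points X_surface" "blow_down \<xi> = new_node"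
  shows "\<exists>u. node_conic u \<and> \<xi> = exc_pt u"
proof -
  obtain z where z: "z \<in> X_cone" "\<xi> = X_class z"
    using H.blowup_pointE[OF \<xi>(1)[unfolded X_surface_eq]] .
  then have zX: "X_class z \<in> points X_surface" using \<xi> by simp
  note zX' = zX[unfolded X_surface_eq]
  have "pt (fst z) = pt node_vec"
    using \<xi>(2) H.blow_down_class[OF z(1)] z(2) by (simp add: new_node_eq)
  then obtain a where a: "a \<noteq> 0" "fst z = a *s node_vec" using pt_eq_iff[OF node_vec_nonzero] by blast
  define u where "u = off_node (snd z new_node)"
  have "u $ 4 = 0" by (simp add: u_def off_node_nth)
  moreover have "sum (($) u) UNIV = 0"
  proof -
    have "sum (($) (snd z new_node)) UNIV = 0"
    proof (rule H.blowup_point_vanishing[OF z(1) zX'])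
      fix z' :: "('k, 5) blowup_cone" assume z': "z' \<in> H.graph_cone Hessian"
      then have "fst z' \<noteq> 0" "pt (fst z') \<in> Hessian" by (auto simp: H.graph_cone_def blowup_cone_def)
      then have s: "sum (($) (fst z')) UNIV = 0" using pt_in_Hessian_iff by blast
      obtain c w where "w \<in> insert 0 new_node" "snd z' new_node = c *s fst z' + w"
        using z' new_node_singular unfolding H.graph_cone_def by blast
      moreover from this obtain d where "w = d *s node_vec"
        unfolding new_node_eq insert_0_pt[OF node_vec_nonzero] by blast
      ultimately show "sum (($) (snd z' new_node)) UNIV = 0"
        by (simp only: sum_add sum_scale sum_node_vec s) simp
    qed (intro polyfuns_intros polyfuns_snd new_node_singular)
    then show ?thesis by (simp only: u_def off_node_def sum_add sum_scale sum_node_vec) simp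
  qed
  moreover have "e2 u = 0"
  proof -
    \<comment> \<open>The equation of \<open>quartic_near_node\<close> with two off-node factors of
      each term replaced by the direction. On the graph this multiplies it by c^2, so it still
      vanishes; over the node the positions drop out and only \<open>2 * a\<^sup>2 * e2 u\<close>
      remains.\<close>
    define f where "f z = 2 * (- fst z $ 4 / 4)\<^sup>2 * e2 (off_node (snd z new_node)) +
      3 * (- fst z $ 4 / 4) * (let x = off_node (fst z); w = off_node (snd z new_node) in
        x$0 * w$1 * w$2 + x$0 * w$1 * w$3 + x$0 * w$2 * w$3 + x$1 * w$2 * w$3) +
      4 * (let x = off_node (fst z); w = off_node (snd z new_node) in x$0 * x$1 * w$2 * w$3)"
      for z :: "('k, 5) blowup_cone"
    have "f z = 0"
    proof (rule H.blowup_point_vanishing[OF z(1) zX'])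
      show "f \<in> X_polyfuns"
        unfolding f_def[abs_def] e2_def Let_def
        by (intro polyfuns_intros polyfuns_divide polyfuns_fst polyfuns_off_node_fst polyfuns_off_node_snd)
      fix z' :: "('k, 5) blowup_cone" assume z': "z' \<in> H.graph_cone Hessian"
      then have "fst z' \<noteq> 0" "pt (fst z') \<in> Hessian" by (auto simp: H.graph_cone_def blowup_cone_def)
      then have s: "sum (($) (fst z')) UNIV = 0" and q: "quartic (fst z') = 0"
        using pt_in_Hessian_iff by blast+
      obtain c w where "w \<in> insert 0 new_node" "snd z' new_node = c *s fst z' + w"
        using z' new_node_singular unfolding H.graph_cone_def by blast
      moreover from this have "off_node w = 0" using off_node_eq_0_iff by blast
      ultimately have w: "off_node (snd z' new_node) = c *s off_node (fst z')"
        by (simp add: off_node_add off_node_scale)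
      have "f z' = c\<^sup>2 * (4 * quartic (fst z'))"
        unfolding quartic_near_node[OF s] f_def w Let_def e2_def e3_def e4_def
        by (simp add: algebra_simps power2_eq_square)
      then show "f z' = 0" using q by simp
    qed
    moreover have "off_node (fst z) = 0" "- fst z $ 4 / 4 = a"
      by (simp_all add: a off_node_scale off_node_node) (simp add: node_vec_def)
    ultimately show ?thesis using a(1) unfolding f_def u_def Let_def by auto
  qed
  moreover have "u \<noteq> 0"
  proof -
    have "snd z \<in> (\<Pi>\<^sub>E p\<in>Hessian_singular. - insert 0 p)"
      using z(1) by (cases z) (simp add: blowup_cone_def)
    then have "snd z new_node \<in> - insert 0 new_node" using new_node_singular by (rule PiE_mem)
    then show ?thesis unfolding u_def off_node_eq_0_iff by simp
  qed
  ultimately have u: "node_conic u" by (simp add: node_conic_def)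
  have "X_class z = exc_pt u"
  proof (rule H.blowup_point_eqI[OF z(1) zX' exc_rep_cone[OF u] exc_pt_in_X[OF u, unfolded X_surface_eq]])
    show "pt (fst (exc_rep u)) = pt (fst z)" using a by (simp add: exc_rep_def pt_scale)
    fix p :: "('k ^ 5) set" assume p: "p \<in> Hessian_singular" "fst z \<in> insert 0 p"
    have nz: "fst z \<noteq> 0" using a node_vec_nonzero by simp
    have "p = new_node"
    proof (rule ccontr)
      assume pn: "p \<noteq> new_node"
      obtain v where v: "v \<noteq> 0" "p = pt v" using Hessian_singular_point[OF p(1)] by (elim exE conjE) (rule that)
      then obtain c where "c \<noteq> 0" "fst z = c *s v" using p(2) nz by (auto simp: pt_eq)
      then have "pt v = pt (fst z)" using pt_scale by metis
      then show False using pn v a by (simp add: pt_scale new_node_eq)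
    qed
    moreover have "u = 1 *s snd z new_node + (snd z new_node $ 4 / 4) *s node_vec"
      by (simp add: u_def off_node_def)
    moreover have "(snd z new_node $ 4 / 4) *s node_vec \<in> insert 0 new_node"
      unfolding new_node_eq insert_0_pt[OF node_vec_nonzero] by blast
    ultimately show "\<exists>c w. c \<noteq> 0 \<and> w \<in> insert 0 p \<and> snd (exc_rep u) p = c *s snd z p + w"
      using snd_exc_rep[of u] one_neq_zero by metis
  qed
  then show ?thesis using u z(2) by auto
qed

text \<open>The generic points found near the curve need not lie in \<open>U\<close>. Their
  conditions are open, however, so density of \<open>U\<close> provides a point of \<open>U\<close>
  that satisfies all of them.\<close>

lemma generic_X_point_near:
  fixes u :: "'k::{alg_closed_field, field_char_0} ^ 5"
  assumes u: "node_conic u" and W: "openin X_cone_top W" "exc_rep u \<in> W"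
    and U: "ztop X_surface closure_of U = points X_surface"
  shows "\<exists>z\<in>W. z \<in> X_cone \<and> X_class z \<in> U \<and>
    near_poly (fst z) \<noteq> 0 \<and> diff_poly (fst z) \<noteq> 0"
proof -
  obtain f where f: "f \<in> X_polyfuns" "f (exc_rep u) \<noteq> 0"
    "{y \<in> X_cone. f y \<noteq> 0} \<subseteq> W" using W by (rule openin_affineE)
  obtain z where z: "z \<in> H.graph_cone Hessian" "f z \<noteq> 0" "near_poly (fst z) \<noteq> 0" "diff_poly (fst z) \<noteq> 0"
    using generic_point_near[OF u f(1,2)] by (elim bexE conjE) (rule that)
  let ?g = "\<lambda>z. f z * (near_poly (fst z) * diff_poly (fst z))"
  let ?W = "{y \<in> X_cone. ?g y \<noteq> 0}"
  have "?g \<in> X_polyfuns" by (intro polyfuns_intros f near_poly_polyfun)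
  then have o: "openin X_cone_top ?W" by (rule openin_affine_nonzero)
  have "z \<in> ?W" using z by (simp add: H.graph_cone_def)
  with H.dense_open_near[OF U[unfolded X_surface_eq] o] H.graph_cone_point[OF z(1)]
  obtain z' where z': "z' \<in> ?W" "X_class z' \<in> U" by blast
  then have "z' \<in> W" using f(3) by auto
  then show ?thesis using z' by (intro bexI[of _ z']) auto
qed

lemma generic_X_point:
  fixes z :: "('k::field_char_0, 5) blowup_cone"
  assumes z: "z \<in> X_cone" "X_class z \<in> points X_surface"
    and gen: "near_poly (fst z) \<noteq> 0" "diff_poly (fst z) \<noteq> 0"
  shows "pt (fst z) \<notin> Hessian_singular"
    "\<exists>c. c \<noteq> 0 \<and> off_node (snd z new_node) = c *s off_node (fst z)"
proof -
  show "pt (fst z) \<notin> Hessian_singular"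
  proof
    assume "pt (fst z) \<in> Hessian_singular"
    from singular_squares_eq[OF near_polyD(1)[OF gen(1)] this]
    show False using near_polyD(2)[OF gen(1)] diff_polyD[OF gen(2), of 0 1] by simp
  qed
  have "off_node (fst z) $ 0 \<noteq> off_node (fst z) $ 1"
    using diff_polyD[OF gen(2), of 0 1] by (simp add: off_node_nth)
  then have "off_node (fst z) \<noteq> 0" by auto
  then show "\<exists>c. c \<noteq> 0 \<and> off_node (snd z new_node) = c *s off_node (fst z)"
    by (rule X_point_off_node[OF z])
qed

lemma parallel_vectors:
  fixes v w :: "'k::field ^ 'n"
  assumes "\<And>i j. v $ i * w $ j = v $ j * w $ i" "w \<noteq> 0"
  shows "\<exists>c. v = c *s w"
proof -
  obtain j where j: "w $ j \<noteq> 0" using assms(2) by (auto simp: vec_eq_iff)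
  define k where "k = v $ j / w $ j"
  have "v $ i = k * w $ i" for i
    unfolding k_def times_divide_eq_left assms(1)[of i j, symmetric]
    by (rule nonzero_mult_div_cancel_right[OF j, symmetric])
  then have "v = k *s w" by (simp add: vec_eq_iff)
  then show ?thesis by blast
qed

text \<open>The shared form of the continuity argument: a polynomial vector \<open>L\<close>,
  proportional to the image direction at points accumulating at \<open>exc_pt u\<close>, gives the
  image of that point provided \<open>L\<close> does not vanish there. That \<open>L\<close> lands
  on the conic is a consequence, since the image lies over the node.\<close>

lemma exc_pt_image:
  fixes \<tau> :: "'k::{alg_closed_field, field_char_0} xpoint \<Rightarrow> 'k xpoint"
  assumes \<tau>: "morphism X_surface X_surface \<tau>" and u: "node_conic u"
    and down: "blow_down (\<tau> (exc_pt u)) = new_node"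
    and L: "\<And>i. (\<lambda>z. L z $ i) \<in> X_polyfuns" "L (exc_rep u) \<noteq> 0"
    and D: "\<And>W. openin X_cone_top W \<Longrightarrow> exc_rep u \<in> W \<Longrightarrow> \<exists>z\<in>W.
      X_class z \<in> points X_surface \<and>
      (\<forall>\<zeta>\<in>X_cone. \<tau> (X_class z) = X_class \<zeta> \<longrightarrow>
        (\<exists>c. off_node (snd \<zeta> new_node) = c *s L z))"
  shows "node_conic (L (exc_rep u)) \<and> \<tau> (exc_pt u) = exc_pt (L (exc_rep u))"
proof -
  note uX = exc_pt_in_X[OF u]
  have "\<tau> (exc_pt u) \<in> points X_surface" using morphism_points[OF \<tau> uX] .
  from exc_pt_cases[OF this down] obtain v where v: "node_conic v" "\<tau> (exc_pt u) = exc_pt v" by blast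
  have "off_node (snd (exc_rep v) new_node) $ i * L (exc_rep u) $ j =
      off_node (snd (exc_rep v) new_node) $ j * L (exc_rep u) $ i" for i j
  proof (rule H.relation_extends[OF \<tau>[unfolded X_surface_eq] exc_rep_cone[OF u] uX[unfolded X_surface_eq]
      exc_rep_cone[OF v(1)] v(2), where A = "\<lambda>z. off_node (snd z new_node)" and L = L])
    show "\<exists>c. c \<noteq> 0 \<and> off_node (snd z' new_node) = c *s off_node (snd z new_node)"
      if "(z, z') \<in> blowup_rel Hessian_singular" for z z' :: "('k, 5) blowup_cone"
    proof -
      obtain c w where "c \<noteq> 0" "w \<in> insert 0 new_node" "snd z' new_node = c *s snd z new_node + w"
        using H.blowup_relD(4)[OF \<open>(z, z') \<in> _\<close> new_node_singular] by (elim exE conjE) (rule that)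
      then show ?thesis using off_node_eq_0_iff[of w] by (auto simp: off_node_add off_node_scale)
    qed
    show "\<exists>z\<in>W. X_class z \<in> points (blowup Hessian Hessian_singular) \<and>
      (\<forall>\<zeta>\<in>X_cone. \<tau> (X_class z) = X_class \<zeta> \<longrightarrow>
        (\<forall>i j. off_node (snd \<zeta> new_node) $ i * L z $ j = off_node (snd \<zeta> new_node) $ j * L z $ i))"
      if W: "openin X_cone_top W" "exc_rep u \<in> W" for W
    proof -
      obtain z where z: "z \<in> W" "X_class z \<in> points X_surface"
        "\<forall>\<zeta>\<in>X_cone. \<tau> (X_class z) = X_class \<zeta> \<longrightarrow>
          (\<exists>c. off_node (snd \<zeta> new_node) = c *s L z)"
        using D[OF W] by (elim bexE conjE) (rule that)
      show ?thesis
      proof (intro bexI[OF _ z(1)] conjI ballI impI allI)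
        show "X_class z \<in> points (blowup Hessian Hessian_singular)"
          using z(2) by (simp add: X_surface_eq)
        fix \<zeta> i j
        assume "\<zeta> \<in> X_cone" "\<tau> (X_class z) = X_class \<zeta>"
        then obtain c where "off_node (snd \<zeta> new_node) = c *s L z" using z(3) by blast
        then show "off_node (snd \<zeta> new_node) $ i * L z $ j = off_node (snd \<zeta> new_node) $ j * L z $ i" by simp
      qed
    qed
  qed (fact L polyfuns_off_node_snd)+
  then have "\<exists>c. v = c *s L (exc_rep u)"
    using L(2) unfolding snd_exc_rep off_node_conic[OF v(1)] by (rule parallel_vectors)
  then obtain c where c: "v = c *s L (exc_rep u)" by blast
  then have "c \<noteq> 0" using v(1) by (auto simp: node_conic_def)
  then show ?thesis using v c node_conic_scale[of c "L (exc_rep u)"] exc_pt_scale[of c "L (exc_rep u)"] by simp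
qed

section \<open>The Cremona involution on the exceptional curve\<close>

lemma cremona_fixes_exc_pt:
  fixes \<sigma> :: "'k::{alg_closed_field, field_char_0} xpoint \<Rightarrow> 'k xpoint"
  assumes \<sigma>: "induced_by_cremona \<sigma>" and u: "node_conic u"
  shows "\<sigma> (exc_pt u) = exc_pt u"
proof -
  have mor: "morphism X_surface X_surface \<sigma>"
    using \<sigma> by (simp add: induced_by_cremona_def isomorphism_def)
  have crem: "blow_down (\<sigma> \<xi>) = pt (\<chi> a. 1 / (lam a * y $ a))"
    if "\<xi> \<in> points X_surface" "blow_down \<xi> = pt y" "\<And>a. y $ a \<noteq> 0" for \<xi> y
    using \<sigma> that unfolding induced_by_cremona_def by simp
  \<comment> \<open>The i-th off-node coordinate of the Cremona image is 1/x_i + 4/x_4, which is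
    4/x_4 times the i-th off-node coordinate of x divided by x_i. Multiplying by the first four
    coordinates of x clears the denominators and leaves the product over the other three, which is 1
    at the node.\<close>
  define L :: "('k, 5) blowup_cone \<Rightarrow> 'k ^ 5" where
    "L z = (\<chi> i. off_node (snd z new_node) $ i * (\<Prod>d\<in>UNIV - {i, 4}. fst z $ d))" for z
  have "(\<chi> a. 1 / (lam a * node_vec $ a)) = (node_vec :: 'k ^ 5)"
    by (simp add: vec_eq_iff lam_def node_vec_def)
  then have "blow_down (\<sigma> (exc_pt u)) = new_node"
    using crem[OF exc_pt_in_X[OF u], of node_vec] blow_down_exc_pt[OF u]
    by (simp add: new_node_eq) (simp add: node_vec_def)
  moreover have Lu: "L (exc_rep u) = u"
    unfolding L_def snd_exc_rep off_node_conic[OF u]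
    by (simp add: vec_eq_iff exc_rep_def node_vec_def)
  moreover have "\<exists>z\<in>W. X_class z \<in> points X_surface \<and>
      (\<forall>\<zeta>\<in>X_cone. \<sigma> (X_class z) = X_class \<zeta> \<longrightarrow>
        (\<exists>c. off_node (snd \<zeta> new_node) = c *s L z))"
    if W: "openin X_cone_top W" "exc_rep u \<in> W" for W
  proof -
    obtain z where z: "z \<in> W" "z \<in> X_cone"
      "X_class z \<in> points X_surface" "near_poly (fst z) \<noteq> 0" "diff_poly (fst z) \<noteq> 0"
      using generic_X_point_near[OF u W closure_of_topspace] by (elim bexE conjE) (rule that)
    define x where "x = fst z"
    define y :: "'k ^ 5" where "y = (\<chi> a. 1 / (lam a * x $ a))"
    have xnz: "x $ a \<noteq> 0" for a unfolding x_def by (rule near_polyD(1)[OF z(4)])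
    obtain c where c: "c \<noteq> 0" "off_node (snd z new_node) = c *s off_node x"
      using generic_X_point(2)[OF z(2-5)] unfolding x_def by blast
    have "off_node (snd \<zeta> new_node) = c' *s L z"
      if "off_node (snd \<zeta> new_node) = k *s off_node y" "c' = - (4 * k) / (c * (- x $ 4) * (\<Prod>d\<in>UNIV - {4}. x $ d))"
      for \<zeta> :: "('k, 5) blowup_cone" and k c'
    proof -
      have "off_node (snd \<zeta> new_node) $ i = c' * L z $ i" for i
      proof (cases "i = 4")
        case False
        have "(\<Prod>d\<in>UNIV - {4}. x $ d) = x $ i * (\<Prod>d\<in>UNIV - {i, 4}. x $ d)"
        proof -
          have "UNIV - {i, 4} = UNIV - {4} - {i}" by blast
          then show ?thesis using False by (simp only:) (rule prod.remove, auto)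
        qed
        moreover have "(\<Prod>d\<in>UNIV - {i, 4}. x $ d) \<noteq> 0" using xnz by auto
        moreover have "off_node y $ i = 1 / x $ i + 4 / x $ 4" using False by (simp add: off_node_nth y_def lam_def)
        moreover define P where "P = (\<Prod>d\<in>UNIV - {i, 4}. x $ d)"
        moreover have "k * (1 / x $ i + 4 / x $ 4) =
            - (4 * k) / (c * (- x $ 4) * (x $ i * P)) * (c * (x $ i + x $ 4 / 4) * P)"
          if "P \<noteq> 0" using that c(1) xnz[of i] xnz[of 4] by (simp add: field_simps)
        ultimately show ?thesis
          unfolding that L_def x_def[symmetric] c(2) using False
          by (simp only: vec_lambda_beta vector_smult_component off_node_nth if_False simp_thms)
      qed (simp add: off_node_nth L_def)
      then show ?thesis by (simp add: vec_eq_iff)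
    qed
    moreover have "\<exists>k. off_node (snd \<zeta> new_node) = k *s off_node y"
      if \<zeta>: "\<zeta> \<in> X_cone" "\<sigma> (X_class z) = X_class \<zeta>" for \<zeta>
    proof -
      have "blow_down (X_class \<zeta>) = pt y"
        using crem[OF z(3), of x] H.blow_down_class[OF z(2)] xnz \<zeta>(2) by (simp add: x_def y_def)
      then have "pt (fst \<zeta>) = pt y" using H.blow_down_class[OF \<zeta>(1)] by simp
      moreover have "y $ 0 \<noteq> 0" using xnz[of 0] by (simp add: y_def lam_def)
      then have "y \<noteq> 0" by auto
      ultimately obtain k where k: "k \<noteq> 0" "fst \<zeta> = k *s y" using pt_eq_iff by blast
      have "x $ 0 \<noteq> x $ 1" unfolding x_def by (rule diff_polyD[OF z(5)]) simp
      then have "off_node y $ 0 \<noteq> off_node y $ 1"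
        using xnz[of 0] xnz[of 1] by (simp add: off_node_nth y_def lam_def)
      then have "off_node (fst \<zeta>) \<noteq> 0" using k by (auto simp: off_node_scale)
      moreover have "X_class \<zeta> \<in> points X_surface"
        using morphism_points[OF mor z(3)] \<zeta>(2) by simp
      ultimately obtain d where "off_node (snd \<zeta> new_node) = d *s off_node (fst \<zeta>)"
        using X_point_off_node[OF \<zeta>(1)] by blast
      then show ?thesis using k by (auto simp: off_node_scale vector_smult_assoc)
    qed
    ultimately show ?thesis using z(1,3) by blast
  qed
  moreover have "(\<lambda>z. L z $ i) \<in> X_polyfuns" for i
    unfolding L_def vec_lambda_beta by (intro polyfuns_intros polyfuns_fst polyfuns_off_node_snd)
  moreover have "L (exc_rep u) \<noteq> 0" using u Lu by (simp add: node_conic_def)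
  ultimately show ?thesis using exc_pt_image[OF mor u, of L] by metis
qed

text \<open>
  The other intersection point of the Hessian with the line from \<open>x\<close> in direction \<open>v\<close> is
  \<open>N(x) x + T(x) v\<close>; in the directions \<open>w\<close> at the node this becomes \<open>N w + T\<^sub>w v\<close>, with \<open>T\<^sub>w\<close> linear
  in \<open>w\<close> and equal to \<open>T(x)\<close> for \<open>w = x\<close>.
\<close>

lemma covering_involution_on_exc:
  fixes \<gamma> :: "'k::{alg_closed_field, field_char_0} xpoint \<Rightarrow> 'k xpoint" and N T :: "'k ^ 5 \<Rightarrow> 'k"
  assumes \<gamma>: "covering_involution (pt v) \<gamma>" and v: "v \<noteq> 0" "sum (($) v) UNIV = 0" and u: "node_conic u"
    and N: "(\<lambda>z. N (fst z)) \<in> X_polyfuns"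
    and T: "(\<lambda>z. T (fst z)) \<in> X_polyfuns"
    and Tw: "Tw \<in> X_polyfuns"
    and key: "\<And>x k t. sum (($) x) UNIV = 0 \<Longrightarrow> quartic x = 0 \<Longrightarrow> quartic (k *s x + t *s v) = 0 \<Longrightarrow>
      k \<noteq> 0 \<Longrightarrow> t \<noteq> 0 \<Longrightarrow> t * N x = k * T x"
    and Nnz: "\<And>x. near_poly x \<noteq> 0 \<Longrightarrow> N x \<noteq> 0" and Tnode: "T node_vec = 0"
    and lin: "\<And>z c. sum (($) (fst z)) UNIV = 0 \<Longrightarrow> off_node (snd z new_node) = c *s off_node (fst z) \<Longrightarrow>
      Tw z = c * T (fst z)"
    and cd: "distinct [c, d, 4]" "v $ c = v $ d"
    and nz: "N node_vec *s u + Tw (exc_rep u) *s off_node v \<noteq> 0"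
  shows "node_conic (N node_vec *s u + Tw (exc_rep u) *s off_node v) \<and>
    \<gamma> (exc_pt u) = exc_pt (N node_vec *s u + Tw (exc_rep u) *s off_node v)"
proof -
  have mor: "morphism X_surface X_surface \<gamma>"
    using \<gamma> by (simp add: covering_involution_def isomorphism_def)
  obtain U where U: "openin (ztop X_surface) U" "ztop X_surface closure_of U = points X_surface"
    "\<And>\<xi>. \<xi> \<in> U \<Longrightarrow> blow_down \<xi> \<noteq> pt v \<and> blow_down (\<gamma> \<xi>) \<noteq> pt v \<and> \<gamma> \<xi> \<noteq> \<xi> \<and>
       project_from (pt v) (blow_down (\<gamma> \<xi>)) = project_from (pt v) (blow_down \<xi>)"
    using \<gamma> unfolding covering_involution_def by (elim conjE exE) (rule that, assumption, assumption, rule bspec)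
  have second: "\<exists>k t. k \<noteq> 0 \<and> fst \<zeta> = k *s (N (fst z) *s fst z + T (fst z) *s v) \<and>
      fst \<zeta> = (k * N (fst z)) *s fst z + t *s v"
    if z: "z \<in> X_cone" "X_class z \<in> U"
      "near_poly (fst z) \<noteq> 0" "diff_poly (fst z) \<noteq> 0"
    and \<zeta>: "\<zeta> \<in> X_cone" "\<gamma> (X_class z) = X_class \<zeta>"
    for z \<zeta>
  proof -
    define x y where "x = fst z" and "y = fst \<zeta>"
    have zX: "X_class z \<in> points X_surface" using z(2) openin_subset[OF U(1)] by blast
    have \<zeta>X: "X_class \<zeta> \<in> points X_surface" using morphism_points[OF mor zX] \<zeta>(2) by simp
    have x: "sum (($) x) UNIV = 0" "quartic x = 0" using X_point_on_Hessian[OF z(1) zX] by (simp_all add: x_def)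
    have y: "quartic y = 0" using X_point_on_Hessian[OF \<zeta>(1) \<zeta>X] by (simp add: y_def)
    have xnz: "x \<noteq> 0" and ynz: "y \<noteq> 0" using z(1) \<zeta>(1) by (auto simp: x_def y_def blowup_cone_def)
    have proj: "pt y \<noteq> pt v" "project_from (pt v) (pt y) = project_from (pt v) (pt x)"
      "X_class \<zeta> \<noteq> X_class z"
      using U(3)[OF z(2)] H.blow_down_class[OF z(1)] H.blow_down_class[OF \<zeta>(1)] \<zeta>(2)
      by (simp_all add: x_def y_def)
    have "y + 0 \<in> project_from (pt v) (pt y)"
      unfolding project_from_def using self_in_pt[OF ynz] by blast
    then have "y \<in> project_from (pt v) (pt x)" using proj(2) by simp
    then obtain x' u where "x' \<in> pt x" "u \<in> insert 0 (pt v)" "y = x' + u" unfolding project_from_def by blast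
    then obtain k t where kt: "k \<noteq> 0" "y = k *s x + t *s v"
      unfolding pt_eq[OF xnz] insert_0_pt[OF v(1)] by blast
    \<comment> \<open>For \<open>t = 0\<close> both points would have the same image in the Hessian.
      That image is not a centre, so the points themselves would coincide, whereas
      \<open>\<gamma>\<close> moves every point of \<open>U\<close>.\<close>
    have t: "t \<noteq> 0"
    proof
      assume "t = 0"
      then have "pt y = pt x" using kt by (simp add: pt_scale)
      have "X_class z = X_class \<zeta>"
      proof (rule H.blowup_point_eqI[OF z(1) zX[unfolded X_surface_eq] \<zeta>(1) \<zeta>X[unfolded X_surface_eq]])
        show "pt (fst \<zeta>) = pt (fst z)" using \<open>pt y = pt x\<close> by (simp add: x_def y_def)
        fix p :: "('k ^ 5) set" assume "p \<in> Hessian_singular" "fst z \<in> insert 0 p"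
        then show "\<exists>c u. c \<noteq> 0 \<and> u \<in> insert 0 p \<and> snd \<zeta> p = c *s snd z p + u"
          using H.off_centre[OF xnz[unfolded x_def] generic_X_point(1)[OF z(1) zX z(3,4)], of p] by simp
      qed
      then show False using proj(3) by simp
    qed
    have tN: "t * N x = k * T x" using key[OF x _ kt(1) t] y kt(2) by simp
    have Nx: "N x \<noteq> 0" using Nnz z(3) by (simp add: x_def)
    have "t = k / N x * T x" using tN Nx by (simp add: field_simps)
    then have "y = (k / N x) *s (N x *s x + T x *s v)"
      using kt(2) Nx by (simp add: vector_add_ldistrib vector_smult_assoc)
    moreover have "y = (k / N x * N x) *s x + t *s v" using kt(2) Nx by simp
    moreover have "k / N x \<noteq> 0" using kt(1) Nx by simp
    ultimately show ?thesis unfolding x_def y_def by blast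
  qed
  have near: "\<exists>z\<in>W. z \<in> X_cone \<and> X_class z \<in> U \<and>
      near_poly (fst z) \<noteq> 0 \<and> diff_poly (fst z) \<noteq> 0"
    if "openin X_cone_top W" "exc_rep u \<in> W" for W
    using generic_X_point_near[OF u that U(2)] .
  have UX: "\<xi> \<in> points X_surface" if "\<xi> \<in> U" for \<xi> using openin_subset[OF U(1)] that by blast
  note uX = exc_pt_in_X[OF u]
  \<comment> \<open>Continuity is applied to positions before directions. At the node
    \<open>T\<close> vanishes, so \<open>N x + T v\<close> is a nonzero multiple of the node and the
    image lies on the exceptional curve again.\<close>
  have down: "blow_down (\<gamma> (exc_pt u)) = new_node"
  proof -
    obtain \<zeta> where \<zeta>: "\<zeta> \<in> X_cone" "\<gamma> (exc_pt u) = X_class \<zeta>"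
      using H.blowup_pointE[OF morphism_points[OF mor uX, unfolded X_surface_eq]] .
    define L where "L z = N (fst z) *s fst z + T (fst z) *s v" for z :: "('k, 5) blowup_cone"
    have rel: "fst \<zeta> $ i * L (exc_rep u) $ j = fst \<zeta> $ j * L (exc_rep u) $ i" for i j
    proof (rule H.relation_extends[OF mor[unfolded X_surface_eq] exc_rep_cone[OF u] uX[unfolded X_surface_eq] \<zeta>,
        where A = fst and L = L])
      show "(\<lambda>z. L z $ i) \<in> X_polyfuns" for i
        unfolding L_def vector_add_component vector_smult_component
        by (intro polyfuns_intros N T polyfuns_fst)
      show "\<exists>c. c \<noteq> 0 \<and> fst z' = c *s fst z" if "(z, z') \<in> blowup_rel Hessian_singular"
        for z z' :: "('k, 5) blowup_cone" by (rule H.blowup_relD(3)[OF that])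
      fix W assume W: "openin X_cone_top W" "exc_rep u \<in> W"
      obtain z where z: "z \<in> W" "z \<in> X_cone" "X_class z \<in> U"
        "near_poly (fst z) \<noteq> 0" "diff_poly (fst z) \<noteq> 0"
        using near[OF W] by (elim bexE conjE) (rule that)
      show "\<exists>z\<in>W. X_class z \<in> points (blowup Hessian Hessian_singular) \<and>
        (\<forall>\<zeta>\<in>X_cone. \<gamma> (X_class z) = X_class \<zeta> \<longrightarrow>
          (\<forall>i j. fst \<zeta> $ i * L z $ j = fst \<zeta> $ j * L z $ i))"
      proof (intro bexI[OF _ z(1)] conjI ballI impI allI)
        show "X_class z \<in> points (blowup Hessian Hessian_singular)"
          using UX[OF z(3)] by (simp add: X_surface_eq)
        fix \<zeta> i j
        assume "\<zeta> \<in> X_cone" "\<gamma> (X_class z) = X_class \<zeta>"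
        from second[OF z(2-5) this] obtain k where "fst \<zeta> = k *s L z" unfolding L_def by blast
        then show "fst \<zeta> $ i * L z $ j = fst \<zeta> $ j * L z $ i" by simp
      qed
    qed (rule polyfuns_fst)
    have "L (exc_rep u) = N node_vec *s node_vec" by (simp add: L_def exc_rep_def Tnode)
    moreover have "N node_vec \<noteq> 0" by (rule Nnz[OF near_poly_node])
    ultimately have "\<exists>c. fst \<zeta> = c *s (N node_vec *s node_vec)"
      using rel node_vec_nonzero by (intro parallel_vectors) auto
    then obtain c where "fst \<zeta> = (c * N node_vec) *s node_vec" by (auto simp: vector_smult_assoc)
    moreover from this have "c * N node_vec \<noteq> 0" using \<zeta>(1) by (auto simp: blowup_cone_def)
    ultimately have "pt (fst \<zeta>) = new_node" using pt_scale by (metis new_node_eq)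
    then show ?thesis using H.blow_down_class[OF \<zeta>(1)] \<zeta>(2) by simp
  qed
  define L where "L z = N (fst z) *s off_node (snd z new_node) + Tw z *s off_node v" for z
  have Lu: "L (exc_rep u) = N node_vec *s u + Tw (exc_rep u) *s off_node v"
    unfolding L_def snd_exc_rep off_node_conic[OF u] by (simp add: exc_rep_def)
  have "node_conic (L (exc_rep u)) \<and> \<gamma> (exc_pt u) = exc_pt (L (exc_rep u))"
  proof (rule exc_pt_image[OF mor u down])
    show "(\<lambda>z. L z $ i) \<in> X_polyfuns" for i
      unfolding L_def vector_add_component vector_smult_component
      by (intro polyfuns_intros N Tw polyfuns_off_node_snd)
    show "L (exc_rep u) \<noteq> 0" using nz Lu by simp
    fix W assume W: "openin X_cone_top W" "exc_rep u \<in> W"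
    obtain z where z: "z \<in> W" "z \<in> X_cone" "X_class z \<in> U"
      "near_poly (fst z) \<noteq> 0" "diff_poly (fst z) \<noteq> 0"
      using near[OF W] by (elim bexE conjE) (rule that)
    note zX = UX[OF z(3)]
    define x where "x = fst z"
    obtain a where a: "a \<noteq> 0" "off_node (snd z new_node) = a *s off_node x"
      using generic_X_point(2)[OF z(2) zX z(4,5)] unfolding x_def by blast
    have Tz: "Tw z = a * T x"
      using lin[OF X_point_on_Hessian(1)[OF z(2) zX]] a by (simp add: x_def)
    have Lz: "L z = a *s off_node (N x *s x + T x *s v)"
      by (simp add: L_def x_def[symmetric] a Tz off_node_add off_node_scale vector_add_ldistrib vector_smult_assoc mult.commute)
    show "\<exists>z\<in>W. X_class z \<in> points X_surface \<and>
      (\<forall>\<zeta>\<in>X_cone. \<gamma> (X_class z) = X_class \<zeta> \<longrightarrow>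
        (\<exists>c. off_node (snd \<zeta> new_node) = c *s L z))"
    proof (intro bexI[OF _ z(1)] conjI ballI impI)
      show "X_class z \<in> points X_surface" by fact
      fix \<zeta> assume \<zeta>: "\<zeta> \<in> X_cone" "\<gamma> (X_class z) = X_class \<zeta>"
      obtain k t where k: "k \<noteq> 0" "fst \<zeta> = k *s (N x *s x + T x *s v)" "fst \<zeta> = (k * N x) *s x + t *s v"
        using second[OF z(2-5) \<zeta>, folded x_def] by (elim exE conjE) (rule that)
      have \<zeta>X: "X_class \<zeta> \<in> points X_surface"
        using morphism_points[OF mor zX] \<zeta>(2) by simp
      \<comment> \<open>Motion along \<open>v\<close> does not affect the difference of two
        coordinates on which \<open>v\<close> agrees. So the image keeps a nonzero off-node part and
        its direction can be read off from its position.\<close>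
      have "off_node (fst \<zeta>) $ c - off_node (fst \<zeta>) $ d = (k * N x) * (x $ c - x $ d)"
        unfolding k(3) using cd by (simp add: off_node_nth algebra_simps)
      moreover have "x $ c \<noteq> x $ d" unfolding x_def by (rule diff_polyD[OF z(5) cd(1)])
      moreover have "N x \<noteq> 0" using Nnz z(4) by (simp add: x_def)
      ultimately have "off_node (fst \<zeta>) \<noteq> 0" using k(1) by auto
      from X_point_off_node[OF \<zeta>(1) \<zeta>X this] obtain b where
        "off_node (snd \<zeta> new_node) = b *s off_node (fst \<zeta>)" by blast
      then have "off_node (snd \<zeta> new_node) = (b * k / a) *s L z"
        unfolding k(2) Lz off_node_scale vector_smult_assoc using a(1) by simp
      then show "\<exists>c. off_node (snd \<zeta> new_node) = c *s L z" by blast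
    qed
  qed
  then show ?thesis unfolding Lu .
qed

section \<open>The projections from the ten nodes as reflections\<close>

definition edge_vec :: "5 \<Rightarrow> 5 \<Rightarrow> 'k::field ^ 5" where
  "edge_vec a b = (\<chi> c. if c = a then 1 else if c = b then - 1 else 0)"

text \<open>The orthogonal reflection that negates \<open>d\<close>, multiplied by the square length
  of \<open>d\<close> to avoid a division.\<close>

definition reflection :: "'k::field ^ 5 \<Rightarrow> 'k ^ 5 \<Rightarrow> 'k ^ 5" where
  "reflection d u = (\<Sum>i\<in>UNIV. (d $ i)\<^sup>2) *s u - (2 * (\<Sum>i\<in>UNIV. u $ i * d $ i)) *s d"

lemma reflection_scale: "reflection (c *s d) u = c\<^sup>2 *s reflection d u"
  by (simp add: reflection_def vec_eq_iff power_mult_distrib sum_distrib_left[symmetric] mult.left_commute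
    power2_eq_square algebra_simps)

lemma P_node_eq: "P_node a b = pt (edge_vec a b)" by (simp add: P_node_def edge_vec_def)

lemma exists_complement_5:
  fixes a b :: 5
  assumes "distinct [a, b, 4]"
  shows "\<exists>c d. distinct [a, b, c, d, 4]"
proof -
  have "\<exists>c. c \<notin> {a, b, 4}"
  proof (rule ccontr)
    assume "\<not> ?thesis"
    then have "UNIV = {a, b, 4}" by auto
    then have "card (UNIV :: 5 set) = card {a, b, 4}" by simp
    then show False using assms by simp
  qed
  then obtain c where c: "c \<notin> {a, b, 4}" by blast
  have "\<exists>d. d \<notin> {a, b, c, 4}"
  proof (rule ccontr)
    assume "\<not> ?thesis"
    then have "UNIV = {a, b, c, 4}" by auto
    then have "card (UNIV :: 5 set) = card {a, b, c, 4}" by simp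
    then show False using assms c by (auto simp: card_insert_if)
  qed
  then show ?thesis using assms c by auto
qed

text \<open>Along the direction \<open>e\<^sub>a - e\<^sub>b\<close> the sum of the two coordinates
  is constant, so the quartic varies only through their product. The second intersection point has
  these coordinates interchanged: the involution is a transposition, as it must be for equal
  parameters.\<close>

lemma covering_involution_transposition:
  fixes \<gamma> :: "'k::{alg_closed_field, field_char_0} xpoint \<Rightarrow> 'k xpoint"
  assumes ab: "distinct [a, b, 4]" and \<gamma>: "covering_involution (P_node a b) \<gamma>" and u: "node_conic u"
  shows "node_conic (reflection (off_node (edge_vec a b)) u) \<and> \<gamma> (exc_pt u) = exc_pt (reflection (off_node (edge_vec a b)) u)"
proof -
  obtain c d where dis: "distinct [a, b, c, d, 4]" using exists_complement_5[OF ab] by blast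
  define v :: "'k ^ 5" where "v = edge_vec a b"
  have v_nth: "v $ a = 1" "v $ b = - 1" "v $ c = 0" "v $ d = 0" "v $ 4 = 0"
    using dis by (auto simp: v_def edge_vec_def)
  define N :: "'k ^ 5 \<Rightarrow> 'k" where "N x = x $ c * x $ d + x $ 4 / 16 * (x $ c + x $ d)" for x
  define T :: "'k ^ 5 \<Rightarrow> 'k" where "T x = N x * (x $ b - x $ a)" for x
  define Tw where "Tw z = N (fst z) * (off_node (snd z new_node) $ b - off_node (snd z new_node) $ a)"
    for z :: "('k, 5) blowup_cone"
  have ov: "off_node v = v" by (simp add: off_node_def v_nth)
  have N_node: "N node_vec = 1 / 2" using dis by (simp add: N_def node_vec_def)
  have res: "N node_vec *s u + Tw (exc_rep u) *s off_node v = (1 / 4) *s reflection (off_node v) u"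
  proof -
    have "Tw (exc_rep u) = (u $ b - u $ a) / 2"
      unfolding Tw_def snd_exc_rep off_node_conic[OF u] by (simp add: exc_rep_def N_node)
    moreover have "(\<Sum>i\<in>UNIV. (v $ i)\<^sup>2) = 2" "(\<Sum>i\<in>UNIV. u $ i * v $ i) = u $ a - u $ b"
      by (simp_all add: sum_distinct_5[OF dis] v_nth)
    ultimately show ?thesis unfolding ov reflection_def N_node by (simp only:) (simp add: vec_eq_iff field_simps)
  qed
  have "node_conic (N node_vec *s u + Tw (exc_rep u) *s off_node v) \<and>
    \<gamma> (exc_pt u) = exc_pt (N node_vec *s u + Tw (exc_rep u) *s off_node v)"
  proof (rule covering_involution_on_exc[OF _ _ _ u, where T = T])
    show "covering_involution (pt v) \<gamma>" using \<gamma> by (simp add: P_node_eq v_def)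
    show "v \<noteq> 0" using v_nth(1) by auto
    show "sum (($) v) UNIV = 0" by (simp add: sum_distinct_5[OF dis] v_nth)
    have Np: "(\<lambda>z. N (fst z)) \<in> X_polyfuns"
      unfolding N_def by (intro polyfuns_intros polyfuns_divide polyfuns_fst)
    then show "(\<lambda>z. N (fst z)) \<in> X_polyfuns" .
    show "(\<lambda>z. T (fst z)) \<in> X_polyfuns"
      unfolding T_def by (intro polyfuns_intros Np polyfuns_fst)
    show "Tw \<in> X_polyfuns"
      unfolding Tw_def[abs_def] by (intro polyfuns_intros Np polyfuns_off_node_snd)
    show "t * N x = k * T x" if "quartic x = 0" "quartic (k *s x + t *s v) = 0" "k \<noteq> 0" "t \<noteq> 0" for x k t
    proof -
      have "quartic (k *s x + t *s v) = k ^ 4 * quartic x + k\<^sup>2 * t * (k * T x - t * N x)"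
        unfolding quartic_distinct[OF dis] T_def N_def
        by (simp add: v_nth field_simps power2_eq_square power4_eq_xxxx)
      then show ?thesis using that by simp
    qed
    show "N x \<noteq> 0" if "near_poly x \<noteq> 0" for x
      unfolding N_def by (rule near_polyD(3)[OF that]) (use dis in auto)
    show "T node_vec = 0" using dis by (simp add: T_def node_vec_def)
    show "Tw z = c' * T (fst z)" if "off_node (snd z new_node) = c' *s off_node (fst z)" for z c'
      unfolding Tw_def T_def that using dis by (simp add: off_node_nth algebra_simps)
    show "distinct [c, d, 4]" "v $ c = v $ d" using dis v_nth by auto
    show "N node_vec *s u + Tw (exc_rep u) *s off_node v \<noteq> 0"
    proof
      assume *: "N node_vec *s u + Tw (exc_rep u) *s off_node v = 0"
      have Twe: "Tw (exc_rep u) = (u $ b - u $ a) / 2"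
        unfolding Tw_def snd_exc_rep off_node_conic[OF u] by (simp add: exc_rep_def N_node)
      have "u $ i + (u $ b - u $ a) * v $ i = 0" for i
      proof -
        have "(u $ i + (u $ b - u $ a) * v $ i) / 2 = 0"
          using arg_cong[OF *, of "\<lambda>w. w $ i"] by (simp add: ov N_node Twe add_divide_distrib)
        then show ?thesis by simp
      qed
      from this[of a] this[of b] this[of c] this[of d] this[of 4]
      have "u $ i = 0" if "i \<in> {a, b, c, d, 4}" for i using that by (auto simp: v_nth)
      then have "u = 0" using distinct_UNIV_5[OF dis] by (auto simp: vec_eq_iff)
      then show False using u by (simp add: node_conic_def)
    qed
  qed
  then show ?thesis
    unfolding res v_def[symmetric]
    using node_conic_scale[of "1/4" "reflection (off_node v) u"] exc_pt_scale[of "1/4" "reflection (off_node v) u"] by simp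
qed

lemma covering_involution_last:
  fixes \<gamma> :: "'k::{alg_closed_field, field_char_0} xpoint \<Rightarrow> 'k xpoint"
  assumes a: "a \<noteq> 4" and \<gamma>: "covering_involution (P_node a 4) \<gamma>" and u: "node_conic u"
  shows "node_conic (reflection (off_node (edge_vec a 4)) u) \<and> \<gamma> (exc_pt u) = exc_pt (reflection (off_node (edge_vec a 4)) u)"
proof -
  have "\<exists>c::5. c \<noteq> a \<and> c \<noteq> 4" using exhaust_5[of a] by (auto intro: exI[of _ 0] exI[of _ 1])
  then obtain c where "c \<noteq> a" "c \<noteq> 4" by blast
  then have "distinct [a, c, 4]" using a by auto
  then obtain d e where dis: "distinct [a, c, d, e, 4]" using exists_complement_5 by blast
  define v :: "'k ^ 5" where "v = edge_vec a 4"
  have v_nth: "v $ a = 1" "v $ c = 0" "v $ d = 0" "v $ e = 0" "v $ 4 = - 1"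
    using dis by (auto simp: v_def edge_vec_def)
  define N :: "'k ^ 5 \<Rightarrow> 'k" where "N x = x $ c * x $ d + x $ c * x $ e + x $ d * x $ e" for x
  \<comment> \<open>The number 15 is 16 - 1: in 16 times the quartic the product of the three fixed
    coordinates is multiplied by 16 times coordinate \<open>a\<close> plus coordinate 4, and these
    move in opposite directions.\<close>
  define T :: "'k ^ 5 \<Rightarrow> 'k" where "T x = N x * (x $ 4 - x $ a) + 15 * x $ c * x $ d * x $ e" for x
  \<comment> \<open>With coordinates \<open>u + s\<close>, \<open>T\<close> expands without constant
    term in \<open>u\<close>, once the sum of the other three coordinates of \<open>u\<close> is
    replaced by minus coordinate \<open>a\<close>. In each remaining term one factor
    \<open>u\<close> is exchanged for the direction \<open>w\<close>.\<close>
  define Tw where "Tw z = (let x = off_node (fst z); w = off_node (snd z new_node); s = - fst z $ 4 / 4 in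
      (- 5 * s\<^sup>2 - N (fst z)) * w $ a + 10 * s * (x $ c * w $ d + x $ c * w $ e + x $ d * w $ e)
      + 15 * x $ c * x $ d * w $ e)"
    for z :: "('k, 5) blowup_cone"
  have ov: "off_node v $ a = 3 / 4" "off_node v $ c = - 1 / 4" "off_node v $ d = - 1 / 4"
    "off_node v $ e = - 1 / 4" "off_node v $ 4 = 0"
    using dis by (auto simp: off_node_nth v_nth)
  have N_node: "N node_vec = 3" using dis by (simp add: N_def node_vec_def)
  have Twe: "Tw (exc_rep u) = - 8 * u $ a"
    unfolding Tw_def snd_exc_rep off_node_conic[OF u] Let_def
    by (simp add: exc_rep_def N_node off_node_node) (simp add: node_vec_def)
  have u_sum: "u $ a + u $ c + u $ d + u $ e = 0" "u $ 4 = 0"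
    using u by (auto simp: node_conic_def sum_distinct_5[OF dis])
  have res: "N node_vec *s u + Tw (exc_rep u) *s off_node v = 4 *s reflection (off_node v) u"
  proof -
    have "(\<Sum>i\<in>UNIV. (off_node v $ i)\<^sup>2) = 3 / 4"
      by (simp add: sum_distinct_5[OF dis] ov power2_eq_square)
    moreover have "(\<Sum>i\<in>UNIV. u $ i * off_node v $ i) = u $ a - (u $ a + u $ c + u $ d + u $ e) / 4"
      by (simp add: sum_distinct_5[OF dis] ov field_simps)
    ultimately show ?thesis
      unfolding u_sum reflection_def N_node Twe by (simp only:) (simp add: vec_eq_iff field_simps)
  qed
  have "node_conic (N node_vec *s u + Tw (exc_rep u) *s off_node v) \<and>
    \<gamma> (exc_pt u) = exc_pt (N node_vec *s u + Tw (exc_rep u) *s off_node v)"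
  proof (rule covering_involution_on_exc[OF _ _ _ u, where T = T])
    show "covering_involution (pt v) \<gamma>" using \<gamma> by (simp add: P_node_eq v_def)
    show "v \<noteq> 0" using v_nth(1) by auto
    show "sum (($) v) UNIV = 0" by (simp add: sum_distinct_5[OF dis] v_nth)
    have Np: "(\<lambda>z. N (fst z)) \<in> X_polyfuns"
      unfolding N_def by (intro polyfuns_intros polyfuns_fst)
    then show "(\<lambda>z. N (fst z)) \<in> X_polyfuns" .
    show "(\<lambda>z. T (fst z)) \<in> X_polyfuns"
      unfolding T_def by (intro polyfuns_intros Np polyfuns_fst)
    show "Tw \<in> X_polyfuns"
      unfolding Tw_def[abs_def] Let_def
      by (intro polyfuns_intros polyfuns_divide Np polyfuns_fst polyfuns_off_node_fst polyfuns_off_node_snd)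
    show "t * N x = k * T x" if "quartic x = 0" "quartic (k *s x + t *s v) = 0" "k \<noteq> 0" "t \<noteq> 0" for x k t
    proof -
      have "16 * quartic (k *s x + t *s v) = 16 * k ^ 4 * quartic x + k\<^sup>2 * t * (k * T x - t * N x)"
        unfolding quartic_distinct[OF dis] T_def N_def
        by (simp add: v_nth field_simps power2_eq_square power4_eq_xxxx)
      then show ?thesis using that by simp
    qed
    show "N x \<noteq> 0" if "near_poly x \<noteq> 0" for x
      unfolding N_def by (rule near_polyD(4)[OF that]) (use dis in auto)
    show "T node_vec = 0" using dis by (simp add: T_def N_node) (simp add: node_vec_def)
    show "Tw z = c' * T (fst z)"
      if "sum (($) (fst z)) UNIV = 0" "off_node (snd z new_node) = c' *s off_node (fst z)" for z c'
    proof -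
      have xa: "fst z $ a = - fst z $ c - fst z $ d - fst z $ e - fst z $ 4"
        using that(1) unfolding sum_distinct_5[OF dis] by algebra
      have x4: "\<exists>s. fst z $ 4 = - 4 * s" by (intro exI[of _ "- fst z $ 4 / 4"]) simp
      then obtain s where s: "fst z $ 4 = - 4 * s" by blast
      show ?thesis
        unfolding Tw_def T_def N_def that(2) Let_def
        using dis by (simp add: off_node_nth xa s algebra_simps power2_eq_square)
    qed
    show "distinct [c, d, 4]" "v $ c = v $ d" using dis v_nth by auto
    show "N node_vec *s u + Tw (exc_rep u) *s off_node v \<noteq> 0"
    proof
      assume *: "N node_vec *s u + Tw (exc_rep u) *s off_node v = 0"
      have eq: "3 * u $ i - 8 * u $ a * off_node v $ i = 0" for i
        using arg_cong[OF *, of "\<lambda>w. w $ i"] by (simp add: N_node Twe)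
      have "u $ a = 0" using eq[of a] by (simp add: ov)
      then have "u = 0" using eq by (simp add: vec_eq_iff)
      then show False using u by (simp add: node_conic_def)
    qed
  qed
  then show ?thesis
    unfolding res v_def[symmetric]
    using node_conic_scale[of 4 "reflection (off_node v) u"] exc_pt_scale[of 4 "reflection (off_node v) u"] by simp
qed

lemma covering_involution_reflection:
  fixes \<gamma> :: "'k::{alg_closed_field, field_char_0} xpoint \<Rightarrow> 'k xpoint"
  assumes ab: "a \<noteq> b" and \<gamma>: "covering_involution (P_node a b) \<gamma>" and u: "node_conic u"
  shows "node_conic (reflection (off_node (edge_vec a b)) u) \<and> \<gamma> (exc_pt u) = exc_pt (reflection (off_node (edge_vec a b)) u)"
proof -
  consider "distinct [a, b, 4]" | "b = 4" "a \<noteq> 4" | "a = 4" "b \<noteq> 4" using ab by auto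
  then show ?thesis
  proof cases
    case 3
    \<comment> \<open>Exchanging the indices negates the edge vector. The node is unaffected, and so
      is the reflection, which is quadratic in \<open>d\<close>.\<close>
    have e: "edge_vec a b = (- 1) *s (edge_vec b a :: 'k ^ 5)" using ab by (simp add: edge_vec_def vec_eq_iff)
    have "P_node a b = (P_node b a :: ('k ^ 5) set)"
      unfolding P_node_eq e by (rule pt_scale) simp
    moreover have "reflection (off_node (edge_vec a b)) u = reflection (off_node (edge_vec b a)) u"
      unfolding e off_node_scale reflection_scale by simp
    ultimately show ?thesis using covering_involution_last[of b \<gamma> u] \<gamma> u 3 by simp
  next
    case 1
    then show ?thesis using covering_involution_transposition \<gamma> u by (intro conjI) blast+
  next
    case 2
    then show ?thesis using covering_involution_last[of a \<gamma> u] \<gamma> u by simp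
  qed
qed

section \<open>Quaternions and the projective line\<close>

lemma quat_simps [simp]:
  "q_re 0 = 0" "q_i 0 = 0" "q_j 0 = 0" "q_k 0 = 0"
  "q_re 1 = 1" "q_i 1 = 0" "q_j 1 = 0" "q_k 1 = 0"
  "q_re (- x) = - q_re x" "q_i (- x) = - q_i x" "q_j (- x) = - q_j x" "q_k (- x) = - q_k x"
  "q_re (x + y) = q_re x + q_re y" "q_i (x + y) = q_i x + q_i y"
  "q_j (x + y) = q_j x + q_j y" "q_k (x + y) = q_k x + q_k y"
  "q_re (x - y) = q_re x - q_re y" "q_i (x - y) = q_i x - q_i y"
  "q_j (x - y) = q_j x - q_j y" "q_k (x - y) = q_k x - q_k y"
  "q_re (x * y) = q_re x * q_re y - q_i x * q_i y - q_j x * q_j y - q_k x * q_k y"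
  "q_i (x * y) = q_re x * q_i y + q_i x * q_re y + q_j x * q_k y - q_k x * q_j y"
  "q_j (x * y) = q_re x * q_j y - q_i x * q_k y + q_j x * q_re y + q_k x * q_i y"
  "q_k (x * y) = q_re x * q_k y + q_i x * q_j y - q_j x * q_i y + q_k x * q_re y"
  "q_re (quat_scale c x) = c * q_re x" "q_i (quat_scale c x) = c * q_i x"
  "q_j (quat_scale c x) = c * q_j x" "q_k (quat_scale c x) = c * q_k x"
  "q_re quat_i = 0" "q_i quat_i = 1" "q_j quat_i = 0" "q_k quat_i = 0"
  "q_re quat_j = 0" "q_i quat_j = 0" "q_j quat_j = 1" "q_k quat_j = 0"
  "q_re quat_k = 0" "q_i quat_k = 0" "q_j quat_k = 0" "q_k quat_k = 1"
  by (simp_all add: zero_quat_def one_quat_def uminus_quat_def plus_quat_def minus_quat_def times_quat_def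
    quat_scale_def quat.map_sel quat_i_def quat_j_def quat_k_def)

lemma quat_eq_iff: "x = y \<longleftrightarrow> q_re x = q_re y \<and> q_i x = q_i y \<and> q_j x = q_j y \<and> q_k x = q_k y"
  by (auto simp: quat.expand)

definition quat_of_vec :: "'k::field ^ 5 \<Rightarrow> 'k quat" where
  "quat_of_vec u = Quat 0 (u $ 0 + u $ 1) (u $ 0 + u $ 2) (u $ 0 + u $ 3)"

text \<open>For coordinate sum 0 the three imaginary parts add up to twice the coordinate 0, which
  is therefore \<open>s\<close>.\<close>

definition vec_of_quat :: "'k::field quat \<Rightarrow> 'k ^ 5" where
  "vec_of_quat q = (let s = (q_i q + q_j q + q_k q) / 2 in
     \<chi> a. if a = 0 then s else if a = 1 then q_i q - s else if a = 2 then q_j q - s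
       else if a = 3 then q_k q - s else 0)"

lemma quat_of_vec_sel [simp]:
  "q_re (quat_of_vec u) = 0" "q_i (quat_of_vec u) = u $ 0 + u $ 1"
  "q_j (quat_of_vec u) = u $ 0 + u $ 2" "q_k (quat_of_vec u) = u $ 0 + u $ 3"
  by (simp_all add: quat_of_vec_def)

lemma vec_of_quat_of_vec:
  fixes u :: "'k::field_char_0 ^ 5"
  assumes "u $ 4 = 0" "sum (($) u) UNIV = 0"
  shows "vec_of_quat (quat_of_vec u) = u"
proof -
  have u3: "u $ 3 = - u $ 0 - u $ 1 - u $ 2" using assms unfolding sum_5 by algebra
  show ?thesis by (simp add: vec_of_quat_def vec_eq_iff forall_5 Let_def u3 assms(1) field_simps)
qed

lemma vec_of_quat_of_conic: "node_conic u \<Longrightarrow> vec_of_quat (quat_of_vec u) = u" for u :: "'k::field_char_0 ^ 5"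
  by (rule vec_of_quat_of_vec) (simp_all add: node_conic_def)

lemma quat_of_vec_of_quat: "q_re q = 0 \<Longrightarrow> quat_of_vec (vec_of_quat q) = (q :: 'k::field_char_0 quat)"
  by (simp add: quat_eq_iff vec_of_quat_def Let_def)

lemma vec_of_quat_scale: "vec_of_quat (quat_scale c q) = c *s vec_of_quat q"
  by (simp add: vec_of_quat_def Let_def vec_eq_iff algebra_simps add_divide_distrib)

lemma quat_of_vec_scale: "quat_of_vec (c *s u) = quat_scale c (quat_of_vec u)"
  by (simp add: quat_eq_iff algebra_simps)

lemma vec_of_quat_conic:
  fixes q :: "'k::field_char_0 quat"
  assumes q: "q \<noteq> 0" "q * q = 0"
  shows "q_re q = 0" "node_conic (vec_of_quat q)"
proof -
  have sq: "q_re q * q_re q - q_i q * q_i q - q_j q * q_j q - q_k q * q_k q = 0"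
    "2 * q_re q * q_i q = 0" "2 * q_re q * q_j q = 0" "2 * q_re q * q_k q = 0"
    using q(2) by (auto simp: quat_eq_iff)
  then show re: "q_re q = 0" by auto
  have n: "q_i q * q_i q + q_j q * q_j q + q_k q * q_k q = 0" using sq(1) re by algebra
  define s where "s = (q_i q + q_j q + q_k q) / 2"
  have v: "vec_of_quat q $ 0 = s" "vec_of_quat q $ 1 = q_i q - s" "vec_of_quat q $ 2 = q_j q - s"
    "vec_of_quat q $ 3 = q_k q - s" "vec_of_quat q $ 4 = 0" by (simp_all add: vec_of_quat_def Let_def s_def)
  have sum: "sum (($) (vec_of_quat q)) UNIV = 0" by (simp add: sum_5 v) (simp add: s_def field_simps)
  have "2 * s = q_i q + q_j q + q_k q" by (simp add: s_def)
  then have k: "q_k q = 2 * s - q_i q - q_j q" by algebra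
  have "2 * e2 (vec_of_quat q) = - (q_i q * q_i q + q_j q * q_j q + q_k q * q_k q)"
    by (simp add: e2_def v k algebra_simps)
  then have e2: "e2 (vec_of_quat q) = 0" using n by simp
  have "vec_of_quat q \<noteq> 0"
  proof
    assume "vec_of_quat q = 0"
    then have "quat_of_vec (0 :: 'k ^ 5) = q" using quat_of_vec_of_quat[OF re] by simp
    then show False using q(1) by (auto simp: quat_eq_iff)
  qed
  then show "node_conic (vec_of_quat q)" using sum e2 by (simp add: node_conic_def v)
qed

lemma quat_of_conic:
  fixes u :: "'k::field_char_0 ^ 5"
  assumes u: "node_conic u"
  shows "quat_of_vec u \<noteq> 0" "quat_of_vec u * quat_of_vec u = 0"
proof -
  have u4: "u $ 4 = 0" and us: "sum (($) u) UNIV = 0" and e: "e2 u = 0" and nz: "u \<noteq> 0"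
    using u by (simp_all add: node_conic_def)
  have u3: "u $ 3 = - u $ 0 - u $ 1 - u $ 2" using u4 us unfolding sum_5 by algebra
  have "q_re (quat_of_vec u * quat_of_vec u) = 2 * e2 u" by (simp add: e2_def u3 algebra_simps)
  then show "quat_of_vec u * quat_of_vec u = 0" using e by (simp add: quat_eq_iff)
  show "quat_of_vec u \<noteq> 0"
  proof
    assume "quat_of_vec u = 0"
    then have "vec_of_quat 0 = u" using vec_of_quat_of_vec[OF u4 us] by simp
    moreover have "vec_of_quat 0 = (0 :: 'k ^ 5)"
      by (simp add: vec_of_quat_def Let_def vec_eq_iff forall_5)
    ultimately show False using nz by simp
  qed
qed

text \<open>For pure quaternions, d n d equals -|d|^2 n if n is parallel to d, and |d|^2 n if n is
  orthogonal to d, where they anticommute. As \<open>quat_of_vec\<close> is an isometry on these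
  vectors, this is \<open>reflection\<close>.\<close>

lemma quat_of_vec_reflection:
  fixes u d :: "'k::field_char_0 ^ 5"
  assumes u: "u $ 4 = 0" "sum (($) u) UNIV = 0" and d: "d $ 4 = 0" "sum (($) d) UNIV = 0"
  shows "quat_of_vec (reflection d u) = quat_of_vec d * quat_of_vec u * quat_of_vec d"
proof -
  have u3: "u $ 3 = - u $ 0 - u $ 1 - u $ 2" using u unfolding sum_5 by algebra
  have d3: "d $ 3 = - d $ 0 - d $ 1 - d $ 2" using d unfolding sum_5 by algebra
  show ?thesis
    by (simp add: quat_eq_iff reflection_def sum_5 u d u3 d3 power2_eq_square algebra_simps)
qed

lemma quat_of_vec_square:
  "quat_of_vec d * quat_of_vec d = quat_scale (q_re (quat_of_vec d * quat_of_vec d)) 1"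
  by (simp add: quat_eq_iff)

text \<open>For a matrix of rank one this is literally a point of the projective line, points being
  sets of nonzero vectors.\<close>

definition punctured_range :: "'k::field ^ 2 ^ 2 \<Rightarrow> ('k ^ 2) set" where
  "punctured_range A = range (\<lambda>v. A *v v) - {0}"

lemma matrix_2_vector: "((A :: 'k::field ^ 2 ^ 'm) *v v) $ i = A $ i $ 1 * v $ 1 + A $ i $ 2 * v $ 2"
  by (simp add: matrix_vector_mult_def sum_2)

lemma punctured_range_nilpotent:
  fixes A :: "'k::field ^ 2 ^ 2"
  assumes A: "A ** A = 0" and v: "A *v e \<noteq> 0"
  shows "punctured_range A = pt (A *v e)"
proof -
  define v where "v = A *v e"
  have kill: "A *v (A *v f) = 0" for f using A by (simp add: matrix_vector_mul_assoc)
  \<comment> \<open>Since the square of \<open>A\<close> is 0, both vectors lie in the kernel; and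
    the kernel of a nonzero 2x2 matrix has dimension at most 1.\<close>
  have dep: "\<exists>c. w = c *s v" if w: "w = A *v f" for w f
  proof -
    have vw: "A $ i $ 1 * v $ 1 + A $ i $ 2 * v $ 2 = 0" "A $ i $ 1 * w $ 1 + A $ i $ 2 * w $ 2 = 0" for i
      using arg_cong[OF kill[of e], of "\<lambda>x. x $ i"] arg_cong[OF kill[of f], of "\<lambda>x. x $ i"]
      by (simp_all only: matrix_2_vector v_def[symmetric] w[symmetric] zero_index)
    have 1: "A $ i $ 1 * (v $ 1 * w $ 2 - v $ 2 * w $ 1) = 0" for i using vw[of i] by algebra
    have 2: "A $ i $ 2 * (v $ 1 * w $ 2 - v $ 2 * w $ 1) = 0" for i using vw[of i] by algebra
    have "\<exists>i. A $ i $ 1 \<noteq> 0 \<or> A $ i $ 2 \<noteq> 0"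
    proof (rule ccontr)
      assume "\<not> ?thesis"
      then have "A *v e = 0" by (simp add: vec_eq_iff matrix_2_vector)
      then show False using v by simp
    qed
    then obtain i where "A $ i $ 1 \<noteq> 0 \<or> A $ i $ 2 \<noteq> 0" by blast
    then have "w $ 1 * v $ 2 = w $ 2 * v $ 1" using 1[of i] 2[of i] by (auto simp: mult.commute)
    then have "w $ i * v $ j = w $ j * v $ i" for i j
      using exhaust_2[of i] exhaust_2[of j] by (elim disjE) simp_all
    moreover have "v \<noteq> 0" using v by (simp add: v_def)
    ultimately show ?thesis by (rule parallel_vectors)
  qed
  show ?thesis
  proof
    show "punctured_range A \<subseteq> pt (A *v e)"
      using dep unfolding punctured_range_def pt_eq[OF v] v_def by fastforce
    show "pt (A *v e) \<subseteq> punctured_range A"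
    proof
      fix x assume "x \<in> pt (A *v e)"
      then obtain c where c: "c \<noteq> 0" "x = c *s (A *v e)" using pt_eq[OF v] by auto
      have "c *s (A *v e) = A *v (c *s e)" by (simp add: vec_eq_iff matrix_2_vector algebra_simps)
      moreover have "c *s (A *v e) \<noteq> 0" using c v by (simp only: vector_mul_eq_0 simp_thms)
      ultimately show "x \<in> punctured_range A" unfolding punctured_range_def c(2) by simp
    qed
  qed
qed

lemma punctured_range_scale: "c \<noteq> 0 \<Longrightarrow> punctured_range (\<chi> i j. c * A $ i $ j) = punctured_range A"
proof -
  assume c: "c \<noteq> 0"
  have "(\<chi> i j. c * A $ i $ j) *v v = A *v (c *s v)" for v by (simp add: vec_eq_iff matrix_2_vector algebra_simps)
  moreover have "range (\<lambda>v. A *v (c *s v)) = range (\<lambda>v. A *v v)"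
  proof -
    have "A *v v = A *v (c *s (inverse c *s v))" for v using c by (simp add: vector_smult_assoc)
    then show ?thesis by blast
  qed
  ultimately show ?thesis by (simp add: punctured_range_def)
qed

text \<open>The product of the column \<open>v\<close> with the row \<open>(v $ 2, - v $ 1)\<close>:
  the rank-one matrix whose kernel and image are both the line of \<open>v\<close>. It is quadratic
  in \<open>v\<close>, as a parametrization of a conic should be.\<close>

definition nilpotent_of :: "'k::field ^ 2 \<Rightarrow> 'k ^ 2 ^ 2" where
  "nilpotent_of v = vector [vector [v $ 1 * v $ 2, - (v $ 1 * v $ 1)], vector [v $ 2 * v $ 2, - (v $ 1 * v $ 2)]]"

lemma nilpotent_of_nth:
  "nilpotent_of v $ 1 $ 1 = v $ 1 * v $ 2" "nilpotent_of v $ 1 $ 2 = - (v $ 1 * v $ 1)"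
  "nilpotent_of v $ 2 $ 1 = v $ 2 * v $ 2" "nilpotent_of v $ 2 $ 2 = - (v $ 1 * v $ 2)"
  by (simp_all add: nilpotent_of_def)

lemma nilpotent_of_vector: "nilpotent_of v *v e = (v $ 2 * e $ 1 - v $ 1 * e $ 2) *s v"
  by (simp add: vec_eq_iff forall_2 matrix_2_vector nilpotent_of_nth algebra_simps)

lemma nilpotent_of_square: "nilpotent_of v ** nilpotent_of v = 0"
  by (simp add: vec_eq_iff forall_2 matrix_matrix_mult_def sum_2 nilpotent_of_nth algebra_simps)

lemma nilpotent_of_scale: "nilpotent_of (c *s v) = (\<chi> i j. c\<^sup>2 * nilpotent_of v $ i $ j)"
  by (simp add: vec_eq_iff forall_2 nilpotent_of_nth power2_eq_square)

lemma nilpotent_of_nonzero: "v \<noteq> 0 \<Longrightarrow> nilpotent_of v \<noteq> 0"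
  by (auto simp: vec_eq_iff forall_2 nilpotent_of_nth)

lemma punctured_range_nilpotent_of:
  assumes "v \<noteq> 0" shows "punctured_range (nilpotent_of v) = pt v"
proof -
  obtain e :: "'a ^ 2" where e: "v $ 2 * e $ 1 - v $ 1 * e $ 2 \<noteq> 0"
  proof (cases "v $ 1 = 0")
    case True
    then have "v $ 2 \<noteq> 0" using assms by (auto simp: vec_eq_iff forall_2)
    then show ?thesis using that[of "vector [1, 0]"] by simp
  next
    case False
    then show ?thesis using that[of "vector [0, 1]"] by simp
  qed
  then have "nilpotent_of v *v e \<noteq> 0" using assms by (simp add: nilpotent_of_vector)
  from punctured_range_nilpotent[OF nilpotent_of_square this] show ?thesis
    unfolding nilpotent_of_vector pt_scale[OF e] .
qed

lemma nilpotent_eq_nilpotent_of: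
  fixes A :: "'k::field ^ 2 ^ 2"
  assumes A: "A ** A = 0" "A \<noteq> 0"
  shows "\<exists>v c. v \<noteq> 0 \<and> c \<noteq> 0 \<and> A = (\<chi> i j. c * nilpotent_of v $ i $ j)"
proof -
  obtain i j where ij: "A $ i $ j \<noteq> 0" using A(2) by (auto simp: vec_eq_iff)
  obtain e where e: "A *v e \<noteq> 0"
  proof (cases "j = 1")
    case True
    then have "(A *v vector [1, 0]) $ i \<noteq> 0" using ij by (simp add: matrix_2_vector)
    then show ?thesis using that[of "vector [1, 0]"] by (metis zero_index)
  next
    case False
    then have "j = 2" using exhaust_2[of j] by simp
    then have "(A *v vector [0, 1]) $ i \<noteq> 0" using ij by (simp add: matrix_2_vector)
    then show ?thesis using that[of "vector [0, 1]"] by (metis zero_index)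
  qed
  define v where "v = A *v e"
  have v: "v \<noteq> 0" using e by (simp add: v_def)
  have "punctured_range A = pt v" using punctured_range_nilpotent[OF A(1) e] by (simp add: v_def)
  have col: "\<exists>a. A *v f = a *s v" for f
  proof (cases "A *v f = 0")
    case True
    then show ?thesis by (intro exI[of _ 0]) simp
  next
    case False
    then have "A *v f \<in> pt v" using \<open>punctured_range A = pt v\<close> by (auto simp: punctured_range_def)
    then show ?thesis by (auto simp: pt_eq[OF v])
  qed
  obtain a where a: "A *v vector [1, 0] = a *s v" using col by blast
  obtain b where b: "A *v vector [0, 1] = b *s v" using col by blast
  have Aij: "A $ i $ 1 = a * v $ i" "A $ i $ 2 = b * v $ i" for i
    using arg_cong[OF a, of "\<lambda>x. x $ i"] arg_cong[OF b, of "\<lambda>x. x $ i"] by (simp_all add: matrix_2_vector)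
  have "A *v v = 0" using A(1) by (simp add: v_def matrix_vector_mul_assoc)
  then have "(a * v $ 1 + b * v $ 2) *s v = 0"
    by (simp add: vec_eq_iff matrix_2_vector Aij algebra_simps)
  then have ab: "a * v $ 1 + b * v $ 2 = 0" using v by (simp only: vector_mul_eq_0 simp_thms)
  \<comment> \<open>Both columns are multiples of \<open>v\<close>, so \<open>A\<close> is
    \<open>v\<close> times the row \<open>(a, b)\<close>. Since \<open>A\<close> kills
    \<open>v\<close>, this row is proportional to \<open>(v $ 2, - v $ 1)\<close>.\<close>
  obtain c where c: "a = c * v $ 2" "b = - (c * v $ 1)"
  proof (cases "v $ 1 = 0")
    case True
    then have "v $ 2 \<noteq> 0" using v by (auto simp: vec_eq_iff forall_2)
    then show ?thesis using that[of "a / v $ 2"] ab True by simp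
  next
    case False
    then show ?thesis using that[of "- b / v $ 1"] ab by (simp add: field_simps eq_neg_iff_add_eq_0)
  qed
  have eq: "A = (\<chi> i j. c * nilpotent_of v $ i $ j)"
    by (simp add: vec_eq_iff forall_2 Aij c nilpotent_of_nth)
  have "c \<noteq> 0" using A(2) eq by (auto simp: vec_eq_iff)
  then show ?thesis using v eq by blast
qed

section \<open>The conic of nilpotent quaternions as the projective line\<close>

locale quat_iso =
  fixes \<Phi> :: "'k::field_char_0 quat \<Rightarrow> 'k ^ 2 ^ 2"
  assumes iso: "quat_matrix_iso \<Phi>"
begin

lemma \<Phi>_rules:
  "bij \<Phi>" "\<Phi> 1 = mat 1" "\<Phi> (x + y) = \<Phi> x + \<Phi> y" "\<Phi> (x * y) = \<Phi> x ** \<Phi> y"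
  "\<Phi> (quat_scale c x) = (\<chi> i j. c * \<Phi> x $ i $ j)"
  using iso unfolding quat_matrix_iso_def by simp_all

lemma \<Phi>_zero: "\<Phi> 0 = 0"
  using \<Phi>_rules(3)[of 0 0] by simp

lemma \<Phi>_eq_iff: "\<Phi> x = \<Phi> y \<longleftrightarrow> x = y"
  using \<Phi>_rules(1) by (auto dest: bij_is_inj injD)

definition \<Phi>_inv :: "'k ^ 2 ^ 2 \<Rightarrow> 'k quat" where "\<Phi>_inv = inv \<Phi>"

lemma \<Phi>_\<Phi>_inv: "\<Phi> (\<Phi>_inv A) = A"
  using \<Phi>_rules(1) by (simp add: \<Phi>_inv_def bij_is_surj surj_f_inv_f)

lemma \<Phi>_inv_scale: "\<Phi>_inv (\<chi> i j. c * A $ i $ j) = quat_scale c (\<Phi>_inv A)"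
  by (subst \<Phi>_eq_iff[symmetric]) (simp add: \<Phi>_\<Phi>_inv \<Phi>_rules)

lemma \<Phi>_inv_add: "\<Phi>_inv (A + B) = \<Phi>_inv A + \<Phi>_inv B"
  by (subst \<Phi>_eq_iff[symmetric]) (simp add: \<Phi>_\<Phi>_inv \<Phi>_rules)

definition conic_vec :: "'k ^ 2 \<Rightarrow> 'k ^ 5" where
  "conic_vec v = vec_of_quat (\<Phi>_inv (nilpotent_of v))"

lemma \<Phi>_inv_nilpotent:
  assumes "A ** A = 0" "A \<noteq> 0"
  shows "\<Phi>_inv A \<noteq> 0" "\<Phi>_inv A * \<Phi>_inv A = 0"
proof -
  show "\<Phi>_inv A \<noteq> 0" using assms(2) \<Phi>_\<Phi>_inv[of A] \<Phi>_zero by auto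
  show "\<Phi>_inv A * \<Phi>_inv A = 0"
    by (subst \<Phi>_eq_iff[symmetric]) (simp add: \<Phi>_\<Phi>_inv \<Phi>_rules \<Phi>_zero assms)
qed

lemma conic_vec:
  assumes "v \<noteq> 0"
  shows "node_conic (conic_vec v)" "\<Phi> (quat_of_vec (conic_vec v)) = nilpotent_of v"
proof -
  note q = \<Phi>_inv_nilpotent[OF nilpotent_of_square nilpotent_of_nonzero[OF assms]]
  show "node_conic (conic_vec v)" unfolding conic_vec_def by (rule vec_of_quat_conic[OF q])
  show "\<Phi> (quat_of_vec (conic_vec v)) = nilpotent_of v"
    unfolding conic_vec_def quat_of_vec_of_quat[OF vec_of_quat_conic(1)[OF q]] by (rule \<Phi>_\<Phi>_inv)
qed

lemma conic_vec_scale: "conic_vec (c *s v) = c\<^sup>2 *s conic_vec v"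
  unfolding conic_vec_def nilpotent_of_scale \<Phi>_inv_scale vec_of_quat_scale ..

lemma conic_vec_polyfun: "(\<lambda>v. conic_vec v $ i) \<in> polyfuns vec_coords"
proof -
  have polyfuns_coord: "(\<lambda>v. v $ i) \<in> polyfuns {f. \<exists>i. f = (\<lambda>v. v $ i)}" for i :: 2
    by (intro polyfuns.coord) auto
  \<comment> \<open>\<open>\<Phi>\<close> is an arbitrary isomorphism with no formula at hand. Its
    inverse is linear, though, and \<open>nilpotent_of\<close> combines three fixed matrices with
    monomials in \<open>v\<close> as coefficients.\<close>
  define A B D :: "'k ^ 2 ^ 2" where "A = vector [vector [1, 0], vector [0, - 1]]"
    and "B = vector [vector [0, - 1], vector [0, 0]]" and "D = vector [vector [0, 0], vector [1, 0]]"
  have "nilpotent_of v = (\<chi> i j. (v $ 1 * v $ 2) * A $ i $ j) + (\<chi> i j. (v $ 1 * v $ 1) * B $ i $ j)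
      + (\<chi> i j. (v $ 2 * v $ 2) * D $ i $ j)" for v
    by (simp add: vec_eq_iff forall_2 nilpotent_of_nth A_def B_def D_def)
  then have q: "\<Phi>_inv (nilpotent_of v) = quat_scale (v $ 1 * v $ 2) (\<Phi>_inv A)
      + quat_scale (v $ 1 * v $ 1) (\<Phi>_inv B) + quat_scale (v $ 2 * v $ 2) (\<Phi>_inv D)" for v
    by (simp add: \<Phi>_inv_add \<Phi>_inv_scale)
  consider "i = 0" | "i = 1" | "i = 2" | "i = 3" | "i = 4" using exhaust_5 by blast
  then show ?thesis
    by cases (simp_all add: conic_vec_def q vec_of_quat_def Let_def,
      (intro polyfuns_intros polyfuns_divide polyfuns_coord)+)
qed

lemma conic_eq_conic_vec:
  assumes u: "node_conic u"
  shows "\<exists>v c. v \<noteq> 0 \<and> c \<noteq> 0 \<and> u = c *s conic_vec v"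
proof -
  have "\<Phi> (quat_of_vec u) ** \<Phi> (quat_of_vec u) = 0"
    using quat_of_conic(2)[OF u] \<Phi>_rules(4)[of "quat_of_vec u" "quat_of_vec u"] \<Phi>_zero by simp
  moreover have "\<Phi> (quat_of_vec u) \<noteq> 0"
    using quat_of_conic(1)[OF u] \<Phi>_eq_iff[of "quat_of_vec u" 0] \<Phi>_zero by simp
  ultimately obtain v c where v: "v \<noteq> 0" "c \<noteq> 0"
    "\<Phi> (quat_of_vec u) = (\<chi> i j. c * nilpotent_of v $ i $ j)"
    using nilpotent_eq_nilpotent_of by blast
  have "\<Phi> (quat_of_vec u) = \<Phi> (quat_of_vec (c *s conic_vec v))"
    unfolding quat_of_vec_scale \<Phi>_rules(5) conic_vec(2)[OF v(1)] v(3) ..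
  then have eq: "quat_of_vec u = quat_of_vec (c *s conic_vec v)" by (simp add: \<Phi>_eq_iff)
  have "node_conic (c *s conic_vec v)" using node_conic_scale[OF v(2)] conic_vec(1)[OF v(1)] by simp
  then have "c *s conic_vec v = vec_of_quat (quat_of_vec (c *s conic_vec v))"
    by (rule vec_of_quat_of_conic[symmetric])
  also have "\<dots> = u" unfolding eq[symmetric] by (rule vec_of_quat_of_conic[OF u])
  finally show ?thesis using v(1,2) by metis
qed

end

context blowup_centre
begin

text \<open>A polynomial vector that scales along classes defines a map to projective space where it
  is nonzero. Since it may vanish elsewhere, the facts are stated for the open set \<open>O'\<close>
  and not as a morphism.\<close>

lemma ambient_to_proj_space:
  fixes g :: "('k, 'n) blowup_cone \<Rightarrow> 'k ^ 'm" and V :: "('k ^ 'm) set set"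
  assumes g: "\<And>i. (\<lambda>z. g z $ i) \<in> cone_polyfuns Z"
    and inv: "\<And>z z'. (z, z') \<in> blowup_rel Z \<Longrightarrow> \<exists>c. c \<noteq> 0 \<and> g z' = c *s g z"
    and V: "openin (ztop proj_space) V"
  defines "O' \<equiv> blowup_class Z ` {z \<in> blowup_cone Z. g z \<noteq> 0 \<and> pt (g z) \<in> V}"
  shows "openin (ztop (blowup_ambient Z)) O'"
    and "z \<in> blowup_cone Z \<Longrightarrow> blowup_class Z z \<in> O' \<longleftrightarrow> g z \<noteq> 0 \<and> pt (g z) \<in> V"
    and "h \<in> reg proj_space V \<Longrightarrow>
      h \<circ> (\<lambda>\<xi>. pt (g (SOME z. z \<in> \<xi>))) \<in> reg (blowup_ambient Z) O'"
    and "z \<in> blowup_cone Z \<Longrightarrow> pt (g (SOME y. y \<in> blowup_class Z z)) = pt (g z)"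
proof -
  let ?A = "affine_part (- {0}) (vec_coords :: ('k ^ 'm \<Rightarrow> 'k) set)"
  let ?F = "\<lambda>\<xi>. pt (g (SOME z. z \<in> \<xi>))"
  define V' where "V' = {v \<in> - {0}. pt v \<in> V}"
  have V': "openin (ztop ?A) V'"
    using V unfolding proj_space_def openin_quotient_space points_affine_part V'_def pt_def by simp
  have gp: "(\<lambda>z. k (g z)) \<in> cone_polyfuns Z" if "k \<in> vec_coords" for k
    using that g by auto
  have "{z \<in> blowup_cone Z. g z \<in> - {0}} = (\<Union>i. {z \<in> blowup_cone Z. g z $ i \<noteq> 0})"
    by (auto simp: vec_eq_iff)
  moreover have "openin (ztop (cone_space Z)) (\<Union>i. {z \<in> blowup_cone Z. g z $ i \<noteq> 0})"
    by (rule openin_Union) (auto intro: openin_affine_nonzero g)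
  ultimately have B: "openin (ztop (cone_space Z)) {z \<in> blowup_cone Z. g z \<in> - {0}}" by simp
  have pre: "{z \<in> blowup_cone Z. g z \<noteq> 0 \<and> pt (g z) \<in> V} = {z \<in> blowup_cone Z. g z \<in> V'}"
    by (auto simp: V'_def)
  show o: "openin (ztop (blowup_ambient Z)) O'"
    unfolding O'_def pre by (intro open_blowup_class_image affine_preimage_open[OF gp B V'])
  have scale: "g y \<noteq> 0 \<longleftrightarrow> g z \<noteq> 0" "pt (g y) = pt (g z)" if "(z, y) \<in> blowup_rel Z" for z y
    using inv[OF that] by (auto simp: pt_scale)
  show mem: "blowup_class Z z \<in> O' \<longleftrightarrow> g z \<noteq> 0 \<and> pt (g z) \<in> V" if z: "z \<in> blowup_cone Z" for z
  proof
    assume "blowup_class Z z \<in> O'"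
    then obtain y where y: "y \<in> blowup_cone Z" "g y \<noteq> 0" "pt (g y) \<in> V" "blowup_class Z z = blowup_class Z y"
      by (auto simp: O'_def)
    then have "(z, y) \<in> blowup_rel Z" using blowup_class_eq_iff[OF z y(1)] by simp
    then show "g z \<noteq> 0 \<and> pt (g z) \<in> V" using y scale by auto
  qed (use z in \<open>auto simp: O'_def\<close>)
  show F: "pt (g (SOME y. y \<in> blowup_class Z z)) = pt (g z)" if z: "z \<in> blowup_cone Z" for z
  proof -
    have "(SOME y. y \<in> blowup_class Z z) \<in> blowup_class Z z"
      using blowup_class_self[OF z] by (rule someI)
    then show ?thesis by (intro scale(2)) simp
  qed
  show "h \<circ> ?F \<in> reg (blowup_ambient Z) O'" if h: "h \<in> reg proj_space V"
  proof -
    have "(\<lambda>v. h (pt v)) \<in> reg ?A V'"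
      using h unfolding proj_space_def reg_quotient_space points_affine_part V'_def pt_def .
    from affine_reg_comp[OF gp B this]
    have *: "(\<lambda>z. h (pt (g z))) \<in> reg (cone_space Z) {z \<in> blowup_cone Z. g z \<in> V'}" .
    have "(\<lambda>z. (h \<circ> ?F) (blowup_class Z z)) \<in> reg (cone_space Z) {z \<in> blowup_cone Z. g z \<in> V'}"
    proof (rule reg_cong[OF function_sheaf_affine_part affine_preimage_open[OF gp B V'] *])
      fix z assume "z \<in> {z \<in> blowup_cone Z. g z \<in> V'}"
      then have "z \<in> blowup_cone Z" by blast
      from F[OF this] show "(h \<circ> ?F) (blowup_class Z z) = h (pt (g z))" by (simp only: comp_apply)
    qed
    moreover have "{z \<in> blowup_cone Z. blowup_class Z z \<in> O'} = {z \<in> blowup_cone Z. g z \<in> V'}"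
      unfolding V'_def using mem by (intro Collect_cong conj_cong refl) simp
    ultimately show ?thesis
      unfolding blowup_ambient_def reg_quotient_space points_affine_part by simp
  qed
qed

end

definition exc_curve :: "'k::field xpoint set" where
  "exc_curve = {\<xi> \<in> points X_surface. blow_down \<xi> = new_node}"

lemma exc_curve_eq: "exc_curve = {exc_pt u | u. node_conic (u :: 'k::{alg_closed_field, field_char_0} ^ 5)}"
proof (rule set_eqI)
  show "\<xi> \<in> exc_curve \<longleftrightarrow> \<xi> \<in> {exc_pt u | u. node_conic u}" for \<xi> :: "'k xpoint"
  proof
    assume "\<xi> \<in> exc_curve"
    then show "\<xi> \<in> {exc_pt u | u. node_conic u}" using exc_pt_cases[of \<xi>] unfolding exc_curve_def by blast
  next
    assume "\<xi> \<in> {exc_pt u | u. node_conic u}"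
    then obtain u where "node_conic u" "\<xi> = exc_pt u" by blast
    then show "\<xi> \<in> exc_curve" by (simp only: exc_curve_def mem_Collect_eq exc_pt_in_X blow_down_exc_pt simp_thms)
  qed
qed

lemma function_sheaf_X: "function_sheaf (X_surface :: ('k::field_char_0 xpoint, 'k) fspace)"
  unfolding X_surface_eq by (rule H.function_sheaf_blowup)

locale exc_parametrization = quat_iso \<Phi>
  for \<Phi> :: "'k::{alg_closed_field, field_char_0} quat \<Rightarrow> 'k ^ 2 ^ 2"
begin

definition exc_matrix :: "('k, 5) blowup_cone \<Rightarrow> 'k ^ 2 ^ 2" where
  "exc_matrix z = \<Phi> (quat_of_vec (off_node (snd z new_node)))"

text \<open>Another representative of the class multiplies the matrix by a nonzero scalar, so the
  chosen one does not matter.\<close>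

definition exc_line :: "'k xpoint \<Rightarrow> ('k ^ 2) set" where
  "exc_line \<xi> = punctured_range (exc_matrix (SOME z. z \<in> \<xi>))"

lemma exc_matrix_rel:
  assumes "(z, z') \<in> blowup_rel Hessian_singular"
  shows "\<exists>c. c \<noteq> 0 \<and> exc_matrix z' = (\<chi> i j. c * exc_matrix z $ i $ j)"
proof -
  obtain c w where c: "c \<noteq> 0" "w \<in> insert 0 new_node" "snd z' new_node = c *s snd z new_node + w"
    using H.blowup_relD(4)[OF assms new_node_singular] by (elim exE conjE) (rule that)
  then have "off_node (snd z' new_node) = c *s off_node (snd z new_node)"
    using off_node_eq_0_iff[of w] by (simp add: off_node_add off_node_scale)
  then have "exc_matrix z' = (\<chi> i j. c * exc_matrix z $ i $ j)"
    unfolding exc_matrix_def by (simp only: quat_of_vec_scale \<Phi>_rules)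
  then show ?thesis using c(1) by blast
qed

lemma exc_line:
  assumes u: "node_conic u"
  shows "exc_line (exc_pt u) = punctured_range (\<Phi> (quat_of_vec u))"
proof -
  have "(SOME z. z \<in> exc_pt u) \<in> exc_pt u"
    using H.blowup_class_self[OF exc_rep_cone[OF u]] by (rule someI)
  then obtain c where "c \<noteq> 0" "exc_matrix (SOME z. z \<in> exc_pt u) = (\<chi> i j. c * exc_matrix (exc_rep u) $ i $ j)"
    using exc_matrix_rel[of "exc_rep u"] by blast
  moreover have "exc_matrix (exc_rep u) = \<Phi> (quat_of_vec u)"
    unfolding exc_matrix_def snd_exc_rep off_node_conic[OF u] ..
  ultimately show ?thesis unfolding exc_line_def by (simp add: punctured_range_scale)
qed

lemma exc_line_conic_vec: "v \<noteq> 0 \<Longrightarrow> exc_line (exc_pt (conic_vec v)) = pt v"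
  by (simp add: exc_line conic_vec punctured_range_nilpotent_of)

lemma exc_pt_conic_vec:
  assumes "node_conic u"
  shows "\<exists>v. v \<noteq> 0 \<and> exc_pt u = exc_pt (conic_vec v)"
proof -
  obtain v c where "v \<noteq> 0" "c \<noteq> 0" "u = c *s conic_vec v" using conic_eq_conic_vec[OF assms] by blast
  then show ?thesis using exc_pt_scale[of c "conic_vec v"] conic_vec(1) by blast
qed

lemma \<Phi>_quat_of_vec:
  "\<Phi> (quat_of_vec u) $ i $ j = (u $ 0 + u $ 1) * \<Phi> quat_i $ i $ j + (u $ 0 + u $ 2) * \<Phi> quat_j $ i $ j
    + (u $ 0 + u $ 3) * \<Phi> quat_k $ i $ j"
proof -
  have "quat_of_vec u = quat_scale (u $ 0 + u $ 1) quat_i + quat_scale (u $ 0 + u $ 2) quat_j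
      + quat_scale (u $ 0 + u $ 3) quat_k" by (simp add: quat_eq_iff)
  then show ?thesis by (simp add: \<Phi>_rules)
qed

text \<open>The image of a nonzero nilpotent matrix is spanned by its value at any vector outside
  the kernel. A fixed vector \<open>e\<close> stays outside the kernel nearby, and there the line is
  given by the polynomial vector \<open>exc_matrix z *v e\<close>.\<close>

lemma morphism_exc_line: "morphism (subspace_of X_surface exc_curve) proj_space exc_line"
proof (rule morphism_local[OF function_sheaf_subspace_of[OF function_sheaf_X]])
  let ?X = "X_surface :: ('k xpoint, 'k) fspace" and ?E = "exc_curve :: 'k xpoint set"
  let ?Y = "subspace_of ?X ?E"
  let ?B = "blowup_ambient (Hessian_singular :: ('k ^ 5) set set)"
  have ptsY: "points ?Y = ?E" by (auto simp: points_subspace_of exc_curve_def)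
  fix \<xi> assume "\<xi> \<in> points ?Y"
  then have "\<xi> \<in> ?E" by (simp only: ptsY)
  then obtain u where u: "node_conic u" "\<xi> = exc_pt u" unfolding exc_curve_eq by blast
  have "\<exists>v. v \<noteq> 0 \<and> exc_line \<xi> = pt v"
    using exc_pt_conic_vec[OF u(1)] exc_line_conic_vec u(2) by metis
  then show "exc_line \<xi> \<in> points proj_space" by (auto simp: points_proj_space)
  define N where "N = \<Phi> (quat_of_vec u)"
  have "N \<noteq> 0" using quat_of_conic(1)[OF u(1)] \<Phi>_eq_iff[of "quat_of_vec u" 0] \<Phi>_zero by (simp add: N_def)
  then obtain v c where vc: "v \<noteq> 0" "c \<noteq> 0" "N = (\<chi> i j. c * nilpotent_of v $ i $ j)"
    using nilpotent_eq_nilpotent_of[of N] quat_of_conic(2)[OF u(1)]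
      \<Phi>_rules(4)[of "quat_of_vec u" "quat_of_vec u"] \<Phi>_zero unfolding N_def by metis
  have "punctured_range N = pt v" unfolding vc(3) punctured_range_scale[OF vc(2)] by (rule punctured_range_nilpotent_of[OF vc(1)])
  then have "v \<in> punctured_range N" using self_in_pt[OF vc(1)] by simp
  then obtain e where e: "N *v e \<noteq> 0" by (auto simp: punctured_range_def)
  define g where "g z = exc_matrix z *v e" for z
  define F where "F \<eta> = pt (g (SOME z. z \<in> \<eta>))" for \<eta>
  have g: "(\<lambda>z. g z $ i) \<in> X_polyfuns" for i
    unfolding g_def matrix_2_vector exc_matrix_def \<Phi>_quat_of_vec
    by (intro polyfuns_intros polyfuns_off_node_snd)
  have inv: "\<exists>c. c \<noteq> 0 \<and> g z' = c *s g z" if "(z, z') \<in> blowup_rel Hessian_singular" for z z'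
    using exc_matrix_rel[OF that]
    by (elim exE conjE, intro exI conjI) (auto simp: g_def vec_eq_iff matrix_2_vector algebra_simps)
  define O' where "O' V = X_class `
    {z \<in> X_cone. g z \<noteq> 0 \<and> pt (g z) \<in> V}" for V
  note amb = H.ambient_to_proj_space[OF g inv, folded O'_def F_def]
  have Yopen: "openin (ztop ?Y) (O' V \<inter> ?E)" if "openin (ztop proj_space) V" for V
  proof -
    have "openin (ztop ?X) (O' V \<inter> points ?X)"
      unfolding X_surface_eq H.openin_blowup using amb(1)[OF _ that] by blast
    moreover have "O' V \<inter> ?E = (O' V \<inter> points ?X) \<inter> ?E" by (auto simp: exc_curve_def)
    ultimately show ?thesis unfolding openin_subspace_of by blast
  qed
  have Yreg: "h \<circ> F \<in> reg ?Y (O' V \<inter> ?E)" if V: "openin (ztop proj_space) V" and h: "h \<in> reg proj_space V" for V h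
  proof -
    have "h \<circ> F \<in> reg ?X (O' V \<inter> points ?X)"
      unfolding X_surface_eq
      by (subst H.blowup_eq) (rule reg_subspace_ofI[OF amb(3)[OF _ V h] amb(1)[OF _ V]], auto)
    moreover have "openin (ztop ?X) (O' V \<inter> points ?X)"
      unfolding X_surface_eq H.openin_blowup using amb(1)[OF _ V] by blast
    ultimately show ?thesis by (rule reg_subspace_ofI) (auto simp: exc_curve_def)
  qed
  define W where "W = O' (points proj_space) \<inter> ?E"
  have inW: "\<eta> \<in> W \<and> F \<eta> \<in> V \<longleftrightarrow> \<eta> \<in> O' V \<inter> ?E" if V: "openin (ztop proj_space) V" for V \<eta>
  proof (cases "\<eta> \<in> ?E")
    case True
    then obtain w where w: "node_conic w" "\<eta> = exc_pt w" unfolding exc_curve_eq by blast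
    note wc = exc_rep_cone[OF w(1)]
    show ?thesis
      using True amb(2)[OF _ V wc] amb(2)[OF _ openin_topspace wc] amb(4)[OF _ V wc] openin_subset[OF V]
      by (auto simp: W_def w(2) points_proj_space)
  qed (auto simp: W_def)
  have "exc_line \<eta> = F \<eta>" if \<eta>: "\<eta> \<in> W" for \<eta>
  proof -
    obtain w where w: "node_conic w" "\<eta> = exc_pt w" using \<eta> unfolding W_def exc_curve_eq by blast
    note wc = exc_rep_cone[OF w(1)]
    have gw: "g (exc_rep w) = \<Phi> (quat_of_vec w) *v e"
      unfolding g_def exc_matrix_def snd_exc_rep off_node_conic[OF w(1)] ..
    have nz: "g (exc_rep w) \<noteq> 0" using \<eta> amb(2)[OF _ openin_topspace wc] by (simp add: W_def w(2))
    have "\<Phi> (quat_of_vec w) ** \<Phi> (quat_of_vec w) = 0"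
      using quat_of_conic(2)[OF w(1)] \<Phi>_rules(4)[of "quat_of_vec w" "quat_of_vec w"] \<Phi>_zero by simp
    from punctured_range_nilpotent[OF this] nz show ?thesis
      unfolding w(2) exc_line[OF w(1)] using amb(4)[OF _ openin_topspace wc] gw by simp
  qed
  moreover have "\<xi> \<in> W"
    using amb(2)[OF _ openin_topspace exc_rep_cone[OF u(1)]] e u
    unfolding W_def u(2) g_def exc_matrix_def snd_exc_rep off_node_conic[OF u(1)]
    by (auto simp: N_def points_proj_space exc_curve_eq)
  moreover have "{\<eta> \<in> W. F \<eta> \<in> V} = O' V \<inter> ?E" if "openin (ztop proj_space) V" for V
    using inW[OF that] by blast
  ultimately show "\<exists>W F. openin (ztop ?Y) W \<and> \<xi> \<in> W \<and>
      (\<forall>V. openin (ztop proj_space) V \<longrightarrow> openin (ztop ?Y) {y \<in> W. F y \<in> V}) \<and>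
      (\<forall>V h. openin (ztop proj_space) V \<longrightarrow> h \<in> reg proj_space V \<longrightarrow> h \<circ> F \<in> reg ?Y {y \<in> W. F y \<in> V}) \<and>
      (\<forall>y\<in>W. exc_line y = F y)"
    using Yopen Yreg by (intro exI[of _ W] exI[of _ F]) (simp add: W_def)
qed

end

lemma reflection_exc_curve:
  fixes \<gamma> :: "'k::{alg_closed_field, field_char_0} xpoint \<Rightarrow> 'k xpoint"
  assumes "a \<noteq> b" "covering_involution (P_node a b) \<gamma>" "\<xi> \<in> exc_curve"
  shows "\<gamma> \<xi> \<in> exc_curve"
proof -
  obtain u where "node_conic u" "\<xi> = exc_pt u" using assms(3) unfolding exc_curve_eq by blast
  then show ?thesis
    using covering_involution_reflection[OF assms(1,2), of u] unfolding exc_curve_eq by blast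
qed

lemma off_node_edge_vec:
  assumes "a \<noteq> b"
  shows "off_node (edge_vec a b) $ 4 = (0 :: 'k::field_char_0)" "sum (($) (off_node (edge_vec a b :: 'k ^ 5))) UNIV = 0"
proof -
  have "sum (($) (edge_vec a b :: 'k ^ 5)) UNIV = 0"
    using exhaust_5[of a] exhaust_5[of b] assms by (elim disjE) (simp_all add: edge_vec_def sum_5)
  then show "sum (($) (off_node (edge_vec a b :: 'k ^ 5))) UNIV = 0"
    by (simp only: off_node_def sum_add sum_scale sum_node_vec) simp
qed (simp add: off_node_nth)

definition edge_quat :: "5 \<Rightarrow> 5 \<Rightarrow> 'k::field quat" where
  "edge_quat a b = quat_of_vec (off_node (edge_vec a b))"

lemma edge_quat_values:
  "edge_quat a b = Quat 0
    (off_node (edge_vec a b) $ 0 + off_node (edge_vec a b) $ 1)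
    (off_node (edge_vec a b) $ 0 + off_node (edge_vec a b) $ 2)
    (off_node (edge_vec a b) $ 0 + off_node (edge_vec a b) $ 3)"
  by (simp add: edge_quat_def quat_of_vec_def)

text \<open>A pure quaternion squares to minus its norm, which is 2 if both indices differ from 4
  and 3/4 otherwise. Hence its matrix is invertible.\<close>

lemma edge_quat_square:
  assumes "a \<noteq> b"
  shows "\<exists>c::'k::field_char_0. c \<noteq> 0 \<and> edge_quat a b * edge_quat a b = quat_scale c 1"
proof (intro exI conjI)
  show "edge_quat a b * edge_quat a b = quat_scale (q_re (edge_quat a b * edge_quat a b)) (1 :: 'k quat)"
    unfolding edge_quat_def by (rule quat_of_vec_square)
  show "q_re (edge_quat a b * edge_quat a b :: 'k quat) \<noteq> 0"
    using exhaust_5[of a] exhaust_5[of b] assms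
    by (elim disjE) (simp_all add: edge_quat_values off_node_nth edge_vec_def field_simps)
qed

section \<open>The bi-anticanonical curve in the quotient surface and its coordinate\<close>

locale coble_curve = exc_parametrization \<Phi>
  for \<Phi> :: "'k::{alg_closed_field, field_char_0} quat \<Rightarrow> 'k ^ 2 ^ 2" +
  fixes \<sigma> :: "'k xpoint \<Rightarrow> 'k xpoint"
  assumes \<sigma>: "induced_by_cremona \<sigma>"
begin

lemma \<sigma>_morphism: "morphism X_surface X_surface \<sigma>"
  and \<sigma>_involution: "\<xi> \<in> points X_surface \<Longrightarrow> \<sigma> (\<sigma> \<xi>) = \<xi>"
  using \<sigma> by (simp_all add: induced_by_cremona_def isomorphism_def)

lemma \<sigma>_exc_curve: "\<xi> \<in> exc_curve \<Longrightarrow> \<sigma> \<xi> = \<xi>"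
  using cremona_fixes_exc_pt[OF \<sigma>] unfolding exc_curve_eq by blast

lemma quotient_exc: "\<xi> \<in> exc_curve \<Longrightarrow> quotient_map_S \<sigma> \<xi> = {\<xi>}"
  using \<sigma>_exc_curve by (auto simp: quotient_map_S_def sigma_rel_def exc_curve_def)

lemma C_curve_eq: "C_curve \<sigma> = subspace_of (S_surface \<sigma>) (quotient_map_S \<sigma> ` exc_curve)"
  by (simp add: C_curve_def exc_curve_def)

lemma points_S: "points (S_surface \<sigma>) = quotient_map_S \<sigma> ` points X_surface"
  by (auto simp: S_surface_def points_quotient_space quotient_map_S_def quotient_def)

lemma exc_curve_subset: "exc_curve \<subseteq> points X_surface"
  by (auto simp: exc_curve_def)

lemma points_C: "points (C_curve \<sigma>) = quotient_map_S \<sigma> ` exc_curve"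
  using exc_curve_subset by (auto simp: C_curve_eq points_subspace_of points_S)

lemma function_sheaf_S: "function_sheaf (S_surface \<sigma>)"
  unfolding S_surface_def by (intro function_sheaf_quotient_space function_sheaf_X)

text \<open>The classes on the curve are singletons, since \<open>\<sigma>\<close> fixes it pointwise.\<close>

definition curve_param :: "'k xpoint set \<Rightarrow> ('k ^ 2) set" where
  "curve_param c = exc_line (SOME \<xi>. \<xi> \<in> c)"

text \<open>Rescaling the chosen vector rescales \<open>conic_vec\<close> by a square, which leaves
  the point of the exceptional curve unchanged.\<close>

definition curve_point :: "('k ^ 2) set \<Rightarrow> 'k xpoint set" where
  "curve_point P = quotient_map_S \<sigma> (exc_pt (conic_vec (SOME v. v \<in> P)))"

lemma exc_pt_in_exc_curve: "node_conic u \<Longrightarrow> exc_pt u \<in> (exc_curve :: 'k xpoint set)"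
  unfolding exc_curve_eq by blast

lemma curve_param_quotient: "\<xi> \<in> exc_curve \<Longrightarrow> curve_param (quotient_map_S \<sigma> \<xi>) = exc_line \<xi>"
  by (simp add: curve_param_def quotient_exc)

lemma curve_point_pt:
  assumes v: "v \<noteq> 0"
  shows "curve_point (pt v) = quotient_map_S \<sigma> (exc_pt (conic_vec v))"
proof -
  have "(SOME w. w \<in> pt v) \<in> pt v" using self_in_pt[OF v] by (rule someI)
  then obtain c where c: "c \<noteq> 0" "(SOME w. w \<in> pt v) = c *s v" by (auto simp: pt_eq[OF v])
  show ?thesis
    unfolding curve_point_def c(2) conic_vec_scale
    using exc_pt_scale[of "c\<^sup>2" "conic_vec v"] conic_vec(1)[OF v] c(1) by simp
qed

lemma curve_param_point: "v \<noteq> 0 \<Longrightarrow> curve_param (curve_point (pt v)) = pt v"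
  by (simp add: curve_point_pt curve_param_quotient exc_pt_in_exc_curve conic_vec exc_line_conic_vec)

lemma curve_point_param:
  assumes "c \<in> points (C_curve \<sigma>)"
  shows "curve_point (curve_param c) = c"
proof -
  obtain u where u: "node_conic u" "c = quotient_map_S \<sigma> (exc_pt u)"
    using assms unfolding points_C exc_curve_eq by blast
  obtain v where v: "v \<noteq> 0" "exc_pt u = exc_pt (conic_vec v)" using exc_pt_conic_vec[OF u(1)] by blast
  have "c = curve_point (pt v)" unfolding u(2) v(2) curve_point_pt[OF v(1)] ..
  then show ?thesis using curve_param_point[OF v(1)] by simp
qed

lemma morphism_curve_param: "morphism (C_curve \<sigma>) proj_space curve_param"
proof -
  have "morphism (C_curve \<sigma>) (subspace_of X_surface exc_curve) (\<lambda>c. SOME \<xi>. \<xi> \<in> c)"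
    unfolding C_curve_eq S_surface_def quotient_map_S_def[abs_def]
  proof (rule morphism_fixed_locus_of_quotient[OF function_sheaf_X \<sigma>_morphism \<sigma>_involution \<sigma>_exc_curve exc_curve_subset])
    show "sigma_rel \<sigma> = {(x, y). x \<in> points X_surface \<and> (y = x \<or> y = \<sigma> x)}" by (simp add: sigma_rel_def)
    show "(SOME \<eta>. \<eta> \<in> sigma_rel \<sigma> `` {\<xi>}) = \<xi>" if "\<xi> \<in> exc_curve" for \<xi>
      using quotient_exc[OF that] by (simp add: quotient_map_S_def)
  qed
  from morphism_comp[OF this morphism_exc_line] show ?thesis
    by (simp add: comp_def curve_param_def[abs_def])
qed

text \<open>On the punctured plane the map lifts to the polynomial map
  \<open>exc_rep (conic_vec v)\<close> into the cone. Passing to the quotients and subspaces that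
  define the curve keeps it a morphism.\<close>

lemma morphism_curve_point: "morphism proj_space (C_curve \<sigma>) curve_point"
  unfolding proj_space_def
proof (rule morphism_from_quotient)
  let ?A = "affine_part (- {0}) (vec_coords :: ('k ^ 2 \<Rightarrow> 'k) set)"
  let ?Z = "Hessian_singular :: ('k ^ 5) set set"
  have A: "function_sheaf ?A" by (rule function_sheaf_affine_part)
  have "morphism ?A (cone_space ?Z) (\<lambda>v. exc_rep (conic_vec v))"
  proof (rule morphism_affine)
    show "exc_rep (conic_vec v) \<in> blowup_cone ?Z" if "v \<in> - {0}" for v
      using that conic_vec(1) exc_rep_cone by blast
    fix k :: "('k, 5) blowup_cone \<Rightarrow> 'k" assume "k \<in> blowup_coords ?Z"
    then show "(\<lambda>v. k (exc_rep (conic_vec v))) \<in> polyfuns vec_coords"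
    proof (cases rule: blowup_coords_cases)
      case (1 i)
      then show ?thesis by (simp add: exc_rep_def polyfuns.const)
    next
      case (2 p i)
      then show ?thesis using conic_vec_polyfun[of i]
        by (cases "p = new_node") (simp_all add: exc_rep_def polyfuns.const)
    qed
  qed
  from morphism_comp[OF this morphism_quotient_map[of _ "blowup_rel ?Z"]]
  have "morphism ?A (blowup_ambient ?Z) (\<lambda>v. exc_pt (conic_vec v))"
    by (simp add: blowup_ambient_def comp_def)
  then have "morphism ?A (subspace_of (blowup_ambient ?Z) (points X_surface)) (\<lambda>v. exc_pt (conic_vec v))"
    by (rule morphism_into_subspace[OF A]) (simp add: points_affine_part conic_vec exc_pt_in_X)
  then have "morphism ?A X_surface (\<lambda>v. exc_pt (conic_vec v))"
    unfolding X_surface_eq H.blowup_eq[symmetric] .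
  from morphism_comp[OF this morphism_quotient_map[of _ "sigma_rel \<sigma>"]]
  have "morphism ?A (S_surface \<sigma>) (\<lambda>v. quotient_map_S \<sigma> (exc_pt (conic_vec v)))"
    by (simp add: S_surface_def quotient_map_S_def comp_def)
  then have "morphism ?A (C_curve \<sigma>) (\<lambda>v. quotient_map_S \<sigma> (exc_pt (conic_vec v)))"
    unfolding C_curve_eq
    by (rule morphism_into_subspace[OF A]) (simp add: points_affine_part conic_vec exc_pt_in_exc_curve)
  then show "morphism ?A (C_curve \<sigma>) (\<lambda>v. curve_point (prop_rel `` {v}))"
    by (rule morphism_cong[OF A]) (simp add: points_affine_part curve_point_pt[unfolded pt_def])
qed

lemma isomorphism_curve_param: "isomorphism (C_curve \<sigma>) proj_space curve_param"
  unfolding isomorphism_def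
proof (intro conjI exI)
  show "\<forall>P\<in>points proj_space. curve_param (curve_point P) = P"
    using curve_param_point unfolding points_proj_space by blast
qed (use morphism_curve_param morphism_curve_point curve_point_param in auto)

text \<open>Since \<open>g\<close> is induced by an involution of the resolution that preserves the
  exceptional curve, it is an involution preserving the image of that curve.\<close>

lemma automorphism_C:
  assumes ab: "a \<noteq> b" and g: "induced_projection_involution \<sigma> (P_node a b) g"
  shows "automorphism (C_curve \<sigma>) g"
proof -
  obtain \<gamma> where \<gamma>: "covering_involution (P_node a b) \<gamma>"
    "\<And>\<xi>. \<xi> \<in> points X_surface \<Longrightarrow> g (quotient_map_S \<sigma> \<xi>) = quotient_map_S \<sigma> (\<gamma> \<xi>)"
    using g unfolding induced_projection_involution_def by blast
  have \<gamma>X: "\<gamma> \<xi> \<in> points X_surface" "\<gamma> (\<gamma> \<xi>) = \<xi>" if "\<xi> \<in> points X_surface" for \<xi>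
    using \<gamma>(1) that morphism_points[of X_surface X_surface \<gamma> \<xi>]
    by (auto simp: covering_involution_def isomorphism_def)
  show ?thesis
    unfolding C_curve_eq
  proof (rule automorphism_subspace[OF function_sheaf_S])
    show "automorphism (S_surface \<sigma>) g" using g by (simp add: induced_projection_involution_def)
    show "g x \<in> quotient_map_S \<sigma> ` exc_curve" if x: "x \<in> quotient_map_S \<sigma> ` exc_curve" for x
    proof -
      obtain \<xi> where \<xi>: "\<xi> \<in> exc_curve" "x = quotient_map_S \<sigma> \<xi>" using x by (elim imageE) (rule that)
      then have "g x = quotient_map_S \<sigma> (\<gamma> \<xi>)" using \<gamma>(2) exc_curve_subset by blast
      then show ?thesis using reflection_exc_curve[OF ab \<gamma>(1) \<xi>(1)] by (rule image_eqI)
    qed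
    show "g (g x) = x" if x: "x \<in> points (S_surface \<sigma>)" for x
    proof -
      obtain \<xi> where \<xi>: "\<xi> \<in> points X_surface" "x = quotient_map_S \<sigma> \<xi>"
        using x unfolding points_S by (elim imageE) (rule that)
      have "g (g x) = quotient_map_S \<sigma> (\<gamma> (\<gamma> \<xi>))"
        by (simp only: \<xi>(2) \<gamma>(2)[OF \<xi>(1)] \<gamma>(2)[OF \<gamma>X(1)[OF \<xi>(1)]])
      then show ?thesis by (simp only: \<gamma>X(2)[OF \<xi>(1)] \<xi>(2))
    qed
  qed
qed

text \<open>If n has image spanned by v, then D n D has image spanned by D v: the right factor is
  invertible and does not change the image, the left factor moves it.\<close>

lemma exc_line_reflection:
  assumes ab: "a \<noteq> b" and v: "v \<noteq> 0"
    and r: "node_conic (reflection (off_node (edge_vec a b)) (conic_vec v))"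
  shows "exc_line (exc_pt (reflection (off_node (edge_vec a b)) (conic_vec v))) = pt (\<Phi> (edge_quat a b) *v v)"
    and "\<Phi> (edge_quat a b) *v v \<noteq> 0"
proof -
  define D where "D = \<Phi> (edge_quat a b)"
  obtain c :: 'k where c: "c \<noteq> 0" "edge_quat a b * edge_quat a b = quat_scale c 1"
    using edge_quat_square[OF ab, where 'k = 'k] by (elim exE conjE) (rule that)
  have "D ** D = (\<chi> i j. c * mat 1 $ i $ j)"
    unfolding D_def \<Phi>_rules(4)[symmetric] c(2) \<Phi>_rules(5) \<Phi>_rules(2) ..
  then have DD: "D *v (D *v w) = c *s w" for w
    by (simp add: matrix_vector_mul_assoc vec_eq_iff forall_2 matrix_2_vector mat_def)
  show nz: "\<Phi> (edge_quat a b) *v v \<noteq> 0"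
  proof
    assume "\<Phi> (edge_quat a b) *v v = 0"
    then have "c *s v = 0" using DD[of v] by (simp add: D_def)
    then show False using c v by simp
  qed
  note cv = conic_vec[OF v]
  let ?r = "reflection (off_node (edge_vec a b)) (conic_vec v)"
  have q: "quat_of_vec ?r = edge_quat a b * quat_of_vec (conic_vec v) * edge_quat a b"
    unfolding edge_quat_def using cv(1) off_node_edge_vec[OF ab]
    by (intro quat_of_vec_reflection) (simp_all add: node_conic_def)
  have M: "\<Phi> (quat_of_vec ?r) = D ** nilpotent_of v ** D"
    unfolding q \<Phi>_rules(4) cv(2) D_def ..
  have sq: "\<Phi> (quat_of_vec ?r) ** \<Phi> (quat_of_vec ?r) = 0"
    using quat_of_conic(2)[OF r] \<Phi>_rules(4)[of "quat_of_vec ?r" "quat_of_vec ?r"] \<Phi>_zero by simp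
  obtain e where e: "\<Phi> (quat_of_vec ?r) *v e \<noteq> 0"
  proof -
    have "\<Phi> (quat_of_vec ?r) \<noteq> 0"
      using quat_of_conic(1)[OF r] \<Phi>_eq_iff[of "quat_of_vec ?r" 0] \<Phi>_zero by simp
    then have "\<exists>e. \<Phi> (quat_of_vec ?r) *v e \<noteq> 0"
      by (metis matrix_eq matrix_vector_mult_0)
    then show ?thesis using that by blast
  qed
  have Me: "\<Phi> (quat_of_vec ?r) *v e = (v $ 2 * (D *v e) $ 1 - v $ 1 * (D *v e) $ 2) *s (D *v v)"
    unfolding M matrix_vector_mul_assoc[symmetric] nilpotent_of_vector
    by (simp add: vec_eq_iff matrix_2_vector algebra_simps)
  have "exc_line (exc_pt ?r) = pt (\<Phi> (quat_of_vec ?r) *v e)"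
    using exc_line[OF r] punctured_range_nilpotent[OF sq e] by simp
  also have "\<dots> = pt (D *v v)"
    using e unfolding Me by (intro pt_scale) auto
  finally show "exc_line (exc_pt ?r) = pt (\<Phi> (edge_quat a b) *v v)" unfolding D_def .
qed

end

context coble_curve
begin

definition quat_pgl :: "'k quat \<Rightarrow> ('k ^ 2) set \<Rightarrow> ('k ^ 2) set" where
  "quat_pgl q = pgl_act (pgl_class (\<Phi> q))"

lemma quat_pgl_pt:
  assumes "v \<noteq> 0" "\<Phi> q *v v \<noteq> 0"
  shows "quat_pgl q (pt v) = pt (\<Phi> q *v v)"
proof -
  have scale: "(\<chi> i j. c * \<Phi> q $ i $ j) *v (d *s v) = (c * d) *s (\<Phi> q *v v)" for c d
    by (simp add: vec_eq_iff matrix_2_vector algebra_simps)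
  have "quat_pgl q (pt v) = {A *v w | A w. A \<in> pgl_class (\<Phi> q) \<and> w \<in> pt v}"
    using assms(1) by (auto simp: quat_pgl_def pgl_act_def points_proj_space)
  also have "\<dots> = {e *s (\<Phi> q *v v) | e. e \<noteq> 0}" (is "?L = ?R")
  proof
    show "?L \<subseteq> ?R"
    proof
      fix x assume "x \<in> ?L"
      then obtain c d where cd: "c \<noteq> 0" "d \<noteq> 0" "x = (\<chi> i j. c * \<Phi> q $ i $ j) *v (d *s v)"
        unfolding pgl_class_def pt_eq[OF assms(1)] by blast
      then have "x = (c * d) *s (\<Phi> q *v v)" "c * d \<noteq> 0" by (simp_all only: scale) simp
      then show "x \<in> ?R" by blast
    qed
    show "?R \<subseteq> ?L"
    proof
      fix x assume "x \<in> ?R"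
      then obtain e where e: "e \<noteq> 0" "x = e *s (\<Phi> q *v v)" by blast
      then have "x = (\<chi> i j. e * \<Phi> q $ i $ j) *v (1 *s v)" unfolding scale by simp
      moreover have "(\<chi> i j. e * \<Phi> q $ i $ j) \<in> pgl_class (\<Phi> q)" using e(1) by (auto simp: pgl_class_def)
      moreover have "1 *s v \<in> pt v" using self_in_pt[OF assms(1)] by simp
      ultimately show "x \<in> ?L" by blast
    qed
  qed
  finally show ?thesis unfolding pt_eq[OF assms(2)] .
qed

lemma quat_pgl_scale:
  assumes c: "c \<noteq> 0"
  shows "quat_pgl (quat_scale c q) = quat_pgl q"
proof -
  have "pgl_class (\<Phi> (quat_scale c q)) = pgl_class (\<Phi> q)"
  proof -
    have "{\<chi> i j. d * (c * \<Phi> q $ i $ j) | d. d \<noteq> 0} = {\<chi> i j. d * \<Phi> q $ i $ j | d. d \<noteq> 0}" (is "?L = ?R")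
    proof
      show "?L \<subseteq> ?R"
      proof
        fix A assume "A \<in> ?L"
        then obtain d where "d \<noteq> 0" "A = (\<chi> i j. d * (c * \<Phi> q $ i $ j))" by blast
        then have "d * c \<noteq> 0" "A = (\<chi> i j. (d * c) * \<Phi> q $ i $ j)" using c by (simp_all add: mult.assoc)
        then show "A \<in> ?R" by blast
      qed
      show "?R \<subseteq> ?L"
      proof
        fix A assume "A \<in> ?R"
        then obtain d where "d \<noteq> 0" "A = (\<chi> i j. d * \<Phi> q $ i $ j)" by blast
        then have "d / c \<noteq> 0" "A = (\<chi> i j. (d / c) * (c * \<Phi> q $ i $ j))" using c by simp_all
        then show "A \<in> ?L" by blast
      qed
    qed
    then show ?thesis by (simp add: pgl_class_def \<Phi>_rules)
  qed
  then show ?thesis by (simp add: quat_pgl_def)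
qed

text \<open>A vector \<open>v\<close> is followed through its point on the conic, the reflection
  there, and the image of the reflected nilpotent matrix. The sets representing points are handled
  by \<open>curve_point_pt\<close> and \<open>quat_pgl_pt\<close>.\<close>

lemma transport_eq:
  assumes ab: "a \<noteq> b" and g: "induced_projection_involution \<sigma> (P_node a b) g"
  shows "transport (C_curve \<sigma>) proj_space curve_param g = quat_pgl (edge_quat a b)"
proof
  fix P :: "('k ^ 2) set"
  show "transport (C_curve \<sigma>) proj_space curve_param g P = quat_pgl (edge_quat a b) P"
  proof (cases "P \<in> points proj_space")
    case False
    then show ?thesis by (simp add: transport_def quat_pgl_def pgl_act_def)
  next
    case True
    then obtain v where v: "v \<noteq> 0" "P = pt v" by (auto simp: points_proj_space)
    obtain \<gamma> where \<gamma>: "covering_involution (P_node a b) \<gamma>"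
      "\<And>\<xi>. \<xi> \<in> points X_surface \<Longrightarrow> g (quotient_map_S \<sigma> \<xi>) = quotient_map_S \<sigma> (\<gamma> \<xi>)"
      using g unfolding induced_projection_involution_def by blast
    note cv = conic_vec(1)[OF v(1)]
    let ?r = "reflection (off_node (edge_vec a b)) (conic_vec v)"
    have r: "node_conic ?r" "\<gamma> (exc_pt (conic_vec v)) = exc_pt ?r"
      using covering_involution_reflection[OF ab \<gamma>(1) cv] by simp_all
    have "the_inv_into (points (C_curve \<sigma>)) curve_param P = curve_point P"
    proof (rule the_inv_into_f_eq)
      show "inj_on curve_param (points (C_curve \<sigma>))"
        using isomorphism_bij_betw[OF isomorphism_curve_param] by (rule bij_betw_imp_inj_on)
      show "curve_param (curve_point P) = P" using curve_param_point v by simp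
      show "curve_point P \<in> points (C_curve \<sigma>)"
        using v exc_pt_in_exc_curve[OF cv] by (auto simp: curve_point_pt points_C)
    qed
    then have "transport (C_curve \<sigma>) proj_space curve_param g P = curve_param (g (curve_point P))"
      using True by (simp add: transport_def)
    also have "g (curve_point P) = quotient_map_S \<sigma> (exc_pt ?r)"
      unfolding v(2) curve_point_pt[OF v(1)] \<gamma>(2)[OF exc_pt_in_X[OF cv]] r(2) ..
    also have "curve_param \<dots> = exc_line (exc_pt ?r)"
      by (rule curve_param_quotient[OF exc_pt_in_exc_curve[OF r(1)]])
    also have "\<dots> = pt (\<Phi> (edge_quat a b) *v v)" by (rule exc_line_reflection(1)[OF ab v(1) r(1)])
    also have "\<dots> = quat_pgl (edge_quat a b) P"
      unfolding v(2) using quat_pgl_pt[OF v(1) exc_line_reflection(2)[OF ab v(1) r(1)]] by simp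
    finally show ?thesis .
  qed
qed

section \<open>Matching the edge vectors with the two lists of quaternions\<close>

lemma edge_quat_pgl:
  assumes "c \<noteq> 0" "(edge_quat a b :: 'k quat) = quat_scale c (map_quat of_rat q)"
  shows "pgl_of_quat \<Phi> q = quat_pgl (edge_quat a b)"
  unfolding assms(2) quat_pgl_scale[OF assms(1)] by (simp add: pgl_of_quat_def quat_pgl_def)

lemmas edge_quat_simps = quat_eq_iff edge_quat_values quat.map_sel off_node_nth edge_vec_def of_rat_minus

text \<open>The sum-free part of \<open>edge_vec a 4\<close> has entries 3/4 and -1/4, whence
  imaginary parts with values 1/2 or -1/2. Opposite sign patterns belong to the same index, so eight
  patterns give four maps.\<close>

lemma edge_quat_pgl_last:
  shows "pgl_of_quat \<Phi> (1 * quat_i + 1 * quat_j + 1 * quat_k) = quat_pgl (edge_quat 0 4)"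
    "pgl_of_quat \<Phi> (1 * quat_i + 1 * quat_j + - 1 * quat_k) = quat_pgl (edge_quat 3 4)"
    "pgl_of_quat \<Phi> (1 * quat_i + - 1 * quat_j + 1 * quat_k) = quat_pgl (edge_quat 2 4)"
    "pgl_of_quat \<Phi> (1 * quat_i + - 1 * quat_j + - 1 * quat_k) = quat_pgl (edge_quat 1 4)"
    "pgl_of_quat \<Phi> (- 1 * quat_i + 1 * quat_j + 1 * quat_k) = quat_pgl (edge_quat 1 4)"
    "pgl_of_quat \<Phi> (- 1 * quat_i + 1 * quat_j + - 1 * quat_k) = quat_pgl (edge_quat 2 4)"
    "pgl_of_quat \<Phi> (- 1 * quat_i + - 1 * quat_j + 1 * quat_k) = quat_pgl (edge_quat 3 4)"
    "pgl_of_quat \<Phi> (- 1 * quat_i + - 1 * quat_j + - 1 * quat_k) = quat_pgl (edge_quat 0 4)"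
proof -
  show "pgl_of_quat \<Phi> (1 * quat_i + 1 * quat_j + 1 * quat_k) = quat_pgl (edge_quat 0 4)"
    by (rule edge_quat_pgl[of "1 / 2"]) (simp_all add: edge_quat_simps)
  show "pgl_of_quat \<Phi> (1 * quat_i + 1 * quat_j + - 1 * quat_k) = quat_pgl (edge_quat 3 4)"
    by (rule edge_quat_pgl[of "- 1 / 2"]) (simp_all add: edge_quat_simps)
  show "pgl_of_quat \<Phi> (1 * quat_i + - 1 * quat_j + 1 * quat_k) = quat_pgl (edge_quat 2 4)"
    by (rule edge_quat_pgl[of "- 1 / 2"]) (simp_all add: edge_quat_simps)
  show "pgl_of_quat \<Phi> (1 * quat_i + - 1 * quat_j + - 1 * quat_k) = quat_pgl (edge_quat 1 4)"
    by (rule edge_quat_pgl[of "1 / 2"]) (simp_all add: edge_quat_simps)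
  show "pgl_of_quat \<Phi> (- 1 * quat_i + 1 * quat_j + 1 * quat_k) = quat_pgl (edge_quat 1 4)"
    by (rule edge_quat_pgl[of "- 1 / 2"]) (simp_all add: edge_quat_simps)
  show "pgl_of_quat \<Phi> (- 1 * quat_i + 1 * quat_j + - 1 * quat_k) = quat_pgl (edge_quat 2 4)"
    by (rule edge_quat_pgl[of "1 / 2"]) (simp_all add: edge_quat_simps)
  show "pgl_of_quat \<Phi> (- 1 * quat_i + - 1 * quat_j + 1 * quat_k) = quat_pgl (edge_quat 3 4)"
    by (rule edge_quat_pgl[of "1 / 2"]) (simp_all add: edge_quat_simps)
  show "pgl_of_quat \<Phi> (- 1 * quat_i + - 1 * quat_j + - 1 * quat_k) = quat_pgl (edge_quat 0 4)"
    by (rule edge_quat_pgl[of "- 1 / 2"]) (simp_all add: edge_quat_simps)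
qed

text \<open>Here the edge quaternion is exactly the one listed, without a scalar; reversing the
  order of the indices accounts for the opposite signs.\<close>

lemma edge_quat_pgl_pairs:
  shows "pgl_of_quat \<Phi> (1 * quat_i + 1 * quat_j) = quat_pgl (edge_quat 0 3)"
    "pgl_of_quat \<Phi> (1 * quat_i + - 1 * quat_j) = quat_pgl (edge_quat 1 2)"
    "pgl_of_quat \<Phi> (- 1 * quat_i + 1 * quat_j) = quat_pgl (edge_quat 2 1)"
    "pgl_of_quat \<Phi> (- 1 * quat_i + - 1 * quat_j) = quat_pgl (edge_quat 3 0)"
    "pgl_of_quat \<Phi> (1 * quat_j + 1 * quat_k) = quat_pgl (edge_quat 0 1)"
    "pgl_of_quat \<Phi> (1 * quat_j + - 1 * quat_k) = quat_pgl (edge_quat 2 3)"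
    "pgl_of_quat \<Phi> (- 1 * quat_j + 1 * quat_k) = quat_pgl (edge_quat 3 2)"
    "pgl_of_quat \<Phi> (- 1 * quat_j + - 1 * quat_k) = quat_pgl (edge_quat 1 0)"
    "pgl_of_quat \<Phi> (1 * quat_k + 1 * quat_i) = quat_pgl (edge_quat 0 2)"
    "pgl_of_quat \<Phi> (1 * quat_k + - 1 * quat_i) = quat_pgl (edge_quat 3 1)"
    "pgl_of_quat \<Phi> (- 1 * quat_k + 1 * quat_i) = quat_pgl (edge_quat 1 3)"
    "pgl_of_quat \<Phi> (- 1 * quat_k + - 1 * quat_i) = quat_pgl (edge_quat 2 0)"
  by (rule edge_quat_pgl[of 1], simp, simp add: edge_quat_simps)+

lemma edge_quats_last:
  "{quat_pgl (edge_quat a 4) | a. a \<noteq> 4} =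
    pgl_of_quat \<Phi> ` {s * quat_i + t * quat_j + u * quat_k | s t u. {s, t, u} \<subseteq> {1, - 1}}" (is "?L = ?R")
proof
  show "?L \<subseteq> ?R"
  proof
    fix x assume "x \<in> ?L"
    then obtain a where a: "x = quat_pgl (edge_quat a 4)" "a \<noteq> 4" by blast
    have "\<exists>s t u. {s, t, u} \<subseteq> {1, - 1} \<and> x = pgl_of_quat \<Phi> (s * quat_i + t * quat_j + u * quat_k)"
      using exhaust_5[of a]
    proof (elim disjE)
      assume "a = 0"
      then show ?thesis unfolding a(1)
        by (intro exI[of _ 1] conjI) (simp, simp only: edge_quat_pgl_last)
    next
      assume "a = 1"
      then show ?thesis unfolding a(1)
        by (intro exI[of _ 1] exI[of _ "- 1"] conjI) (simp, simp only: edge_quat_pgl_last)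
    next
      assume "a = 2"
      then show ?thesis unfolding a(1)
        by (intro exI[of _ "- 1"] exI[of _ 1] exI[of _ "- 1"] conjI) (simp, simp only: edge_quat_pgl_last)
    next
      assume "a = 3"
      then show ?thesis unfolding a(1)
        by (intro exI[of _ "- 1"] exI[of _ "- 1"] exI[of _ 1] conjI) (simp, simp only: edge_quat_pgl_last)
    qed (use a(2) in simp)
    then show "x \<in> ?R" by blast
  qed
  have ne: "(0::5) \<noteq> 4" "(1::5) \<noteq> 4" "(2::5) \<noteq> 4" "(3::5) \<noteq> 4" by simp_all
  show "?R \<subseteq> ?L"
  proof
    fix x assume "x \<in> ?R"
    then obtain s t u where stu: "x = pgl_of_quat \<Phi> (s * quat_i + t * quat_j + u * quat_k)" "{s, t, u} \<subseteq> {1, - 1}"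
      by blast
    then have "s = 1 \<or> s = - 1" "t = 1 \<or> t = - 1" "u = 1 \<or> u = - 1" by simp_all
    then have "\<exists>a. a \<noteq> 4 \<and> x = quat_pgl (edge_quat a 4)"
      unfolding stu(1) by (elim disjE) (simp_all only: edge_quat_pgl_last, (use ne in blast)+)
    then show "x \<in> ?L" by blast
  qed
qed

lemma edge_quats_pairs:
  "{quat_pgl (edge_quat a b) | a b. a \<noteq> b \<and> a \<noteq> 4 \<and> b \<noteq> 4} =
    pgl_of_quat \<Phi> ` ({s * quat_i + t * quat_j | s t. {s, t} \<subseteq> {1, - 1}} \<union>
                      {s * quat_j + t * quat_k | s t. {s, t} \<subseteq> {1, - 1}} \<union>
                      {s * quat_k + t * quat_i | s t. {s, t} \<subseteq> {1, - 1}})" (is "?L = ?R")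
proof
  show "?L \<subseteq> ?R"
  proof
    fix x assume "x \<in> ?L"
    then obtain a b where ab: "x = quat_pgl (edge_quat a b)" "a \<noteq> b" "a \<noteq> 4" "b \<noteq> 4" by blast
    have I: "x \<in> ?R" if "{s, t} \<subseteq> {1, - 1}" "x = pgl_of_quat \<Phi> (s * quat_i + t * quat_j) \<or>
      x = pgl_of_quat \<Phi> (s * quat_j + t * quat_k) \<or> x = pgl_of_quat \<Phi> (s * quat_k + t * quat_i)" for s t
      using that by blast
    have sub: "{1, 1} \<subseteq> {1, - 1 :: rat quat}" "{1, - 1} \<subseteq> {1, - 1 :: rat quat}"
      "{- 1, 1} \<subseteq> {1, - 1 :: rat quat}" "{- 1, - 1} \<subseteq> {1, - 1 :: rat quat}" by simp_all
    note J = I[OF sub(1)] I[OF sub(2)] I[OF sub(3)] I[OF sub(4)]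
    show "x \<in> ?R"
      using exhaust_5[of a] exhaust_5[of b] ab(2-4) J unfolding edge_quat_pgl_pairs ab(1)
      by (elim disjE) (simp_all only: simp_thms)
  qed
  have ne: "(0::5) \<noteq> 4" "(1::5) \<noteq> 4" "(2::5) \<noteq> 4" "(3::5) \<noteq> 4" "(0::5) \<noteq> 1" "(0::5) \<noteq> 2" "(0::5) \<noteq> 3"
    "(1::5) \<noteq> 2" "(1::5) \<noteq> 3" "(2::5) \<noteq> 3" by simp_all
  show "?R \<subseteq> ?L"
  proof
    fix x assume "x \<in> ?R"
    then obtain s t where st: "{s, t} \<subseteq> {1, - 1}" "x = pgl_of_quat \<Phi> (s * quat_i + t * quat_j) \<or>
      x = pgl_of_quat \<Phi> (s * quat_j + t * quat_k) \<or> x = pgl_of_quat \<Phi> (s * quat_k + t * quat_i)" by blast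
    then have "s = 1 \<or> s = - 1" "t = 1 \<or> t = - 1" by simp_all
    then have "\<exists>a b. a \<noteq> b \<and> a \<noteq> 4 \<and> b \<noteq> 4 \<and> x = quat_pgl (edge_quat a b)"
      using st(2) by (elim disjE) (simp_all only: edge_quat_pgl_pairs, (use ne in metis)+)
    then show "x \<in> ?L" by blast
  qed
qed

end

theorem theorem5p1:
  fixes \<sigma> :: "'k::{alg_closed_field, field_char_0} xpoint \<Rightarrow> 'k xpoint"
    and g :: "5 \<Rightarrow> 5 \<Rightarrow> 'k xpoint set \<Rightarrow> 'k xpoint set"
    and \<Phi> :: "'k quat \<Rightarrow> 'k ^ 2 ^ 2"
  assumes "induced_by_cremona \<sigma>"
    and "\<And>a b. a \<noteq> b \<Longrightarrow> induced_projection_involution \<sigma> (P_node a b) (g a b)"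
    and "quat_matrix_iso \<Phi>"
  shows "(\<forall>a b. a \<noteq> b \<longrightarrow> automorphism (C_curve \<sigma>) (g a b)) \<and>
    (\<exists>\<phi>. isomorphism (C_curve \<sigma>) (proj_space :: (('k ^ 2) set, 'k) fspace) \<phi> \<and>
      {transport (C_curve \<sigma>) proj_space \<phi> (g a 4) | a. a \<noteq> 4} =
        pgl_of_quat \<Phi> ` {s * quat_i + t * quat_j + u * quat_k | s t u. {s, t, u} \<subseteq> {1, - 1}} \<and>
      {transport (C_curve \<sigma>) proj_space \<phi> (g a b) | a b. a \<noteq> b \<and> a \<noteq> 4 \<and> b \<noteq> 4} =
        pgl_of_quat \<Phi> ` ({s * quat_i + t * quat_j | s t. {s, t} \<subseteq> {1, - 1}} \<union>
                          {s * quat_j + t * quat_k | s t. {s, t} \<subseteq> {1, - 1}} \<union>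
                          {s * quat_k + t * quat_i | s t. {s, t} \<subseteq> {1, - 1}}))"
proof -
  interpret coble_curve \<Phi> \<sigma> by unfold_locales (fact assms)+
  have tr: "transport (C_curve \<sigma>) proj_space curve_param (g a b) = quat_pgl (edge_quat a b)" if "a \<noteq> b" for a b
    by (rule transport_eq[OF that assms(2)[OF that]])
  have last: "{transport (C_curve \<sigma>) proj_space curve_param (g a 4) | a. a \<noteq> 4} =
      {quat_pgl (edge_quat a 4) | a. a \<noteq> 4}"
    by (intro Collect_cong iff_exI) (auto simp: tr)
  have pairs: "{transport (C_curve \<sigma>) proj_space curve_param (g a b) | a b. a \<noteq> b \<and> a \<noteq> 4 \<and> b \<noteq> 4} =
      {quat_pgl (edge_quat a b) | a b. a \<noteq> b \<and> a \<noteq> 4 \<and> b \<noteq> 4}"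
    by (intro Collect_cong iff_exI) (auto simp: tr)
  have "automorphism (C_curve \<sigma>) (g a b)" if "a \<noteq> b" for a b
    by (rule automorphism_C[OF that assms(2)[OF that]])
  then show ?thesis
    unfolding edge_quats_last[symmetric] edge_quats_pairs[symmetric] last[symmetric] pairs[symmetric]
    using isomorphism_curve_param by blast
qed

end
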